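(* There exists a unique Hopf superalgebra pairing $$\varphi:\mathrm{SPO}_q(2n|2m)\times U_q(\mathfrak{spo}(2n|2m))\longrightarrow\mathbb K$$ such that $$\varphi(t_{i,j},h)=\pi_{i,j}(h)\qquad\text{for all } i,j\in I \text{ and all } h\in U_q(\mathfrak{spo}(2n|2m)),$$ where $\pi_{i,j}(h)=\langle e'_i,\pi(h)e_j\rangle$ are the matrix elements of the vector representation $\pi$ of $U_q(\mathfrak{spo}(2n|2m))$ in $V$.
   Context: Setting. $\mathbb K$ is a field of characteristic zero, $q\in\mathbb K$ is nonzero and not a root of unity, $n,m\ge 1$ are integers, $r=n+m$, and $I=\{-r,\dots,-1,1,\dots,r\}$. Gradations are over $\mathbb Z_2$, with $\sigma(\alpha,\beta)=(-1)^{\alpha\beta}$. Degrees: $\eta_i=\bar 0$ for $1\le|i|\le n$ and $\eta_i=\bar 1$ for $n+1\le|i|\le r$; $\sigma_{i,j}=\sigma(\eta_i,\eta_j)$, $\sigma_i=\sigma_{i,i}$. $V$ is the $\mathbb Z_2$-graded vector space with basis $(e_i)_{i\in I}$, $e_i$ of degree $\eta_i$, $(e'_i)$ is the dual basis, and $E_{i,j}(e_k)=\delta_{jk}e_i$. Graded tensor product of linear maps: $(g\,\overline{\otimes}\,g')(x\otimes y)=\sigma(\gamma',\xi)g(x)\otimes g'(y)$ with $\gamma'=\deg g'$, $\xi=\deg x$. Tensor products of superalgebras carry the product $(a\otimes b)(a'\otimes b')=\sigma(\deg b,\deg a')\,aa'\otimes bb'$; bi-superalgebras and Hopf superalgebras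 are meant with respect to this product, with structure maps of degree zero. The quantum supergroup. The matrix $C^q=(C^q_{i,j})_{i,j\in I}$ has $C^q_{i,j}=0$ for $j\neq -i$, and for $1\le j\le r$: $C^q_{j,-j}=q^{\sum_{k=1}^{j}\sigma_k}$, $C^q_{-j,j}=-\sigma_j q^{-1-\sum_{k=1}^{j-1}\sigma_k}$. The operator $R=\sum R_{ij,k\ell}E_{i,k}\,\overline{\otimes}\,E_{j,\ell}$ in $V\otimes V$ is $$R=\sum_i q^{\sigma_i}E_{i,i}\overline{\otimes}E_{i,i}+\sum_i q^{-\sigma_i}E_{i,i}\overline{\otimes}E_{-i,-i}+\sum_{i\ne j,-j}E_{i,i}\overline{\otimes}E_{j,j}+(q-q^{-1})\sum_{i<j}\sigma_iE_{j,i}\overline{\otimes}E_{i,j}-(q-q^{-1})\sum_{i<j}\sigma_i\sigma_j\sigma_{i,j}((C^q)^{-1})_{-j,j}C^q_{i,-i}\,E_{j,i}\overline{\otimes}E_{-j,-i}.$$ $A(R)$ is the universal associative unital superalgebra generated by elements $t_{i,j}$ ($i,j\in I$) of degree $\eta_j-\eta_i$ with relations $$\sum_{a,b\in I}\sigma(\eta_j-\eta_\ell,\eta_a-\eta_k)R_{ij,ab}\,t_{a,k}t_{b,\ell}=\sum_{a,b\in I}\sigma(\eta_j-\eta_b,\eta_a-\eta_k)\,t_{j,b}t_{i,a}R_{ab,k\ell}\qquad(i,j,k,\ell\in I);$$ it is a bi-superalgebra with $\Delta(t_{i,j})=\sum_{k}\sigma(\eta_k-\eta_i,\eta_k-\eta_j)\,t_{i,k}\otimes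 t_{k,j}$, $\varepsilon(t_{i,j})=\delta_{i,j}$. The element $Q=(C^q_{k,-k})^{-1}\sum_{a,b\in I}\sigma_{a,k}\sigma_{b,a}C^q_{a,b}\,t_{a,k}t_{b,-k}\in A(R)$ does not depend on $k\in I$; it is of degree zero, group-like and central. $\mathrm{SPO}_q(2n|2m)=A(R)/J(Q)$, where $J(Q)$ is the two-sided ideal generated by $Q-1$ (a graded biideal). It is a Hopf superalgebra with antipode $S(t_{i,j})=\sigma_i\sigma_{i,j}((C^q)^{-1})_{i,-i}\,t_{-j,-i}\,C^q_{-j,j}$ (images of the generators are again denoted $t_{i,j}$). The quantum superalgebra. Let $\epsilon_1,\dots,\epsilon_r$ be a basis of a lattice with symmetric bilinear form $(\epsilon_a,\epsilon_b)=\sigma_a\delta_{ab}$, and put $\epsilon_{-a}=-\epsilon_a$. The simple roots are $\alpha_1=\epsilon_{-1}-\epsilon_1=-2\epsilon_1$ and $\alpha_j=\epsilon_{-j}-\epsilon_{-j+1}=\epsilon_{j-1}-\epsilon_j$ for $2\le j\le r$; $\alpha_{n+1}$ is odd, the others are even. Put $q_1=q^2$ and $q_j=q$ for $j\ge 2$. $\tilde U$ is the associative unital superalgebra with generators $K_j^{\pm1}$ (even), $E_j,F_j$ (of the parity of $\alpha_j$), $1\le j\le r$, and relations: the $K_j^{\pm1}$ commute, $K_jK_j^{-1}=1$, $K_jE_kK_j^{-1}=q^{(\alpha_j,\alpha_k)}E_k$, $K_jF_kK_j^{-1}=q^{-(\alpha_j,\alpha_k)}F_k$, and $E_jF_k-\sigma(\deg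 E_j,\deg F_k)F_kE_j=\delta_{jk}(K_j-K_j^{-1})/(q_j-q_j^{-1})$. It is a Hopf superalgebra with $\Delta(K_j)=K_j\otimes K_j$, $\Delta(E_j)=E_j\otimes 1+K_j\otimes E_j$, $\Delta(F_j)=F_j\otimes K_j^{-1}+1\otimes F_j$, $\varepsilon(K_j)=1$, $\varepsilon(E_j)=\varepsilon(F_j)=0$, $S(K_j)=K_j^{-1}$, $S(E_j)=-K_j^{-1}E_j$, $S(F_j)=-F_jK_j$. The quantum superalgebra $U_q(\mathfrak{spo}(2n|2m))$ is the quotient Hopf superalgebra of $\tilde U$ obtained by imposing the (higher order) quantum Serre relations among the $E_j$ and among the $F_j$, described as follows. Let $\mathcal F$ be the free associative superalgebra on $\theta_1,\dots,\theta_r$, $\theta_j$ of weight $\alpha_j$ and parity that of $\alpha_j$. Let $\partial_k:\mathcal F\to\mathcal F$ be the linear maps with $\partial_k(1)=0$, $\partial_k(\theta_j)=\delta_{jk}$, $\partial_k(xy)=x\,\partial_k(y)+\sigma(\deg\theta_k,\deg y)\,q^{(\alpha_k,\mathrm{wt}\,y)}\,\partial_k(x)\,y$. Let $\mathcal I$ be the span of all weight-homogeneous $x\in\mathcal F$ that are of degree $N\ge1$ in the generators and satisfy $\partial_{k_1}\cdots\partial_{k_N}x=0$ for all $k_1,\dots,k_N$. One imposes $x(E_1,\dots,E_r)=0$ and $x(F_1,\dots,F_r)=0$ for all $x\in\mathcal I$. The vector representation $\pi$ in $V$ is: $\pi(K_j)e_i=q^{(\alpha_j,\epsilon_i)}e_i$;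 $\pi(E_1)=E_{-1,1}$, $\pi(F_1)=E_{1,-1}$; and for $2\le j\le r$: $\pi(E_j)=E_{-j,-j+1}-\sigma_j\sigma_{j,j-1}E_{j-1,j}$, $\pi(F_j)=\sigma_j\,(E_{-j+1,-j}-E_{j,j-1})$. Pairings. A Hopf superalgebra pairing of Hopf superalgebras $A$ and $H$ is a bilinear form $\varphi:A\times H\to\mathbb K$, homogeneous of degree zero, such that for all homogeneous elements $\varphi(aa',h)=\sum_r\sigma(\deg a',\deg h^1_r)\varphi(a,h^1_r)\varphi(a',h^2_r)$ where $\Delta(h)=\sum_r h^1_r\otimes h^2_r$, $\varphi(a,hh')=\sum_s\sigma(\deg a^2_s,\deg h)\varphi(a^1_s,h)\varphi(a^2_s,h')$ where $\Delta(a)=\sum_s a^1_s\otimes a^2_s$, $\varphi(1,h)=\varepsilon(h)$, $\varphi(a,1)=\varepsilon(a)$, and $\varphi(S(a),h)=\varphi(a,S(h))$. *)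

theory Defs
  imports
    Complex_Main
    "HOL-Algebra.QuotRing"
    "HOL-Algebra.Module"
    "HOL-Library.Poly_Mapping"
    "HOL-Library.Z2"
    "HOL-Library.FuncSet"
begin

text \<open>The grading group is the type \<open>bit\<close>, the field with two elements.\<close>

definition koszul :: "bit \<Rightarrow> bit \<Rightarrow> 'a::ring_1" where
  "koszul \<alpha> \<beta> = (if \<alpha> * \<beta> = 1 then - 1 else 1)"

section \<open>Superalgebras with Hopf structure maps, and pairings\<close>

definition scal :: "'k::field \<Rightarrow> ('b \<Rightarrow>\<^sub>0 'k) \<Rightarrow> ('b \<Rightarrow>\<^sub>0 'k)" where
  "scal c p = Poly_Mapping.map ((*) c) p"

definition lin_ext :: "('b \<Rightarrow> ('c \<Rightarrow>\<^sub>0 'k::field)) \<Rightarrow> ('b \<Rightarrow>\<^sub>0 'k) \<Rightarrow> ('c \<Rightarrow>\<^sub>0 'k)" where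
  "lin_ext f p = (\<Sum>b\<in>Poly_Mapping.keys p. scal (Poly_Mapping.lookup p b) (f b))"

text \<open>
  The tensor square of a vector space \<open>M\<close> is the free vector space on pairs of elements of \<open>M\<close>
  modulo the bilinearity relations; its elements are represented as cosets.
\<close>

definition tensor_null :: "('k::field, 'a, 'z) module_scheme \<Rightarrow> (('a \<times> 'a) \<Rightarrow>\<^sub>0 'k) set" where
  "tensor_null M = Modules.module.span scal
     ({Poly_Mapping.single (a \<oplus>\<^bsub>M\<^esub> a', b) 1 - Poly_Mapping.single (a, b) 1 - Poly_Mapping.single (a', b) 1
        | a a' b. a \<in> carrier M \<and> a' \<in> carrier M \<and> b \<in> carrier M} \<union>
      {Poly_Mapping.single (a, b \<oplus>\<^bsub>M\<^esub> b') 1 - Poly_Mapping.single (a, b) 1 - Poly_Mapping.single (a, b') 1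
        | a b b'. a \<in> carrier M \<and> b \<in> carrier M \<and> b' \<in> carrier M} \<union>
      {Poly_Mapping.single (c \<odot>\<^bsub>M\<^esub> a, b) 1 - Poly_Mapping.single (a, b) c
        | c a b. a \<in> carrier M \<and> b \<in> carrier M} \<union>
      {Poly_Mapping.single (a, c \<odot>\<^bsub>M\<^esub> b) 1 - Poly_Mapping.single (a, b) c
        | c a b. a \<in> carrier M \<and> b \<in> carrier M})"

definition tensor_class ::
  "('k::field, 'a, 'z) module_scheme \<Rightarrow> (('a \<times> 'a) \<Rightarrow>\<^sub>0 'k) \<Rightarrow> (('a \<times> 'a) \<Rightarrow>\<^sub>0 'k) set" where
  "tensor_class M x = {y. y - x \<in> tensor_null M}"

definition tensor_sum ::
  "('k::field, 'a, 'z) module_scheme \<Rightarrow> ('a \<times> 'a) list \<Rightarrow> (('a \<times> 'a) \<Rightarrow>\<^sub>0 'k) set" where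
  "tensor_sum M ps = tensor_class M (\<Sum>p\<leftarrow>ps. Poly_Mapping.single p 1)"

record (overloaded) ('k, 'a) hopf_superalgebra = "('k::zero, 'a) module" +
  homog :: "bit \<Rightarrow> 'a set"
  comult :: "'a \<Rightarrow> (('a \<times> 'a) \<Rightarrow>\<^sub>0 'k) set"
  counit :: "'a \<Rightarrow> 'k"
  antipode :: "'a \<Rightarrow> 'a"

definition homogeneous :: "('k::field, 'a) hopf_superalgebra \<Rightarrow> 'a \<Rightarrow> bool" where
  "homogeneous A a \<longleftrightarrow> (\<exists>\<alpha>. a \<in> homog A \<alpha>)"

text \<open>Only meaningful for homogeneous elements; zero, which has both degrees, gets degree 0.\<close>

definition hdeg :: "('k::field, 'a) hopf_superalgebra \<Rightarrow> 'a \<Rightarrow> bit" where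
  "hdeg A a = (if a \<in> homog A 0 then 0 else 1)"

definition bilinear_form ::
  "('k::field, 'a) hopf_superalgebra \<Rightarrow> ('k, 'h) hopf_superalgebra \<Rightarrow> ('a \<times> 'h \<Rightarrow> 'k) \<Rightarrow> bool" where
  "bilinear_form A H \<phi> \<longleftrightarrow>
     (\<forall>a\<in>carrier A. \<forall>a'\<in>carrier A. \<forall>h\<in>carrier H. \<phi> (a \<oplus>\<^bsub>A\<^esub> a', h) = \<phi> (a, h) + \<phi> (a', h)) \<and>
     (\<forall>a\<in>carrier A. \<forall>h\<in>carrier H. \<forall>h'\<in>carrier H. \<phi> (a, h \<oplus>\<^bsub>H\<^esub> h') = \<phi> (a, h) + \<phi> (a, h')) \<and>
     (\<forall>c. \<forall>a\<in>carrier A. \<forall>h\<in>carrier H. \<phi> (c \<odot>\<^bsub>A\<^esub> a, h) = c * \<phi> (a, h)) \<and>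
     (\<forall>c. \<forall>a\<in>carrier A. \<forall>h\<in>carrier H. \<phi> (a, c \<odot>\<^bsub>H\<^esub> h) = c * \<phi> (a, h))"

definition hopf_pairing ::
  "('k::field, 'a) hopf_superalgebra \<Rightarrow> ('k, 'h) hopf_superalgebra \<Rightarrow> ('a \<times> 'h \<Rightarrow> 'k) \<Rightarrow> bool" where
  "hopf_pairing A H \<phi> \<longleftrightarrow>
     bilinear_form A H \<phi> \<and>
     (\<forall>\<alpha> \<eta>. \<forall>a\<in>homog A \<alpha>. \<forall>h\<in>homog H \<eta>. \<alpha> \<noteq> \<eta> \<longrightarrow> \<phi> (a, h) = 0) \<and>
     (\<forall>a a' h hs.
        homogeneous A a \<and> homogeneous A a' \<and> homogeneous H h \<and>
        (\<forall>(h1, h2)\<in>set hs. homogeneous H h1 \<and> homogeneous H h2) \<and>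
        comult H h = tensor_sum H hs \<longrightarrow>
        \<phi> (a \<otimes>\<^bsub>A\<^esub> a', h) = (\<Sum>(h1, h2)\<leftarrow>hs. koszul (hdeg A a') (hdeg H h1) * \<phi> (a, h1) * \<phi> (a', h2))) \<and>
     (\<forall>a h h' as.
        homogeneous A a \<and> homogeneous H h \<and> homogeneous H h' \<and>
        (\<forall>(a1, a2)\<in>set as. homogeneous A a1 \<and> homogeneous A a2) \<and>
        comult A a = tensor_sum A as \<longrightarrow>
        \<phi> (a, h \<otimes>\<^bsub>H\<^esub> h') = (\<Sum>(a1, a2)\<leftarrow>as. koszul (hdeg A a2) (hdeg H h) * \<phi> (a1, h) * \<phi> (a2, h'))) \<and>
     (\<forall>h. homogeneous H h \<longrightarrow> \<phi> (\<one>\<^bsub>A\<^esub>, h) = counit H h) \<and>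
     (\<forall>a. homogeneous A a \<longrightarrow> \<phi> (a, \<one>\<^bsub>H\<^esub>) = counit A a) \<and>
     (\<forall>a h. homogeneous A a \<and> homogeneous H h \<longrightarrow> \<phi> (antipode A a, h) = \<phi> (a, antipode H h))"

section \<open>Hopf superalgebras given by generators and relations\<close>

datatype 'x free_monoid = FM (letters: "'x list")

instantiation free_monoid :: (type) monoid_add
begin

definition zero_free_monoid :: "'a free_monoid" where "0 = FM []"

definition plus_free_monoid :: "'a free_monoid \<Rightarrow> 'a free_monoid \<Rightarrow> 'a free_monoid" where
  "u + v = FM (letters u @ letters v)"

instance
  by standard (simp_all add: zero_free_monoid_def plus_free_monoid_def)

end

text \<open>Multiplication of finitely supported functions on words is the concatenation product.\<close>

type_synonym ('x, 'k) free_algebra = "'x free_monoid \<Rightarrow>\<^sub>0 'k"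

definition gen :: "'x \<Rightarrow> ('x, 'k::field) free_algebra" where
  "gen x = Poly_Mapping.single (FM [x]) 1"

definition free_alg :: "'x set \<Rightarrow> ('k::field, ('x, 'k) free_algebra) module" where
  "free_alg X =
     \<lparr>carrier = {p. \<forall>w\<in>Poly_Mapping.keys p. set (letters w) \<subseteq> X},
      monoid.mult = (*), one = 1, zero = 0, add = (+), smult = scal\<rparr>"

lemma ring_free_alg: "ring (free_alg X :: ('k::field, ('x, 'k) free_algebra) module)"
proof -
  let ?F = "free_alg X :: ('k, ('x, 'k) free_algebra) module"
  have plus: "p + p' \<in> carrier ?F" if "p \<in> carrier ?F" "p' \<in> carrier ?F" for p p'
    using that Poly_Mapping.keys_add[of p p'] by (auto simp: free_alg_def)
  have times: "p * p' \<in> carrier ?F" if "p \<in> carrier ?F" "p' \<in> carrier ?F" for p p'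
  proof -
    have "set (letters w) \<subseteq> X" if w: "w \<in> Poly_Mapping.keys (p * p')" for w
    proof -
      obtain u v where "u \<in> Poly_Mapping.keys p" "v \<in> Poly_Mapping.keys p'" "w = u + v"
        using w keys_mult[of p p'] by blast
      then show ?thesis
        using \<open>p \<in> carrier ?F\<close> \<open>p' \<in> carrier ?F\<close> by (simp add: free_alg_def plus_free_monoid_def)
    qed
    then show ?thesis by (simp add: free_alg_def)
  qed
  have neg: "- p \<in> carrier ?F" if "p \<in> carrier ?F" for p
    using that by (simp add: free_alg_def)
  show ?thesis
  proof (rule ringI)
    show "abelian_group ?F"
    proof (rule abelian_groupI)
      fix x assume "x \<in> carrier ?F"
      then show "\<exists>y\<in>carrier ?F. y \<oplus>\<^bsub>?F\<^esub> x = \<zero>\<^bsub>?F\<^esub>"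
        using neg by (intro bexI[of _ "- x"]) (auto simp: free_alg_def)
    next
      fix x y assume "x \<in> carrier ?F" "y \<in> carrier ?F"
      then show "x \<oplus>\<^bsub>?F\<^esub> y \<in> carrier ?F"
        using plus[of x y] by (simp add: free_alg_def)
    qed (simp_all add: free_alg_def add.assoc add.commute)
    show "monoid ?F"
    proof (rule monoidI)
      fix x y assume "x \<in> carrier ?F" "y \<in> carrier ?F"
      then show "x \<otimes>\<^bsub>?F\<^esub> y \<in> carrier ?F"
        using times[of x y] by (simp add: free_alg_def)
    qed (simp_all add: free_alg_def mult.assoc zero_free_monoid_def)
  qed (simp_all add: free_alg_def distrib_left distrib_right)
qed

definition wdeg :: "('x \<Rightarrow> bit) \<Rightarrow> 'x free_monoid \<Rightarrow> bit" where
  "wdeg d w = sum_list (map d (letters w))"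

text \<open>
  The tensor square of the free algebra has the basis of pairs of words; \<open>tmul\<close> is the graded
  product \<open>(u \<otimes> v)(u' \<otimes> v') = \<sigma>(deg v, deg u') uu' \<otimes> vv'\<close>.
\<close>

definition tmul :: "('x \<Rightarrow> bit) \<Rightarrow> (('x free_monoid \<times> 'x free_monoid) \<Rightarrow>\<^sub>0 'k::field) \<Rightarrow>
    (('x free_monoid \<times> 'x free_monoid) \<Rightarrow>\<^sub>0 'k) \<Rightarrow> (('x free_monoid \<times> 'x free_monoid) \<Rightarrow>\<^sub>0 'k)" where
  "tmul d p p' = (\<Sum>(u, v)\<in>Poly_Mapping.keys p. \<Sum>(u', v')\<in>Poly_Mapping.keys p'.
     Poly_Mapping.single (u + u', v + v')
       (koszul (wdeg d v) (wdeg d u') * Poly_Mapping.lookup p (u, v) * Poly_Mapping.lookup p' (u', v')))"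

definition free_comult :: "('x \<Rightarrow> bit) \<Rightarrow> ('x \<Rightarrow> (('x free_monoid \<times> 'x free_monoid) \<Rightarrow>\<^sub>0 'k::field)) \<Rightarrow>
    ('x, 'k) free_algebra \<Rightarrow> (('x free_monoid \<times> 'x free_monoid) \<Rightarrow>\<^sub>0 'k)" where
  "free_comult d D = lin_ext (\<lambda>w. foldr (\<lambda>x. tmul d (D x)) (letters w) (Poly_Mapping.single (0, 0) 1))"

definition free_counit :: "('x \<Rightarrow> 'k) \<Rightarrow> ('x, 'k::field) free_algebra \<Rightarrow> 'k" where
  "free_counit e p = (\<Sum>w\<in>Poly_Mapping.keys p. Poly_Mapping.lookup p w * prod_list (map e (letters w)))"

text \<open>The antipode is a graded anti-homomorphism: \<open>S(ab) = \<sigma>(deg a, deg b) S(b) S(a)\<close>.\<close>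

fun list_antipode :: "('x \<Rightarrow> bit) \<Rightarrow> ('x \<Rightarrow> ('x, 'k::field) free_algebra) \<Rightarrow> 'x list \<Rightarrow> ('x, 'k) free_algebra" where
  "list_antipode d s [] = 1"
| "list_antipode d s (x # xs) =
     scal (koszul (d x) (wdeg d (FM xs))) (list_antipode d s xs * s x)"

definition free_antipode :: "('x \<Rightarrow> bit) \<Rightarrow> ('x \<Rightarrow> ('x, 'k::field) free_algebra) \<Rightarrow>
    ('x, 'k) free_algebra \<Rightarrow> ('x, 'k) free_algebra" where
  "free_antipode d s = lin_ext (\<lambda>w. list_antipode d s (letters w))"

definition rep :: "'b set \<Rightarrow> 'b" where
  "rep X = (SOME x. x \<in> X)"

definition rel_ideal :: "'x set \<Rightarrow> ('x, 'k::field) free_algebra set \<Rightarrow> ('x, 'k) free_algebra set" where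
  "rel_ideal X Rel = genideal (free_alg X) Rel"

definition pres_class :: "'x set \<Rightarrow> ('x, 'k::field) free_algebra set \<Rightarrow> ('x, 'k) free_algebra \<Rightarrow>
    ('x, 'k) free_algebra set" where
  "pres_class X Rel p = rel_ideal X Rel +>\<^bsub>free_alg X\<^esub> p"

definition pres_module :: "'x set \<Rightarrow> ('x, 'k::field) free_algebra set \<Rightarrow>
    ('k, ('x, 'k) free_algebra set) module" where
  "pres_module X Rel = (let Q = free_alg X Quot rel_ideal X Rel in
     \<lparr>carrier = carrier Q, monoid.mult = monoid.mult Q, one = one Q, zero = zero Q, add = add Q,
      smult = (\<lambda>c x. pres_class X Rel (scal c (rep x)))\<rparr>)"

text \<open>
  The Hopf superalgebra generated by \<open>X\<close> with degrees \<open>d\<close> and relations \<open>Rel\<close>, with coproduct,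
  counit and antipode given on generators by \<open>D\<close>, \<open>e\<close> and \<open>s\<close>.  The structure maps of the quotient are
  computed on representatives, so they are the induced maps whenever those of the free algebra
  respect the ideal of relations.
\<close>

definition presented :: "'x set \<Rightarrow> ('x \<Rightarrow> bit) \<Rightarrow> ('x, 'k::field) free_algebra set \<Rightarrow>
    ('x \<Rightarrow> (('x free_monoid \<times> 'x free_monoid) \<Rightarrow>\<^sub>0 'k)) \<Rightarrow> ('x \<Rightarrow> 'k) \<Rightarrow> ('x \<Rightarrow> ('x, 'k) free_algebra) \<Rightarrow>
    ('k, ('x, 'k) free_algebra set) hopf_superalgebra" where
  "presented X d Rel D e s = (let M = pres_module X Rel; cl = pres_class X Rel in
     \<lparr>carrier = carrier M, monoid.mult = monoid.mult M, one = one M, zero = zero M, add = add M,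
      smult = smult M,
      homog = (\<lambda>\<alpha>. cl ` {p \<in> carrier (free_alg X). \<forall>w\<in>Poly_Mapping.keys p. wdeg d w = \<alpha>}),
      comult = (\<lambda>x. tensor_class M
         (lin_ext (\<lambda>(u, v). Poly_Mapping.single (cl (Poly_Mapping.single u 1), cl (Poly_Mapping.single v 1)) 1)
           (free_comult d D (rep x)))),
      counit = (\<lambda>x. free_counit e (rep x)),
      antipode = (\<lambda>x. cl (free_antipode d s (rep x)))\<rparr>)"

section \<open>The quantum supergroup\<close>

definition idx :: "nat \<Rightarrow> nat \<Rightarrow> int set" where
  "idx n m = {- int (n + m)..int (n + m)} - {0}"

definition eta :: "nat \<Rightarrow> int \<Rightarrow> bit" where
  "eta n i = (if \<bar>i\<bar> \<le> int n then 0 else 1)"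

definition sig :: "nat \<Rightarrow> int \<Rightarrow> int \<Rightarrow> 'a::ring_1" where
  "sig n i j = koszul (eta n i) (eta n j)"

definition Cq :: "nat \<Rightarrow> 'k::field \<Rightarrow> int \<Rightarrow> int \<Rightarrow> 'k" where
  "Cq n q i j =
     (if j \<noteq> - i then 0
      else if i > 0 then q powi (\<Sum>k=1..i. sig n k k)
      else - sig n j j * q powi (- 1 - (\<Sum>k=1..j - 1. sig n k k)))"

definition Cq_inv :: "nat \<Rightarrow> 'k::field \<Rightarrow> int \<Rightarrow> int \<Rightarrow> 'k" where
  "Cq_inv n q i j = (if j = - i then inverse (Cq n q j i) else 0)"

lemma Cq_inv:
  assumes "q \<noteq> 0" "i \<in> idx n m" "j \<in> idx n m"
  shows "(\<Sum>k\<in>idx n m. Cq n q i k * Cq_inv n q k j) = (if i = j then 1 else 0)"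
    and "(\<Sum>k\<in>idx n m. Cq_inv n q i k * Cq n q k j) = (if i = j then 1 else 0)"
proof -
  have fin: "finite (idx n m)" and neg: "- i \<in> idx n m"
    using assms(2) by (auto simp: idx_def)
  have nz: "Cq n q a (- a) \<noteq> 0" for a
    using assms(1) by (auto simp: Cq_def sig_def koszul_def)
  have z: "Cq n q a b = 0" if "b \<noteq> - a" for a b
    using that by (simp add: Cq_def)
  have "(\<Sum>k\<in>idx n m. Cq n q i k * Cq_inv n q k j) =
      (\<Sum>k\<in>idx n m. if k = - i then Cq n q i (- i) * Cq_inv n q (- i) j else 0)"
    by (rule sum.cong) (auto simp: z)
  also have "\<dots> = (if i = j then 1 else 0)"
    using fin neg nz[of i] by (cases "i = j") (simp_all add: Cq_inv_def)
  finally show "(\<Sum>k\<in>idx n m. Cq n q i k * Cq_inv n q k j) = (if i = j then 1 else 0)" .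
  have "(\<Sum>k\<in>idx n m. Cq_inv n q i k * Cq n q k j) =
      (\<Sum>k\<in>idx n m. if k = - i then Cq_inv n q i (- i) * Cq n q (- i) j else 0)"
    by (rule sum.cong) (auto simp: Cq_inv_def)
  also have "\<dots> = (if i = j then 1 else 0)"
    using fin neg nz[of "- i"] z[of j "- i"] by (cases "i = j") (simp_all add: Cq_inv_def)
  finally show "(\<Sum>k\<in>idx n m. Cq_inv n q i k * Cq n q k j) = (if i = j then 1 else 0)" .
qed

text \<open>
  An operator in \<open>V \<otimes> V\<close> is given by its coefficients with respect to the basis of graded tensor
  products of matrix units: the value at \<open>(a, b, c, d)\<close> is the coefficient, written with lower index
  \<open>ab,cd\<close>, of \<open>E\<^bsub>a,c\<^esub> \<otimes> E\<^bsub>b,d\<^esub>\<close>.  So \<open>EE i k j l\<close> represents \<open>E\<^bsub>i,k\<^esub> \<otimes> E\<^bsub>j,l\<^esub>\<close>.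
\<close>

definition EE :: "int \<Rightarrow> int \<Rightarrow> int \<Rightarrow> int \<Rightarrow> int \<times> int \<times> int \<times> int \<Rightarrow> 'k::field" where
  "EE i k j l x = (if x = (i, j, k, l) then 1 else 0)"

definition Rmat :: "nat \<Rightarrow> nat \<Rightarrow> 'k::field \<Rightarrow> int \<times> int \<times> int \<times> int \<Rightarrow> 'k" where
  "Rmat n m q x =
     (\<Sum>i\<in>idx n m. q powi (sig n i i) * EE i i i i x)
   + (\<Sum>i\<in>idx n m. q powi (- sig n i i) * EE i i (- i) (- i) x)
   + (\<Sum>i\<in>idx n m. \<Sum>j\<in>idx n m - {i, - i}. EE i i j j x)
   + (q - inverse q) * (\<Sum>i\<in>idx n m. \<Sum>j\<in>{j \<in> idx n m. i < j}. sig n i i * EE j i i j x)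
   - (q - inverse q) * (\<Sum>i\<in>idx n m. \<Sum>j\<in>{j \<in> idx n m. i < j}.
        sig n i i * sig n j j * sig n i j * Cq_inv n q (- j) j * Cq n q i (- i) * EE j i (- j) (- i) x)"

definition tdeg :: "nat \<Rightarrow> int \<times> int \<Rightarrow> bit" where
  "tdeg n = (\<lambda>(i, j). eta n j - eta n i)"

definition rtt :: "nat \<Rightarrow> nat \<Rightarrow> 'k::field \<Rightarrow> int \<Rightarrow> int \<Rightarrow> int \<Rightarrow> int \<Rightarrow> (int \<times> int, 'k) free_algebra" where
  "rtt n m q i j k l =
     (\<Sum>a\<in>idx n m. \<Sum>b\<in>idx n m.
        scal (koszul (eta n j - eta n l) (eta n a - eta n k) * Rmat n m q (i, j, a, b))
          (gen (a, k) * gen (b, l)))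
   - (\<Sum>a\<in>idx n m. \<Sum>b\<in>idx n m.
        scal (koszul (eta n j - eta n b) (eta n a - eta n k) * Rmat n m q (a, b, k, l))
          (gen (j, b) * gen (i, a)))"

definition Qelt :: "nat \<Rightarrow> nat \<Rightarrow> 'k::field \<Rightarrow> int \<Rightarrow> (int \<times> int, 'k) free_algebra" where
  "Qelt n m q k = scal (inverse (Cq n q k (- k)))
     (\<Sum>a\<in>idx n m. \<Sum>b\<in>idx n m. scal (sig n a k * sig n b a * Cq n q a b) (gen (a, k) * gen (b, - k)))"

text \<open>
  Modulo the first family of relations \<open>Qelt n m q k\<close> is independent of \<open>k\<close>, so all \<open>k\<close> are used in
  the second one instead of an arbitrary choice.
\<close>

definition spo_rels :: "nat \<Rightarrow> nat \<Rightarrow> 'k::field \<Rightarrow> (int \<times> int, 'k) free_algebra set" where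
  "spo_rels n m q =
     {rtt n m q i j k l | i j k l. i \<in> idx n m \<and> j \<in> idx n m \<and> k \<in> idx n m \<and> l \<in> idx n m}
   \<union> {Qelt n m q k - 1 | k. k \<in> idx n m}"

definition spo_comult :: "nat \<Rightarrow> nat \<Rightarrow> int \<times> int \<Rightarrow>
    (((int \<times> int) free_monoid \<times> (int \<times> int) free_monoid) \<Rightarrow>\<^sub>0 'k::field)" where
  "spo_comult n m = (\<lambda>(i, j). \<Sum>k\<in>idx n m.
     Poly_Mapping.single (FM [(i, k)], FM [(k, j)]) (koszul (eta n k - eta n i) (eta n k - eta n j)))"

definition spo_antipode :: "nat \<Rightarrow> 'k::field \<Rightarrow> int \<times> int \<Rightarrow> (int \<times> int, 'k) free_algebra" where
  "spo_antipode n q = (\<lambda>(i, j).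
     scal (sig n i i * sig n i j * Cq_inv n q i (- i) * Cq n q (- j) j) (gen (- j, - i)))"

definition SPO :: "nat \<Rightarrow> nat \<Rightarrow> 'k::field \<Rightarrow> ('k, (int \<times> int, 'k) free_algebra set) hopf_superalgebra" where
  "SPO n m q = presented (idx n m \<times> idx n m) (tdeg n) (spo_rels n m q)
     (spo_comult n m) (\<lambda>(i, j). if i = j then 1 else 0) (spo_antipode n q)"

definition spo_t :: "nat \<Rightarrow> nat \<Rightarrow> 'k::field \<Rightarrow> int \<Rightarrow> int \<Rightarrow> (int \<times> int, 'k) free_algebra set" where
  "spo_t n m q i j = pres_class (idx n m \<times> idx n m) (spo_rels n m q) (gen (i, j))"

section \<open>The quantum superalgebra\<close>

text \<open>Elements of the lattice are represented by their coordinates with respect to its basis.\<close>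

definition eps :: "int \<Rightarrow> nat \<Rightarrow> int" where
  "eps i a = (if int a = \<bar>i\<bar> then sgn i else 0)"

definition form :: "nat \<Rightarrow> nat \<Rightarrow> (nat \<Rightarrow> int) \<Rightarrow> (nat \<Rightarrow> int) \<Rightarrow> int" where
  "form n m x y = (\<Sum>a=1..n + m. sig n (int a) (int a) * x a * y a)"

definition sroot :: "nat \<Rightarrow> nat \<Rightarrow> int" where
  "sroot j = (if j = 1 then (\<lambda>a. eps (- 1) a - eps 1 a)
             else (\<lambda>a. eps (- int j) a - eps (- int j + 1) a))"

definition rdeg :: "nat \<Rightarrow> nat \<Rightarrow> bit" where
  "rdeg n j = (if j = n + 1 then 1 else 0)"

definition qj :: "'k::field \<Rightarrow> nat \<Rightarrow> 'k" where
  "qj q j = (if j = 1 then q\<^sup>2 else q)"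

datatype uq_gen = UK nat | UKinv nat | UE nat | UF nat

definition uq_gens :: "nat \<Rightarrow> nat \<Rightarrow> uq_gen set" where
  "uq_gens n m = UK ` {1..n + m} \<union> UKinv ` {1..n + m} \<union> UE ` {1..n + m} \<union> UF ` {1..n + m}"

fun uq_deg :: "nat \<Rightarrow> uq_gen \<Rightarrow> bit" where
  "uq_deg n (UK j) = 0"
| "uq_deg n (UKinv j) = 0"
| "uq_deg n (UE j) = rdeg n j"
| "uq_deg n (UF j) = rdeg n j"

definition utilde_rels :: "nat \<Rightarrow> nat \<Rightarrow> 'k::field \<Rightarrow> (uq_gen, 'k) free_algebra set" where
  "utilde_rels n m q = (\<Union>j\<in>{1..n + m}. \<Union>k\<in>{1..n + m}.
     {gen (UK j) * gen (UK k) - gen (UK k) * gen (UK j),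
      gen (UK j) * gen (UKinv k) - gen (UKinv k) * gen (UK j),
      gen (UKinv j) * gen (UKinv k) - gen (UKinv k) * gen (UKinv j),
      gen (UK j) * gen (UKinv j) - 1,
      gen (UK j) * gen (UE k) * gen (UKinv j) - scal (q powi (form n m (sroot j) (sroot k))) (gen (UE k)),
      gen (UK j) * gen (UF k) * gen (UKinv j) - scal (q powi (- form n m (sroot j) (sroot k))) (gen (UF k)),
      gen (UE j) * gen (UF k) - scal (koszul (rdeg n j) (rdeg n k)) (gen (UF k) * gen (UE j))
        - (if j = k then scal (inverse (qj q j - inverse (qj q j))) (gen (UK j) - gen (UKinv j)) else 0)})"

definition word_wt :: "nat free_monoid \<Rightarrow> nat \<Rightarrow> int" where
  "word_wt w a = (\<Sum>j\<leftarrow>letters w. sroot j a)"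

fun list_pder :: "nat \<Rightarrow> nat \<Rightarrow> 'k::field \<Rightarrow> nat \<Rightarrow> nat list \<Rightarrow> (nat, 'k) free_algebra" where
  "list_pder n m q k [] = 0"
| "list_pder n m q k (j # w) = gen j * list_pder n m q k w +
     (if j = k then Poly_Mapping.single (FM w)
        (koszul (rdeg n k) (wdeg (rdeg n) (FM w)) * q powi (form n m (sroot k) (word_wt (FM w)))) else 0)"

text \<open>The twisted Leibniz rule \<open>\<partial>\<^sub>k(xy) = x \<partial>\<^sub>k(y) + \<sigma>(deg \<theta>\<^sub>k, deg y) q\<^bsup>(\<alpha>\<^sub>k, wt y)\<^esup> \<partial>\<^sub>k(x) y\<close> on words:\<close>

lemma list_pder_append:
  fixes q :: "'k::field"
  assumes "q \<noteq> 0"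
  shows "list_pder n m q k (u @ w) = Poly_Mapping.single (FM u) 1 * list_pder n m q k w +
     scal (koszul (rdeg n k) (wdeg (rdeg n) (FM w)) * q powi (form n m (sroot k) (word_wt (FM w))))
       (list_pder n m q k u * Poly_Mapping.single (FM w) 1)"
proof (induction u)
  case Nil
  have "Poly_Mapping.single (FM []) 1 = (1 :: (nat, 'k) free_algebra)"
    by (metis single_one zero_free_monoid_def)
  then show ?case by (simp add: scal_def mult_map_scale_conv_mult)
next
  case (Cons j u)
  let ?c = "\<lambda>w. koszul (rdeg n k) (wdeg (rdeg n) (FM w)) * q powi (form n m (sroot k) (word_wt (FM w)))"
  have scal_mult: "scal c p = Poly_Mapping.single 0 c * p" for c and p :: "(nat, 'k) free_algebra"
    by (simp add: scal_def mult_map_scale_conv_mult)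
  have comm: "Poly_Mapping.single 0 (?c w) * gen j = (gen j * Poly_Mapping.single 0 (?c w) :: (nat, 'k) free_algebra)"
    by (simp add: gen_def mult_single)
  have form_add: "form n m (sroot k) (word_wt (FM (u @ w))) =
      form n m (sroot k) (word_wt (FM u)) + form n m (sroot k) (word_wt (FM w))"
    by (simp add: form_def word_wt_def distrib_left sum.distrib)
  have wdeg_add: "wdeg (rdeg n) (FM (u @ w)) = wdeg (rdeg n) (FM u) + wdeg (rdeg n) (FM w)"
    by (simp only: wdeg_def free_monoid.sel map_append sum_list_append)
  have kos: "koszul a (b + c) = (koszul a b * koszul a c :: 'k)" for a b c
    by (cases a; cases b; cases c) (simp_all add: koszul_def)
  have c_append: "?c (u @ w) = ?c w * ?c u"
    using assms unfolding wdeg_add kos form_add by (simp add: power_int_add)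
  have single_append: "Poly_Mapping.single (FM (u @ w)) (?c (u @ w)) =
      Poly_Mapping.single 0 (?c w) * (Poly_Mapping.single (FM u) (?c u) * Poly_Mapping.single (FM w) 1)"
    unfolding c_append by (simp add: mult_single plus_free_monoid_def zero_free_monoid_def)
  have single_Cons: "Poly_Mapping.single (FM (j # u)) 1 = gen j * Poly_Mapping.single (FM u) (1 :: 'k)"
    by (simp add: gen_def mult_single plus_free_monoid_def)
  have "list_pder n m q k ((j # u) @ w) = gen j * list_pder n m q k (u @ w)
      + (if j = k then Poly_Mapping.single (FM (u @ w)) (?c (u @ w)) else 0)"
    by simp
  also have "gen j * list_pder n m q k (u @ w) = Poly_Mapping.single (FM (j # u)) 1 * list_pder n m q k w
      + gen j * Poly_Mapping.single 0 (?c w) * (list_pder n m q k u * Poly_Mapping.single (FM w) 1)"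
    unfolding Cons.IH single_Cons scal_mult by (simp only: distrib_left mult.assoc)
  also have "gen j * Poly_Mapping.single 0 (?c w) = Poly_Mapping.single 0 (?c w) * gen j"
    by (rule comm[symmetric])
  finally show ?case
    unfolding single_append scal_mult by (simp add: distrib_left distrib_right mult.assoc)
qed

definition pder :: "nat \<Rightarrow> nat \<Rightarrow> 'k::field \<Rightarrow> nat \<Rightarrow> (nat, 'k) free_algebra \<Rightarrow> (nat, 'k) free_algebra" where
  "pder n m q k = lin_ext (\<lambda>w. list_pder n m q k (letters w))"

definition serre_space :: "nat \<Rightarrow> nat \<Rightarrow> 'k::field \<Rightarrow> (nat, 'k) free_algebra set" where
  "serre_space n m q = Modules.module.span scal
     {x \<in> carrier (free_alg {1..n + m}).
        (\<exists>\<nu>. \<forall>w\<in>Poly_Mapping.keys x. word_wt w = \<nu>) \<and>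
        (\<exists>N\<ge>1. (\<forall>w\<in>Poly_Mapping.keys x. length (letters w) = N) \<and>
           (\<forall>ks. length ks = N \<and> set ks \<subseteq> {1..n + m} \<longrightarrow> foldr (pder n m q) ks x = 0))}"

definition subst_gens :: "('x \<Rightarrow> 'y) \<Rightarrow> ('x, 'k::field) free_algebra \<Rightarrow> ('y, 'k) free_algebra" where
  "subst_gens f = lin_ext (\<lambda>w. Poly_Mapping.single (FM (map f (letters w))) 1)"

definition uq_rels :: "nat \<Rightarrow> nat \<Rightarrow> 'k::field \<Rightarrow> (uq_gen, 'k) free_algebra set" where
  "uq_rels n m q = utilde_rels n m q
     \<union> subst_gens UE ` serre_space n m q \<union> subst_gens UF ` serre_space n m q"

fun uq_comult :: "uq_gen \<Rightarrow> ((uq_gen free_monoid \<times> uq_gen free_monoid) \<Rightarrow>\<^sub>0 'k::field)" where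
  "uq_comult (UK j) = Poly_Mapping.single (FM [UK j], FM [UK j]) 1"
| "uq_comult (UKinv j) = Poly_Mapping.single (FM [UKinv j], FM [UKinv j]) 1"
| "uq_comult (UE j) = Poly_Mapping.single (FM [UE j], 0) 1 + Poly_Mapping.single (FM [UK j], FM [UE j]) 1"
| "uq_comult (UF j) = Poly_Mapping.single (FM [UF j], FM [UKinv j]) 1 + Poly_Mapping.single (0, FM [UF j]) 1"

fun uq_counit :: "uq_gen \<Rightarrow> 'k::field" where
  "uq_counit (UK j) = 1"
| "uq_counit (UKinv j) = 1"
| "uq_counit (UE j) = 0"
| "uq_counit (UF j) = 0"

fun uq_antipode :: "uq_gen \<Rightarrow> (uq_gen, 'k::field) free_algebra" where
  "uq_antipode (UK j) = gen (UKinv j)"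
| "uq_antipode (UKinv j) = gen (UK j)"
| "uq_antipode (UE j) = - (gen (UKinv j) * gen (UE j))"
| "uq_antipode (UF j) = - (gen (UF j) * gen (UK j))"

definition Uq_spo :: "nat \<Rightarrow> nat \<Rightarrow> 'k::field \<Rightarrow> ('k, (uq_gen, 'k) free_algebra set) hopf_superalgebra" where
  "Uq_spo n m q = presented (uq_gens n m) (uq_deg n) (uq_rels n m q) uq_comult uq_counit uq_antipode"

section \<open>The vector representation\<close>

text \<open>Vectors are coordinate functions on the index set, with basis vectors \<open>ebasis i\<close>.\<close>

definition ebasis :: "int \<Rightarrow> int \<Rightarrow> 'k::field" where
  "ebasis i = (\<lambda>k. if k = i then 1 else 0)"

definition munit :: "int \<Rightarrow> int \<Rightarrow> (int \<Rightarrow> 'k::field) \<Rightarrow> (int \<Rightarrow> 'k)" where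
  "munit i j v = (\<lambda>k. v j * ebasis i k)"

fun vec_gen :: "nat \<Rightarrow> nat \<Rightarrow> 'k::field \<Rightarrow> uq_gen \<Rightarrow> (int \<Rightarrow> 'k) \<Rightarrow> (int \<Rightarrow> 'k)" where
  "vec_gen n m q (UK j) v = (\<lambda>i. q powi (form n m (sroot j) (eps i)) * v i)"
| "vec_gen n m q (UKinv j) v = (\<lambda>i. q powi (- form n m (sroot j) (eps i)) * v i)"
| "vec_gen n m q (UE j) v =
     (if j = 1 then munit (- 1) 1 v
      else (\<lambda>i. munit (- int j) (- int j + 1) v i
             - sig n (int j) (int j) * sig n (int j) (int j - 1) * munit (int j - 1) (int j) v i))"
| "vec_gen n m q (UF j) v =
     (if j = 1 then munit 1 (- 1) v
      else (\<lambda>i. sig n (int j) (int j) *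
             (munit (- int j + 1) (- int j) v i - munit (int j) (int j - 1) v i)))"

definition free_vec_rep :: "nat \<Rightarrow> nat \<Rightarrow> 'k::field \<Rightarrow> (uq_gen, 'k) free_algebra \<Rightarrow> (int \<Rightarrow> 'k) \<Rightarrow> (int \<Rightarrow> 'k)" where
  "free_vec_rep n m q p v = (\<lambda>i. \<Sum>w\<in>Poly_Mapping.keys p.
     Poly_Mapping.lookup p w * foldr (vec_gen n m q) (letters w) v i)"

definition vec_rep :: "nat \<Rightarrow> nat \<Rightarrow> 'k::field \<Rightarrow> (uq_gen, 'k) free_algebra set \<Rightarrow> (int \<Rightarrow> 'k) \<Rightarrow> (int \<Rightarrow> 'k)" where
  "vec_rep n m q h = free_vec_rep n m q (rep h)"

definition vec_rep_elem :: "nat \<Rightarrow> nat \<Rightarrow> 'k::field \<Rightarrow> int \<Rightarrow> int \<Rightarrow> (uq_gen, 'k) free_algebra set \<Rightarrow> 'k" where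
  "vec_rep_elem n m q i j h = vec_rep n m q h (ebasis j) i"

end

theory Submission
  imports Defs
begin

text \<open>
  A Hopf pairing is determined by its values on algebra generators of the first argument, which gives
  uniqueness.  For existence, the form is defined on words: up to Koszul signs, a word in the
  \<open>t\<^bsub>i,j\<^esub>\<close> of length \<open>l\<close> is paired with a word in the generators of the quantum superalgebra by the
  corresponding matrix coefficient of the latter in the tensor power \<open>V\<^bsup>l\<^esup>\<close>.  Since all structure maps
  are computed on representatives, what remains is that the form vanishes on both sets of relations.
  On the first side this says that the R-matrix, followed by the flip, commutes with the action on
  \<open>V \<otimes> V\<close>, and that the bilinear form given by \<open>C\<close> is invariant.  On the second side the
  Serre relations act by zero on \<open>V\<close> because commuting a word in the \<open>E\<^bsub>j\<^esub>\<close> past an \<open>F\<^bsub>k\<^esub>\<close> produces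
  skew derivatives of that word, so that all matrix coefficients are generated by the skew derivations;
  functionals with this property are closed under the convolution that computes matrix coefficients
  of tensor products.
\<close>

section \<open>Signs\<close>

text \<open>The Serre relations are given as a common kernel of iterated skew derivations and not by
  a list, so they cannot be verified one at a time. Instead one describes functionals that
  annihilate them: combinations of "apply some derivations, then take the constant term". On
  \<open>V\<close> the matrix coefficients of words in the E's are reached from the basis vector
  killed by all E's: every other \<open>e_a\<close> is a multiple of \<open>F_k e_b\<close> for a
  neighbouring index \<open>b\<close>, and commuting words past \<open>F_k\<close> reduces
  \<open>e_a\<close> to \<open>e_b\<close>. In the commutator, \<open>K_k\<close> yields the
  derivation itself, while its inverse yields a derivation with inverse factors. The latter is, up
  to a character, the derivation from the opposite side, which is a convolution; so closure under
  convolution enters already for a single copy of \<open>V\<close>. Relations on either side are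
  tested against words of every length on the other side, that is in all tensor powers. This takes
  the place of a proof that the relations generate a biideal, and it is why the action is set up on
  all tensor powers simultaneously.\<close>

lemma bit_sum_zero [simp]: "(a::bit) + a = 0" "a + (a + b) = b" "a - b = a + b" "- a = a"
  by (cases a; cases b; simp)+

lemma koszul_add_left: "koszul (a + b) c = (koszul a c * koszul b c :: 'a::ring_1)"
  by (cases a; cases b; cases c) (simp_all add: koszul_def)

lemma koszul_add_right: "koszul a (b + c) = (koszul a b * koszul a c :: 'a::ring_1)"
  by (cases a; cases b; cases c) (simp_all add: koszul_def)

lemma koszul_comm: "koszul a b = koszul b a"
  by (simp add: koszul_def mult.commute)

lemma koszul_zero [simp]: "koszul 0 a = 1" "koszul a 0 = 1"
  by (simp_all add: koszul_def)

lemma koszul_square [simp]: "koszul a b * koszul a b = (1 :: 'a::ring_1)"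
  "koszul a b * (koszul a b * x) = (x :: 'a::ring_1)"
  by (simp_all add: koszul_def)

lemma koszul_nonzero [simp]: "koszul a b \<noteq> (0 :: 'a::field)"
  by (simp add: koszul_def)

section \<open>Linear extension of functionals on a basis\<close>

lemma poly_mapping_sum_single:
  "p = (\<Sum>b\<in>Poly_Mapping.keys p. Poly_Mapping.single b (Poly_Mapping.lookup p b))"
proof (rule poly_mapping_eqI)
  fix b
  show "Poly_Mapping.lookup p b = Poly_Mapping.lookup
    (\<Sum>b\<in>Poly_Mapping.keys p. Poly_Mapping.single b (Poly_Mapping.lookup p b)) b"
    by (simp add: lookup_sum lookup_single when_def in_keys_iff)
qed

lemma poly_mapping_induct [case_names single add]:
  fixes p :: "'b \<Rightarrow>\<^sub>0 'k::comm_monoid_add"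
  assumes single: "\<And>b c. P (Poly_Mapping.single b c)" and add: "\<And>p p'. P p \<Longrightarrow> P p' \<Longrightarrow> P (p + p')"
  shows "P p"
proof -
  have "P (\<Sum>b\<in>S. Poly_Mapping.single b (Poly_Mapping.lookup p b))" for S
    by (induction S rule: infinite_finite_induct)
      (simp_all add: single add, metis single single_zero, metis single single_zero)
  then show ?thesis by (subst poly_mapping_sum_single)
qed

lemma lookup_scal [simp]: "Poly_Mapping.lookup (scal c p) b = c * Poly_Mapping.lookup p b"
  by (simp add: scal_def Poly_Mapping.map.rep_eq when_def)

lemma keys_scal: "Poly_Mapping.keys (scal c p) \<subseteq> Poly_Mapping.keys p"
  by (auto simp: in_keys_iff)

lemma scal_zero_left [simp]: "scal 0 p = 0"
  and scal_zero_right [simp]: "scal c 0 = 0"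
  and scal_one [simp]: "scal 1 p = p"
  and scal_scal [simp]: "scal c (scal c' p) = scal (c * c') p"
  and scal_single [simp]: "scal c (Poly_Mapping.single b x) = Poly_Mapping.single b (c * x)"
  by (simp_all add: poly_mapping_eq_iff fun_eq_iff mult.assoc lookup_single when_def)

lemma scal_add_right: "scal c (p + p') = scal c p + scal c p'"
  and scal_add_left: "scal (c + c') p = scal c p + scal c' p"
  and scal_diff_right: "scal c (p - p') = scal c p - scal c p'"
  and scal_minus: "scal c (- p) = - scal c p"
  by (simp_all add: poly_mapping_eq_iff fun_eq_iff lookup_add lookup_minus algebra_simps)

interpretation scal: Modules.module scal
  by standard (simp_all add: scal_add_right scal_add_left)

lemma scal_mult: "scal c p = Poly_Mapping.single 0 c * (p :: ('x, 'k::field) free_algebra)"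
  by (simp add: scal_def mult_map_scale_conv_mult)

text \<open>The forms below are all written through this linear extension, so that products in the
  free algebra become iterated sums over words.\<close>

definition ev :: "('b \<Rightarrow> 'k::field) \<Rightarrow> ('b \<Rightarrow>\<^sub>0 'k) \<Rightarrow> 'k" where
  "ev f p = (\<Sum>b\<in>Poly_Mapping.keys p. Poly_Mapping.lookup p b * f b)"

lemma ev_superset:
  assumes "finite S" "Poly_Mapping.keys p \<subseteq> S"
  shows "ev f p = (\<Sum>b\<in>S. Poly_Mapping.lookup p b * f b)"
  unfolding ev_def using assms by (intro sum.mono_neutral_left) (auto simp: in_keys_iff)

lemma ev_zero [simp]: "ev f 0 = 0"
  by (simp add: ev_def)

lemma ev_add [simp]: "ev f (p + p') = ev f p + ev f p'"
proof -
  let ?S = "Poly_Mapping.keys p \<union> Poly_Mapping.keys p'"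
  have "Poly_Mapping.keys (p + p') \<subseteq> ?S" by (rule Poly_Mapping.keys_add)
  then show ?thesis
    by (subst (1 2 3) ev_superset[of ?S]) (auto simp: lookup_add distrib_right sum.distrib)
qed

lemma ev_scal [simp]: "ev f (scal c p) = c * ev f p"
  by (subst ev_superset[OF _ keys_scal]) (simp_all add: ev_def sum_distrib_left mult.assoc)

lemma ev_minus [simp]: "ev f (- p) = - ev f p"
  using ev_add[of f p "- p"] by (simp add: eq_neg_iff_add_eq_0 add.commute)

lemma ev_diff [simp]: "ev f (p - p') = ev f p - ev f p'"
  using ev_add[of f p "- p'"] by simp

lemma ev_sum [simp]: "ev f (sum F S) = (\<Sum>s\<in>S. ev f (F s))"
  by (induction S rule: infinite_finite_induct) simp_all

lemma ev_single [simp]: "ev f (Poly_Mapping.single b c) = c * f b"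
  by (cases "c = 0") (simp_all add: ev_def)

lemma ev_cong: "(\<And>b. b \<in> Poly_Mapping.keys p \<Longrightarrow> f b = g b) \<Longrightarrow> ev f p = ev g p"
  by (simp add: ev_def)

lemma ev_fun_zero: "(\<And>b. b \<in> Poly_Mapping.keys p \<Longrightarrow> f b = 0) \<Longrightarrow> ev f p = 0"
  by (simp add: ev_def)

lemma ev_fun_add: "ev (\<lambda>b. f b + g b) p = ev f p + ev g p"
  by (simp add: ev_def distrib_left sum.distrib)

lemma ev_fun_mult: "ev (\<lambda>b. c * f b) p = c * ev f p"
  by (simp add: ev_def sum_distrib_left mult.left_commute)

lemma ev_fun_mult_right: "ev (\<lambda>b. f b * c) p = ev f p * c"
  by (simp add: ev_def sum_distrib_right mult.assoc)

lemma ev_fun_sum: "ev (\<lambda>b. \<Sum>s\<in>S. f s b) p = (\<Sum>s\<in>S. ev (f s) p)"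
  unfolding ev_def sum_distrib_left by (rule sum.swap)

text \<open>Fubini for finitely supported functions; the symmetry between the two arguments of the
  pairing rests on it.\<close>

lemma ev_swap: "ev (\<lambda>a. ev (\<lambda>b. B a b) p') p = ev (\<lambda>b. ev (\<lambda>a. B a b) p) p'"
  unfolding ev_def sum_distrib_left by (subst sum.swap) (simp add: mult.left_commute)

lemma ev_prod: "ev f p * ev g p' = ev (\<lambda>a. ev (\<lambda>b. f a * g b) p') p"
  by (simp add: ev_fun_mult ev_fun_mult_right)

lemma ev_lin_ext [simp]: "ev f (lin_ext F p) = ev (\<lambda>b. ev f (F b)) p"
  by (simp add: lin_ext_def ev_def[of "\<lambda>b. ev f (F b)"])

lemma ev_mult [simp]:
  "ev f (p * p') = ev (\<lambda>u. ev (\<lambda>v. f (u + v)) p') (p :: ('x, 'k::field) free_algebra)"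
proof -
  have 1: "ev f (Poly_Mapping.single u c * p') = c * ev (\<lambda>v. f (u + v)) p'" for u c
  proof (induction p' rule: poly_mapping_induct)
    case (single b c) then show ?case by (simp add: mult_single)
  next
    case (add p p') then show ?case by (simp add: distrib_left)
  qed
  show ?thesis
  proof (induction p rule: poly_mapping_induct)
    case (single b c) then show ?case by (simp add: 1)
  next
    case (add p p') then show ?case by (simp add: distrib_right)
  qed
qed

lemma ev_one [simp]: "ev f (1 :: ('x, 'k::field) free_algebra) = f 0"
  by (metis ev_single mult_1 single_one)

lemma ev_gen [simp]: "ev f (gen x) = f (FM [x])"
  by (simp add: gen_def)

lemma ev_tmul [simp]: "ev f (tmul d p p') =
  ev (\<lambda>(u, v). ev (\<lambda>(u', v'). koszul (wdeg d v) (wdeg d u') * f (u + u', v + v')) p') p"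
  unfolding tmul_def ev_sum
  by (simp add: case_prod_unfold ev_def[of _ p] ev_def[of _ p'] sum_distrib_left mult.assoc mult.left_commute)

lemma keys_lin_ext: "Poly_Mapping.keys (lin_ext F p) \<subseteq> (\<Union>b\<in>Poly_Mapping.keys p. Poly_Mapping.keys (F b))"
  unfolding lin_ext_def using Poly_Mapping.keys_sum keys_scal by fastforce

lemma lin_ext_zero [simp]: "lin_ext F 0 = 0"
  by (simp add: lin_ext_def)

lemma keys_tmul:
  "Poly_Mapping.keys (tmul d p p') \<subseteq>
    (\<lambda>((u, v), (u', v')). (u + u', v + v')) ` (Poly_Mapping.keys p \<times> Poly_Mapping.keys p')"
proof -
  have 1: "Poly_Mapping.keys (sum f S) \<subseteq> T" if "\<And>s. s \<in> S \<Longrightarrow> Poly_Mapping.keys (f s) \<subseteq> T"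
    for f :: "'s \<Rightarrow> _ \<Rightarrow>\<^sub>0 'b" and S T using Poly_Mapping.keys_sum that by fastforce
  show ?thesis
    unfolding tmul_def case_prod_unfold
    by (intro 1) (force split: if_splits)
qed

definition words :: "'x set \<Rightarrow> 'x free_monoid set" where
  "words X = {w. set (letters w) \<subseteq> X}"

lemma words_zero [simp]: "0 \<in> words X"
  and words_add [simp]: "u + v \<in> words X \<longleftrightarrow> u \<in> words X \<and> v \<in> words X"
  and words_FM [simp]: "FM xs \<in> words X \<longleftrightarrow> set xs \<subseteq> X"
  by (simp_all add: words_def zero_free_monoid_def plus_free_monoid_def)

lemma wdeg_zero [simp]: "wdeg d 0 = 0"
  and wdeg_add [simp]: "wdeg d (u + v) = wdeg d u + wdeg d v"
  and wdeg_Nil [simp]: "wdeg d (FM []) = 0"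
  and wdeg_Cons [simp]: "wdeg d (FM (x # xs)) = d x + wdeg d (FM xs)"
  by (simp_all add: wdeg_def zero_free_monoid_def plus_free_monoid_def)

lemma free_alg_simps [simp]:
  "monoid.mult (free_alg X) = (*)" "one (free_alg X) = 1" "zero (free_alg X) = 0"
  "add (free_alg X) = (+)" "smult (free_alg X) = scal"
  by (simp_all add: free_alg_def)

lemma carrier_free_alg: "p \<in> carrier (free_alg X) \<longleftrightarrow> Poly_Mapping.keys p \<subseteq> words X"
  by (auto simp: free_alg_def words_def)

lemma FM_Cons: "FM (x # xs) = FM [x] + FM xs"
  and FM_Nil: "FM [] = 0"
  by (simp_all add: plus_free_monoid_def zero_free_monoid_def)

lemma FM_append: "FM (u @ v) = FM u + FM v"
  by (simp add: plus_free_monoid_def)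

section \<open>Evaluating bilinear functionals on the tensor square\<close>

definition bilinear_on :: "('k::field, 'a, 'z) module_scheme \<Rightarrow> ('a \<Rightarrow> 'a \<Rightarrow> 'k) \<Rightarrow> bool" where
  "bilinear_on M B \<longleftrightarrow>
     (\<forall>a\<in>carrier M. \<forall>a'\<in>carrier M. \<forall>b\<in>carrier M.
        B (a \<oplus>\<^bsub>M\<^esub> a') b = B a b + B a' b \<and> B b (a \<oplus>\<^bsub>M\<^esub> a') = B b a + B b a') \<and>
     (\<forall>c. \<forall>a\<in>carrier M. \<forall>b\<in>carrier M. B (c \<odot>\<^bsub>M\<^esub> a) b = c * B a b \<and> B b (c \<odot>\<^bsub>M\<^esub> a) = c * B b a)"

text \<open>The universal property of the tensor square: the linear extension of a bilinear map
  kills the generators of \<open>tensor_null\<close>, hence their span.\<close>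

lemma ev_tensor_null:
  assumes "bilinear_on M B" "x \<in> tensor_null M"
  shows "ev (\<lambda>(a, b). B a b) x = 0"
proof -
  have "tensor_null M \<subseteq> {x. ev (\<lambda>(a, b). B a b) x = 0}"
    unfolding tensor_null_def
    by (rule scal.span_minimal) (use assms(1) in \<open>auto simp: scal.subspace_def bilinear_on_def\<close>)
  then show ?thesis using assms(2) by auto
qed

lemma tensor_null_diff: "x \<in> tensor_null M \<Longrightarrow> y \<in> tensor_null M \<Longrightarrow> x - y \<in> tensor_null M"
  unfolding tensor_null_def by (rule scal.span_diff)

lemma tensor_class_eq_iff:
  "tensor_class M x = tensor_class M y \<longleftrightarrow> x - y \<in> tensor_null M"
proof
  assume "tensor_class M x = tensor_class M y"
  moreover have "x \<in> tensor_class M x"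
    by (simp add: tensor_class_def tensor_null_def scal.span_zero)
  ultimately show "x - y \<in> tensor_null M" by (simp add: tensor_class_def)
next
  assume *: "x - y \<in> tensor_null M"
  have "z - x \<in> tensor_null M \<longleftrightarrow> z - y \<in> tensor_null M" for z
    using scal.span_add[OF *[unfolded tensor_null_def], of "z - x"]
      scal.span_diff[OF _ *[unfolded tensor_null_def], of "z - y"]
    unfolding tensor_null_def by auto
  then show "tensor_class M x = tensor_class M y" by (simp add: tensor_class_def)
qed

text \<open>The pairing axioms quantify over every way of writing a coproduct as a list of pure
  tensors. Evaluation by a bilinear map makes the resulting sum independent of the list.\<close>

lemma ev_tensor_sum:
  assumes "bilinear_on M B" "tensor_class M x = tensor_sum M ps"
  shows "ev (\<lambda>(a, b). B a b) x = (\<Sum>(a, b)\<leftarrow>ps. B a b)"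
proof -
  have "ev (\<lambda>(a, b). B a b) x = ev (\<lambda>(a, b). B a b) (\<Sum>p\<leftarrow>ps. Poly_Mapping.single p 1)"
    using ev_tensor_null[OF assms(1)] assms(2) unfolding tensor_sum_def tensor_class_eq_iff
    by fastforce
  also have "\<dots> = (\<Sum>(a, b)\<leftarrow>ps. B a b)"
    by (induction ps) auto
  finally show ?thesis .
qed

text \<open>A list of pure tensors carries no coefficients, so the coefficients of \<open>z\<close>
  are absorbed into the first factors.\<close>

lemma tensor_sum_exists:
  assumes "Poly_Mapping.keys z \<subseteq> P" "P \<subseteq> carrier M \<times> carrier M"
  shows "\<exists>ps. set ps \<subseteq> {(c \<odot>\<^bsub>M\<^esub> a, b) | c a b. (a, b) \<in> P} \<and> tensor_class M z = tensor_sum M ps"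
proof -
  obtain ks where ks: "set ks = Poly_Mapping.keys z" "distinct ks"
    by (metis finite_distinct_list finite_keys)
  let ?l = "Poly_Mapping.lookup z"
  let ?f = "\<lambda>(a, b). (?l (a, b) \<odot>\<^bsub>M\<^esub> a, b)"
  have *: "(\<Sum>p\<leftarrow>ks. Poly_Mapping.single p (?l p)) - (\<Sum>p\<leftarrow>map ?f ks. Poly_Mapping.single p 1)
    \<in> tensor_null M" if "set ks \<subseteq> carrier M \<times> carrier M" for ks
    using that
  proof (induction ks)
    case Nil then show ?case by (simp add: tensor_null_def scal.span_zero)
  next
    case (Cons p ks)
    obtain a b where p: "p = (a, b)" by fastforce
    have 1: "Poly_Mapping.single (?f p) 1 - Poly_Mapping.single p (?l p) \<in> tensor_null M"
      unfolding tensor_null_def by (rule scal.span_base) (use Cons.prems p in auto)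
    have "(\<Sum>p\<leftarrow>p # ks. Poly_Mapping.single p (?l p)) - (\<Sum>p\<leftarrow>map ?f (p # ks). Poly_Mapping.single p 1)
      = ((\<Sum>p\<leftarrow>ks. Poly_Mapping.single p (?l p)) - (\<Sum>p\<leftarrow>map ?f ks. Poly_Mapping.single p 1))
        - (Poly_Mapping.single (?f p) 1 - Poly_Mapping.single p (?l p))"
      by simp
    also have "\<dots> \<in> tensor_null M"
      by (rule tensor_null_diff[OF _ 1]) (use Cons in auto)
    finally show ?case .
  qed
  have z: "(\<Sum>p\<leftarrow>ks. Poly_Mapping.single p (?l p)) = z"
    using ks by (simp add: sum_list_distinct_conv_sum_set poly_mapping_sum_single[symmetric])
  have "z - (\<Sum>p\<leftarrow>map ?f ks. Poly_Mapping.single p 1) \<in> tensor_null M"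
    using *[of ks] assms ks(1) unfolding z by simp
  then have "tensor_class M z = tensor_sum M (map ?f ks)"
    unfolding tensor_sum_def tensor_class_eq_iff .
  moreover have "set (map ?f ks) \<subseteq> {(c \<odot>\<^bsub>M\<^esub> a, b) | c a b. (a, b) \<in> P}"
    using assms(1) ks(1) by auto
  ultimately show ?thesis by blast
qed

section \<open>Presented Hopf superalgebras\<close>

lemma presented_sel [simp]:
  "carrier (presented X d Rel D e s) = carrier (pres_module X Rel)"
  "monoid.mult (presented X d Rel D e s) = monoid.mult (pres_module X Rel)"
  "one (presented X d Rel D e s) = one (pres_module X Rel)"
  "add (presented X d Rel D e s) = add (pres_module X Rel)"
  "smult (presented X d Rel D e s) = smult (pres_module X Rel)"
  "homog (presented X d Rel D e s) =
    (\<lambda>\<alpha>. pres_class X Rel ` {p \<in> carrier (free_alg X). \<forall>w\<in>Poly_Mapping.keys p. wdeg d w = \<alpha>})"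
  "counit (presented X d Rel D e s) = (\<lambda>x. free_counit e (rep x))"
  "antipode (presented X d Rel D e s) = (\<lambda>x. pres_class X Rel (free_antipode d s (rep x)))"
  by (simp_all add: presented_def Let_def)

definition word_comult :: "('x \<Rightarrow> bit) \<Rightarrow> ('x \<Rightarrow> (('x free_monoid \<times> 'x free_monoid) \<Rightarrow>\<^sub>0 'k::field)) \<Rightarrow>
    'x list \<Rightarrow> (('x free_monoid \<times> 'x free_monoid) \<Rightarrow>\<^sub>0 'k)" where
  "word_comult d D l = foldr (\<lambda>x. tmul d (D x)) l (Poly_Mapping.single (0, 0) 1)"

lemma word_comult_simps [simp]:
  "word_comult d D [] = Poly_Mapping.single (0, 0) 1"
  "word_comult d D (x # l) = tmul d (D x) (word_comult d D l)"
  by (simp_all add: word_comult_def)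

lemma free_comult_word: "free_comult d D = lin_ext (\<lambda>w. word_comult d D (letters w))"
  by (simp add: free_comult_def word_comult_def)

text \<open>The assumptions are closure conditions on the alphabet \<open>X\<close>. Since the
  structure maps of \<open>H\<close> are computed on representatives, a form that factors through
  \<open>I\<close> can be evaluated on them directly.\<close>

locale presentation =
  fixes X :: "'x set" and d :: "'x \<Rightarrow> bit" and Rel :: "('x, 'k::field) free_algebra set"
    and D :: "'x \<Rightarrow> (('x free_monoid \<times> 'x free_monoid) \<Rightarrow>\<^sub>0 'k)" and e :: "'x \<Rightarrow> 'k"
    and s :: "'x \<Rightarrow> ('x, 'k) free_algebra"
  assumes Rel: "Rel \<subseteq> carrier (free_alg X)"
    and D_words: "x \<in> X \<Longrightarrow> Poly_Mapping.keys (D x) \<subseteq> words X \<times> words X"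
    and s_carrier: "x \<in> X \<Longrightarrow> s x \<in> carrier (free_alg X)"
begin

abbreviation "H \<equiv> presented X d Rel D e s"
abbreviation "I \<equiv> rel_ideal X Rel"
abbreviation "F \<equiv> free_alg X :: ('k, ('x, 'k) free_algebra) module"
abbreviation "cl \<equiv> pres_class X Rel"

sublocale ideal I F
  unfolding rel_ideal_def by (rule ring.genideal_ideal[OF ring_free_alg Rel])

lemma carrier_closed [simp]:
  "p \<in> carrier F \<Longrightarrow> p' \<in> carrier F \<Longrightarrow> p + p' \<in> carrier F"
  "p \<in> carrier F \<Longrightarrow> p' \<in> carrier F \<Longrightarrow> p * p' \<in> carrier F"
  "1 \<in> carrier F" "0 \<in> carrier F"
  "p \<in> carrier F \<Longrightarrow> scal c p \<in> carrier F"
  using a_closed[of p p'] m_closed[of p p'] keys_scal[of c p]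
  by (auto simp: carrier_free_alg)

lemma single_carrier [simp]: "w \<in> words X \<Longrightarrow> Poly_Mapping.single w c \<in> carrier F"
  by (simp add: carrier_free_alg)

lemma ideal_closed:
  "p \<in> I \<Longrightarrow> p' \<in> I \<Longrightarrow> p + p' \<in> I"
  "p \<in> I \<Longrightarrow> p' \<in> carrier F \<Longrightarrow> p * p' \<in> I"
  "p \<in> I \<Longrightarrow> p' \<in> carrier F \<Longrightarrow> p' * p \<in> I"
  "0 \<in> I" "p \<in> I \<Longrightarrow> scal c p \<in> I" "p \<in> I \<Longrightarrow> - p \<in> I" "p \<in> I \<Longrightarrow> p \<in> carrier F"
proof -
  show 1: "p' * p \<in> I" if "p \<in> I" "p' \<in> carrier F" for p p'
    using I_l_closed[OF that] by simp
  show "p \<in> I \<Longrightarrow> p' \<in> I \<Longrightarrow> p + p' \<in> I" "p \<in> I \<Longrightarrow> p' \<in> carrier F \<Longrightarrow> p * p' \<in> I" "0 \<in> I"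
    "p \<in> I \<Longrightarrow> p \<in> carrier F"
    using additive_subgroup.a_closed[OF additive_subgroup_axioms, of p p'] I_r_closed[of p p']
      additive_subgroup.zero_closed[OF additive_subgroup_axioms] Icarr by simp_all
  show 2: "scal c p \<in> I" if "p \<in> I" for c p
    unfolding scal_mult by (rule 1[OF that]) simp
  have "scal (- 1) p = - p" by (simp add: poly_mapping_eq_iff fun_eq_iff)
  with 2[of p "- 1"] show "p \<in> I \<Longrightarrow> - p \<in> I" by simp
qed

lemma mem_cl: "x \<in> cl p \<longleftrightarrow> x - p \<in> I"
proof -
  have "x \<in> cl p \<longleftrightarrow> (\<exists>h\<in>I. x = h + p)"
    by (simp add: pres_class_def a_r_coset_def')
  also have "\<dots> \<longleftrightarrow> x - p \<in> I" by (metis add_diff_cancel diff_add_cancel)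
  finally show ?thesis .
qed

lemma cl_eq_iff: "cl p = cl p' \<longleftrightarrow> p - p' \<in> I"
proof
  assume "cl p = cl p'"
  moreover have "p \<in> cl p" by (simp add: mem_cl ideal_closed)
  ultimately show "p - p' \<in> I" by (simp add: mem_cl)
next
  assume *: "p - p' \<in> I"
  have "x - p \<in> I \<longleftrightarrow> x - p' \<in> I" for x
    using ideal_closed(1)[OF *, of "x - p"] ideal_closed(1)[OF ideal_closed(6)[OF *], of "x - p'"]
    by auto
  then show "cl p = cl p'" by (auto simp: mem_cl)
qed

lemma carrier_H: "carrier (pres_module X Rel) = cl ` carrier F"
  by (auto simp: pres_module_def Let_def FactRing_def A_RCOSETS_def' pres_class_def)

lemma cl_carrier [simp]: "p \<in> carrier F \<Longrightarrow> cl p \<in> carrier (pres_module X Rel)"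
  by (simp add: carrier_H)

lemma cl_mult: "p \<in> carrier F \<Longrightarrow> p' \<in> carrier F \<Longrightarrow> cl p \<otimes>\<^bsub>pres_module X Rel\<^esub> cl p' = cl (p * p')"
  using rcoset_mult_add[of p p'] by (simp add: pres_module_def Let_def FactRing_def pres_class_def)

lemma cl_add: "p \<in> carrier F \<Longrightarrow> p' \<in> carrier F \<Longrightarrow> cl p \<oplus>\<^bsub>pres_module X Rel\<^esub> cl p' = cl (p + p')"
  using a_rcos_sum[of p p'] by (simp add: pres_module_def Let_def FactRing_def pres_class_def)

lemma cl_one: "\<one>\<^bsub>pres_module X Rel\<^esub> = cl 1"
  by (simp add: pres_module_def Let_def FactRing_def pres_class_def)

lemma rep_cl: "rep (cl p) - p \<in> I"
proof -
  have "p \<in> cl p" by (simp add: mem_cl ideal_closed)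
  then have "rep (cl p) \<in> cl p" unfolding rep_def by (rule someI)
  then show ?thesis by (simp add: mem_cl)
qed

lemma rep_carrier: "x \<in> carrier (pres_module X Rel) \<Longrightarrow> rep x \<in> carrier F"
proof -
  assume "x \<in> carrier (pres_module X Rel)"
  then obtain p where p: "x = cl p" "p \<in> carrier F" unfolding carrier_H by blast
  have "rep x - p + p \<in> carrier F"
    using rep_cl[of p] p by (metis carrier_closed(1) ideal_closed(7))
  then show ?thesis by simp
qed

lemma cl_rep: "x \<in> carrier (pres_module X Rel) \<Longrightarrow> cl (rep x) = x"
  unfolding carrier_H using rep_cl cl_eq_iff by blast

lemma cl_smult: "c \<odot>\<^bsub>pres_module X Rel\<^esub> cl p = cl (scal c p)"
proof -
  have "c \<odot>\<^bsub>pres_module X Rel\<^esub> cl p = cl (scal c (rep (cl p)))"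
    by (simp add: pres_module_def Let_def)
  also have "\<dots> = cl (scal c p)"
    unfolding cl_eq_iff scal_diff_right[symmetric] by (intro ideal_closed rep_cl)
  finally show ?thesis .
qed

lemma homog_carrier: "a \<in> homog H \<alpha> \<Longrightarrow> a \<in> carrier H"
  by auto

lemma homogeneous_hdeg: "homogeneous H a \<Longrightarrow> a \<in> homog H (hdeg H a)"
proof -
  assume "homogeneous H a"
  then obtain \<alpha> where "a \<in> homog H \<alpha>" unfolding homogeneous_def by blast
  then show ?thesis unfolding hdeg_def by (cases \<alpha>) (simp_all del: presented_sel)
qed

lemma homogeneous_word:
  assumes "w \<in> words X"
  shows "homogeneous H (cl (Poly_Mapping.single w c))"
proof -
  have "cl (Poly_Mapping.single w c) \<in> homog H (wdeg d w)"
    using assms by (auto intro!: imageI)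
  then show ?thesis unfolding homogeneous_def by blast
qed

lemma word_comult_words:
  "set l \<subseteq> X \<Longrightarrow> Poly_Mapping.keys (word_comult d D l) \<subseteq> words X \<times> words X"
proof (induction l)
  case (Cons x l)
  then show ?case using keys_tmul[of d "D x" "word_comult d D l"] D_words[of x] by fastforce
qed simp

lemma free_comult_words:
  assumes "p \<in> carrier F"
  shows "Poly_Mapping.keys (free_comult d D p) \<subseteq> words X \<times> words X"
proof -
  have "Poly_Mapping.keys (word_comult d D (letters b)) \<subseteq> words X \<times> words X"
    if "b \<in> Poly_Mapping.keys p" for b
    using that assms word_comult_words[of "letters b"] by (auto simp: carrier_free_alg words_def)
  then show ?thesis
    unfolding free_comult_word using keys_lin_ext by fastforce
qed

definition coproduct :: "('x, 'k) free_algebra set \<Rightarrow> (('x, 'k) free_algebra set \<times> ('x, 'k) free_algebra set) \<Rightarrow>\<^sub>0 'k" where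
  "coproduct x = lin_ext (\<lambda>(u, v). Poly_Mapping.single (cl (Poly_Mapping.single u 1), cl (Poly_Mapping.single v 1)) 1)
           (free_comult d D (rep x))"

lemma comult_H: "comult H x = tensor_class (pres_module X Rel) (coproduct x)"
  by (simp add: presented_def Let_def coproduct_def)

lemma tensor_H: "tensor_class H = tensor_class (pres_module X Rel)"
  "tensor_sum H = tensor_sum (pres_module X Rel)"
  by (simp_all add: fun_eq_iff tensor_sum_def tensor_class_def tensor_null_def)

lemma ev_coproduct:
  "ev f (coproduct x) =
    ev (\<lambda>(u, v). f (cl (Poly_Mapping.single u 1), cl (Poly_Mapping.single v 1))) (free_comult d D (rep x))"
  unfolding coproduct_def ev_lin_ext by (simp add: case_prod_unfold)

lemma coproduct_sum_exists:
  assumes "x \<in> carrier H"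
  shows "\<exists>ps. (\<forall>(a, b)\<in>set ps. homogeneous H a \<and> homogeneous H b) \<and> comult H x = tensor_sum H ps"
proof -
  let ?P = "{(cl (Poly_Mapping.single u 1), cl (Poly_Mapping.single v 1)) | u v. u \<in> words X \<and> v \<in> words X}"
  have "Poly_Mapping.keys (coproduct x) \<subseteq> ?P"
    using free_comult_words[OF rep_carrier, of x] assms keys_lin_ext
    unfolding coproduct_def by (fastforce split: prod.splits)
  moreover have "?P \<subseteq> carrier (pres_module X Rel) \<times> carrier (pres_module X Rel)"
    by auto
  ultimately obtain ps where
    "set ps \<subseteq> {(c \<odot>\<^bsub>pres_module X Rel\<^esub> a, b) | c a b. (a, b) \<in> ?P}"
    "comult H x = tensor_sum H ps"
    using tensor_sum_exists[of "coproduct x" ?P "pres_module X Rel"]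
    unfolding comult_H tensor_H by meson
  then show ?thesis
    by (intro exI[of _ ps]) (use homogeneous_word in \<open>fastforce simp: cl_smult\<close>)
qed

text \<open>The elements killed by \<open>f\<close> after multiplication with arbitrary words on
  both sides form an ideal; it contains \<open>Rel\<close>, hence the ideal generated by
  \<open>Rel\<close>.\<close>

lemma ev_ideal_zero:
  assumes f: "\<And>u v r. u \<in> words X \<Longrightarrow> v \<in> words X \<Longrightarrow> r \<in> Rel \<Longrightarrow> ev (\<lambda>w. f (u + w + v)) r = 0"
    and p: "p \<in> I"
  shows "ev f p = 0"
proof -
  let ?J = "{p \<in> carrier F. \<forall>u\<in>words X. \<forall>v\<in>words X. ev (\<lambda>w. f (u + w + v)) p = 0}"
  have "ideal ?J F"
  proof (rule idealI[OF ring_free_alg])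
    show "subgroup ?J (add_monoid F)"
    proof (rule group.subgroupI[OF a_group])
      show "?J \<noteq> {}" using carrier_closed(4) by (intro ex_in_conv[THEN iffD1] exI[of _ 0]) simp
      fix a assume a: "a \<in> ?J"
      then have "- a \<in> carrier F" by (simp add: carrier_free_alg)
      moreover have "inv\<^bsub>add_monoid F\<^esub> a = - a"
        using group.inv_equality[OF a_group, of "- a" a] a calculation by simp
      ultimately show "inv\<^bsub>add_monoid F\<^esub> a \<in> ?J" using a by simp
    qed (use carrier_closed(1) in auto)
  next
    fix a x assume a: "a \<in> ?J" and x: "x \<in> carrier F"
    have "ev (\<lambda>w. f (u + w + v)) (x * a) = 0" if "u \<in> words X" "v \<in> words X" for u v
    proof -
      have "ev (\<lambda>w. f (u + w + v)) (x * a) = ev (\<lambda>u'. ev (\<lambda>w. f ((u + u') + w + v)) a) x"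
        by (simp add: add.assoc)
      also have "\<dots> = 0"
        by (rule ev_fun_zero) (use a x that in \<open>auto simp: carrier_free_alg subset_iff simp flip: add.assoc\<close>)
      finally show ?thesis .
    qed
    then show "x \<otimes>\<^bsub>F\<^esub> a \<in> ?J" using a x by simp
    have "ev (\<lambda>w. f (u + w + v)) (a * x) = 0" if "u \<in> words X" "v \<in> words X" for u v
    proof -
      have "ev (\<lambda>w. f (u + w + v)) (a * x) = ev (\<lambda>v'. ev (\<lambda>w. f (u + w + (v' + v))) a) x"
        by (subst ev_swap) (simp add: add.assoc)
      also have "\<dots> = 0"
        by (rule ev_fun_zero) (use a x that in \<open>simp add: carrier_free_alg subset_iff\<close>)
      finally show ?thesis .
    qed
    then show "a \<otimes>\<^bsub>F\<^esub> x \<in> ?J" using a x by simp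
  qed
  moreover have "Rel \<subseteq> ?J" using Rel f by auto
  ultimately have "I \<subseteq> ?J" unfolding rel_ideal_def by (rule genideal_minimal)
  \<comment> \<open>Empty words on both sides give back \<open>f\<close> itself.\<close>
  then have "ev (\<lambda>w. f (0 + w + 0)) p = 0" using p words_zero by blast
  then show ?thesis by simp
qed

end

section \<open>Pairings of presented Hopf superalgebras\<close>

context presentation begin

lemma list_antipode_carrier: "set l \<subseteq> X \<Longrightarrow> list_antipode d s l \<in> carrier F"
  by (induction l) (simp_all add: s_carrier)

lemma free_antipode_carrier:
  assumes "p \<in> carrier F"
  shows "free_antipode d s p \<in> carrier F"
proof -
  have "Poly_Mapping.keys (list_antipode d s (letters b)) \<subseteq> words X" if "b \<in> Poly_Mapping.keys p" for b
    using list_antipode_carrier[of "letters b"] that assms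
    by (auto simp: carrier_free_alg words_def)
  then show ?thesis
    unfolding carrier_free_alg free_antipode_def using keys_lin_ext by fastforce
qed

lemma sum_comult_words_cong:
  assumes "y \<in> words X" "\<And>u v. u \<in> words X \<Longrightarrow> v \<in> words X \<Longrightarrow> f u v = g u v"
  shows "ev (\<lambda>(u, v). f u v) (word_comult d D (letters y)) = ev (\<lambda>(u, v). g u v) (word_comult d D (letters y))"
  using word_comult_words[of "letters y"] assms by (intro ev_cong) (auto simp: words_def)

lemma ev_carrier_cong:
  assumes "p \<in> carrier F" "\<And>w. w \<in> words X \<Longrightarrow> f w = g w"
  shows "ev f p = ev g p"
  using assms by (intro ev_cong) (auto simp: carrier_free_alg)

end

lemma ev_split_cong:
  assumes "\<And>u v. (u, v) \<in> Poly_Mapping.keys p \<Longrightarrow> f u v = g u v"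
  shows "ev (\<lambda>(u, v). f u v) p = ev (\<lambda>(u, v). g u v) p"
  using assms by (intro ev_cong) auto

lemma ev_split_sum: "ev (\<lambda>(u, v). \<Sum>s\<in>S. f s u v) p = (\<Sum>s\<in>S. ev (\<lambda>(u, v). f s u v) p)"
  unfolding case_prod_unfold by (rule ev_fun_sum)

lemma ev_split_mult: "ev (\<lambda>(u, v). c * f u v) p = c * ev (\<lambda>(u, v). f u v) p"
  unfolding case_prod_unfold by (rule ev_fun_mult)

lemma ev_swap_split: "ev (\<lambda>a. ev (\<lambda>(u, v). B a u v) p') p = ev (\<lambda>(u, v). ev (\<lambda>a. B a u v) p) p'"
  unfolding case_prod_unfold by (rule ev_swap)

text \<open>In a pairing the sign is \<sigma>(deg a', deg h1). By \<open>even\<close> a summand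
  survives only if h1 has the degree of a, so the sign is constant and stands in front of the sum in
  \<open>mult\<close>. In this form the axioms are symmetric, and the locale can be interpreted with
  the arguments exchanged.\<close>

locale word_pairing =
  A: presentation X dX RX DX eX sX + H: presentation Y dY RY DY eY sY
  for X :: "'x set" and dX and RX :: "('x, 'k::field) free_algebra set" and DX eX sX
    and Y :: "'y set" and dY and RY :: "('y, 'k) free_algebra set" and DY eY sY +
  fixes \<Phi> :: "'x free_monoid \<Rightarrow> 'y free_monoid \<Rightarrow> 'k"
  assumes even: "u \<in> words X \<Longrightarrow> y \<in> words Y \<Longrightarrow> wdeg dX u \<noteq> wdeg dY y \<Longrightarrow> \<Phi> u y = 0"
    and unit: "y \<in> words Y \<Longrightarrow> \<Phi> 0 y = prod_list (map eY (letters y))"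
    and mult: "u \<in> words X \<Longrightarrow> v \<in> words X \<Longrightarrow> y \<in> words Y \<Longrightarrow>
      \<Phi> (u + v) y = koszul (wdeg dX u) (wdeg dX v) *
        ev (\<lambda>(y1, y2). \<Phi> u y1 * \<Phi> v y2) (word_comult dY DY (letters y))"
    and rel: "r \<in> RX \<Longrightarrow> y \<in> words Y \<Longrightarrow> ev (\<lambda>w. \<Phi> w y) r = 0"
begin

text \<open>Parity lets the degree of one factor be read off from the other argument. The first sign
  is free of \<open>u\<close>, the second free of \<open>v\<close>, so a relation can be substituted
  for that factor without being split into homogeneous parts.\<close>

lemma mult_deg:
  assumes "u \<in> words X" "v \<in> words X" "y \<in> words Y"
  shows "\<Phi> (u + v) y =
        ev (\<lambda>(y1, y2). koszul (wdeg dY y1) (wdeg dX v) * (\<Phi> u y1 * \<Phi> v y2)) (word_comult dY DY (letters y))"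
    and "\<Phi> (u + v) y =
        ev (\<lambda>(y1, y2). koszul (wdeg dX u) (wdeg dY y2) * (\<Phi> u y1 * \<Phi> v y2)) (word_comult dY DY (letters y))"
proof -
  show "\<Phi> (u + v) y =
        ev (\<lambda>(y1, y2). koszul (wdeg dY y1) (wdeg dX v) * (\<Phi> u y1 * \<Phi> v y2)) (word_comult dY DY (letters y))"
    unfolding mult[OF assms] ev_split_mult[symmetric]
    by (rule H.sum_comult_words_cong[OF assms(3)]) (metis assms(1) even mult_zero_left mult_zero_right)
  show "\<Phi> (u + v) y =
        ev (\<lambda>(y1, y2). koszul (wdeg dX u) (wdeg dY y2) * (\<Phi> u y1 * \<Phi> v y2)) (word_comult dY DY (letters y))"
    unfolding mult[OF assms] ev_split_mult[symmetric]
    by (rule H.sum_comult_words_cong[OF assms(3)]) (metis assms(2) even mult_zero_right)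
qed

lemma ideal_zero:
  assumes "p \<in> A.I" "y \<in> words Y"
  shows "ev (\<lambda>w. \<Phi> w y) p = 0"
proof (rule A.ev_ideal_zero[OF _ assms(1)])
  fix u v r assume u: "u \<in> words X" and v: "v \<in> words X" and r: "r \<in> RX"
  have rc: "r \<in> carrier A.F" using A.Rel r by blast
  \<comment> \<open>Left multiples are settled for all \<open>y\<close>, because the product with
    \<open>v\<close> on the right evaluates them at the components \<open>y1\<close> of the
    coproduct.\<close>
  have left: "ev (\<lambda>w. \<Phi> (u + w) y) r = 0" if y: "y \<in> words Y" for y
  proof -
    have "ev (\<lambda>w. \<Phi> (u + w) y) r =
      ev (\<lambda>w. ev (\<lambda>(y1, y2). koszul (wdeg dX u) (wdeg dY y2) * (\<Phi> u y1 * \<Phi> w y2)) (word_comult dY DY (letters y))) r"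
      by (rule A.ev_carrier_cong[OF rc]) (rule mult_deg(2)[OF u _ y])
    also have "\<dots> = ev (\<lambda>(y1, y2). koszul (wdeg dX u) (wdeg dY y2) * (\<Phi> u y1 * ev (\<lambda>w. \<Phi> w y2) r)) (word_comult dY DY (letters y))"
      unfolding ev_swap_split by (simp add: ev_fun_mult)
    also have "\<dots> = ev (\<lambda>(y1, y2). 0) (word_comult dY DY (letters y))"
      by (rule H.sum_comult_words_cong[OF y]) (simp add: rel r)
    also have "\<dots> = 0" by (rule ev_fun_zero) auto
    finally show ?thesis .
  qed
  have "ev (\<lambda>w. \<Phi> (u + w + v) y) r =
      ev (\<lambda>w. ev (\<lambda>(y1, y2). koszul (wdeg dY y1) (wdeg dX v) * (\<Phi> (u + w) y1 * \<Phi> v y2)) (word_comult dY DY (letters y))) r"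
    by (rule A.ev_carrier_cong[OF rc]) (rule mult_deg(1)[OF _ v assms(2)], simp add: u)
  also have "\<dots> = ev (\<lambda>(y1, y2). koszul (wdeg dY y1) (wdeg dX v) * (ev (\<lambda>w. \<Phi> (u + w) y1) r * \<Phi> v y2)) (word_comult dY DY (letters y))"
    unfolding ev_swap_split by (simp add: ev_fun_mult ev_fun_mult_right)
  also have "\<dots> = ev (\<lambda>(y1, y2). 0) (word_comult dY DY (letters y))"
    by (rule H.sum_comult_words_cong[OF assms(2)]) (simp add: left)
  also have "\<dots> = 0" by (rule ev_fun_zero) auto
  finally show "ev (\<lambda>w. \<Phi> (u + w + v) y) r = 0" .
qed

definition free_form :: "('x, 'k) free_algebra \<Rightarrow> ('y, 'k) free_algebra \<Rightarrow> 'k" where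
  "free_form p h = ev (\<lambda>u. ev (\<Phi> u) h) p"

lemma free_form_ideal: "p \<in> A.I \<Longrightarrow> h \<in> carrier H.F \<Longrightarrow> free_form p h = 0"
  unfolding free_form_def by (subst ev_swap, rule ev_fun_zero) (auto simp: ideal_zero carrier_free_alg)

lemma free_form_linear:
  "free_form (p + p') h = free_form p h + free_form p' h" "free_form p (h + h') = free_form p h + free_form p h'"
  "free_form (scal c p) h = c * free_form p h" "free_form p (scal c h) = c * free_form p h"
  "free_form (p - p') h = free_form p h - free_form p' h" "free_form p (h - h') = free_form p h - free_form p h'"
  by (simp_all add: free_form_def ev_fun_add ev_fun_mult) (simp add: ev_def[of _ p] algebra_simps sum_subtractf)

lemma free_form_mult:
  assumes p: "p \<in> carrier A.F" "\<And>w. w \<in> Poly_Mapping.keys p \<Longrightarrow> wdeg dX w = \<alpha>"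
    and p': "p' \<in> carrier A.F" "\<And>w. w \<in> Poly_Mapping.keys p' \<Longrightarrow> wdeg dX w = \<alpha>'"
    and h: "h \<in> carrier H.F"
  shows "free_form (p * p') h = koszul \<alpha> \<alpha>' *
    ev (\<lambda>(u, v). free_form p (Poly_Mapping.single u 1) * free_form p' (Poly_Mapping.single v 1)) (free_comult dY DY h)"
proof -
  have "free_form (p * p') h = ev (\<lambda>u. ev (\<lambda>v. ev (\<lambda>y. \<Phi> (u + v) y) h) p') p"
    by (simp add: free_form_def)
  also have "\<dots> = ev (\<lambda>u. ev (\<lambda>v. ev (\<lambda>y. koszul \<alpha> \<alpha>' *
      ev (\<lambda>(y1, y2). \<Phi> u y1 * \<Phi> v y2) (word_comult dY DY (letters y))) h) p') p"
    by (intro ev_cong, subst mult) (use assms in \<open>auto simp: carrier_free_alg\<close>)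
  also have "\<dots> = koszul \<alpha> \<alpha>' * ev (\<lambda>u. ev (\<lambda>v. ev (\<lambda>(y1, y2). \<Phi> u y1 * \<Phi> v y2) (free_comult dY DY h)) p') p"
    by (simp add: ev_fun_mult free_comult_word)
  also have "ev (\<lambda>u. ev (\<lambda>v. ev (\<lambda>(y1, y2). \<Phi> u y1 * \<Phi> v y2) (free_comult dY DY h)) p') p =
     ev (\<lambda>(y1, y2). ev (\<lambda>u. ev (\<lambda>v. \<Phi> u y1 * \<Phi> v y2) p') p) (free_comult dY DY h)"
    unfolding ev_swap_split ..
  also have "\<dots> = ev (\<lambda>(u, v). free_form p (Poly_Mapping.single u 1) * free_form p' (Poly_Mapping.single v 1)) (free_comult dY DY h)"
    by (simp add: free_form_def ev_prod)
  finally show ?thesis .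
qed

lemma free_form_even:
  assumes "p \<in> carrier A.F" "\<And>w. w \<in> Poly_Mapping.keys p \<Longrightarrow> wdeg dX w = \<alpha>"
    and "h \<in> carrier H.F" "\<And>w. w \<in> Poly_Mapping.keys h \<Longrightarrow> wdeg dY w = \<beta>" "\<alpha> \<noteq> \<beta>"
  shows "free_form p h = 0"
  unfolding free_form_def using assms
  by (intro ev_fun_zero) (auto simp: carrier_free_alg intro!: even)

lemma free_form_one: "h \<in> carrier H.F \<Longrightarrow> free_form 1 h = free_counit eY h"
proof -
  assume h: "h \<in> carrier H.F"
  have "free_form 1 h = ev (\<Phi> 0) h" by (simp add: free_form_def)
  also have "\<dots> = ev (\<lambda>y. prod_list (map eY (letters y))) h"
    by (rule H.ev_carrier_cong[OF h unit])
  finally show ?thesis by (simp add: free_counit_def ev_def)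
qed

end

text \<open>The name refers to descent: the form also vanishes on the ideal in the second argument,
  so it is defined on both quotients. Trivial radicals are not claimed.\<close>

locale nondegenerate_word_pairing = word_pairing +
  assumes ideal_zero_right: "w \<in> words X \<Longrightarrow> h \<in> H.I \<Longrightarrow> ev (\<Phi> w) h = 0"
begin

lemma free_form_ideal_right: "p \<in> carrier A.F \<Longrightarrow> h \<in> H.I \<Longrightarrow> free_form p h = 0"
  unfolding free_form_def by (rule ev_fun_zero) (auto simp: ideal_zero_right carrier_free_alg)

definition class_form where
  "class_form a h = free_form (rep a) (rep h)"

lemma class_form_cl:
  assumes "p \<in> carrier A.F" "h \<in> carrier H.F"
  shows "class_form (A.cl p) (H.cl h) = free_form p h"
proof -
  have 1: "rep (A.cl p) \<in> carrier A.F" "rep (H.cl h) \<in> carrier H.F"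
    using assms by (simp_all add: A.rep_carrier H.rep_carrier)
  have "free_form (rep (A.cl p)) (rep (H.cl h)) - free_form p (rep (H.cl h)) = 0"
    unfolding free_form_linear(5)[symmetric] using 1 A.rep_cl by (intro free_form_ideal) auto
  moreover have "free_form p (rep (H.cl h)) - free_form p h = 0"
    unfolding free_form_linear(6)[symmetric] using assms H.rep_cl by (intro free_form_ideal_right) auto
  ultimately show ?thesis by (simp add: class_form_def)
qed

lemma class_form_linear:
  assumes "a \<in> carrier A.H" "a' \<in> carrier A.H" "h \<in> carrier H.H" "h' \<in> carrier H.H"
  shows "class_form (a \<oplus>\<^bsub>A.H\<^esub> a') h = class_form a h + class_form a' h"
    "class_form a (h \<oplus>\<^bsub>H.H\<^esub> h') = class_form a h + class_form a h'"
    "class_form (c \<odot>\<^bsub>A.H\<^esub> a) h = c * class_form a h"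
    "class_form a (c \<odot>\<^bsub>H.H\<^esub> h) = c * class_form a h"
  using assms
  by (auto simp: A.carrier_H H.carrier_H A.cl_add H.cl_add A.cl_smult H.cl_smult class_form_cl free_form_linear)

lemma class_form_even:
  assumes "a \<in> homog A.H \<alpha>" "h \<in> homog H.H \<beta>" "\<alpha> \<noteq> \<beta>"
  shows "class_form a h = 0"
  using assms by (auto simp: class_form_cl intro!: free_form_even)

lemma class_form_mult:
  assumes "a \<in> homog A.H \<alpha>" "a' \<in> homog A.H \<alpha>'" "h \<in> carrier H.H"
    and hs: "\<forall>(h1, h2)\<in>set hs. homogeneous H.H h1 \<and> homogeneous H.H h2" "comult H.H h = tensor_sum H.H hs"
  shows "class_form (a \<otimes>\<^bsub>A.H\<^esub> a') h =
    (\<Sum>(h1, h2)\<leftarrow>hs. koszul \<alpha> \<alpha>' * (class_form a h1 * class_form a' h2))"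
proof -
  obtain p where p: "a = A.cl p" "p \<in> carrier A.F" "\<And>w. w \<in> Poly_Mapping.keys p \<Longrightarrow> wdeg dX w = \<alpha>"
    using assms(1) by auto
  obtain p' where p': "a' = A.cl p'" "p' \<in> carrier A.F" "\<And>w. w \<in> Poly_Mapping.keys p' \<Longrightarrow> wdeg dX w = \<alpha>'"
    using assms(2) by auto
  have h: "rep h \<in> carrier H.F" "H.cl (rep h) = h"
    using assms(3) by (simp_all add: H.rep_carrier H.cl_rep)
  let ?M = "pres_module Y RY"
  let ?B = "\<lambda>h1 h2. koszul \<alpha> \<alpha>' * (class_form a h1 * class_form a' h2)"
  have aa': "a \<in> carrier A.H" "a' \<in> carrier A.H" using p p' by simp_all
  have B: "bilinear_on ?M ?B"
    using class_form_linear(2,4)[OF aa'(1,1)] class_form_linear(2,4)[OF aa'(2,2)]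
    unfolding bilinear_on_def by (simp add: algebra_simps)
  have "class_form (a \<otimes>\<^bsub>A.H\<^esub> a') h = class_form (A.cl (p * p')) (H.cl (rep h))"
    using p p' h by (simp add: A.cl_mult)
  also have "\<dots> = free_form (p * p') (rep h)"
    using p p' h by (intro class_form_cl) simp_all
  also have "\<dots> = ev (\<lambda>(u, v). koszul \<alpha> \<alpha>' * (free_form p (Poly_Mapping.single u 1) * free_form p' (Poly_Mapping.single v 1))) (free_comult dY DY (rep h))"
    unfolding ev_split_mult by (rule free_form_mult) (use p p' h in auto)
  also have "\<dots> = ev (\<lambda>(u, v). ?B (H.cl (Poly_Mapping.single u 1)) (H.cl (Poly_Mapping.single v 1))) (free_comult dY DY (rep h))"
    using H.free_comult_words[OF h(1)] p p' by (intro ev_cong) (auto simp: class_form_cl)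
  also have "\<dots> = ev (\<lambda>(h1, h2). ?B h1 h2) (H.coproduct h)"
    unfolding H.ev_coproduct by simp
  also have "\<dots> = (\<Sum>(h1, h2)\<leftarrow>hs. ?B h1 h2)"
    using hs(2) unfolding H.comult_H H.tensor_H by (rule ev_tensor_sum[OF B])
  finally show ?thesis .
qed

lemma class_form_one: "h \<in> carrier H.H \<Longrightarrow> class_form \<one>\<^bsub>A.H\<^esub> h = counit H.H h"
  using free_form_one[of "rep h"] class_form_cl[of 1 "rep h"]
  by (simp add: A.cl_one H.cl_rep H.rep_carrier)

end

text \<open>The two interpretations support each other: \<open>ideal_zero\<close> of one is the
  vanishing in the second argument that the other has to satisfy.\<close>

locale hopf_word_pairing =
  L: word_pairing X dX RX DX eX sX Y dY RY DY eY sY \<Phi> +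
  R: word_pairing Y dY RY DY eY sY X dX RX DX eX sX "\<lambda>y u. \<Phi> u y"
  for X :: "'x set" and dX and RX :: "('x, 'k::field) free_algebra set" and DX eX sX
    and Y :: "'y set" and dY and RY :: "('y, 'k) free_algebra set" and DY eY sY and \<Phi> +
  assumes antipode: "set u \<subseteq> X \<Longrightarrow> set y \<subseteq> Y \<Longrightarrow>
    ev (\<lambda>w. \<Phi> w (FM y)) (list_antipode dX sX u) = ev (\<Phi> (FM u)) (list_antipode dY sY y)"
begin

sublocale L: nondegenerate_word_pairing X dX RX DX eX sX Y dY RY DY eY sY \<Phi>
  by unfold_locales (rule R.ideal_zero)

sublocale R: nondegenerate_word_pairing Y dY RY DY eY sY X dX RX DX eX sX "\<lambda>y u. \<Phi> u y"
  by unfold_locales (rule L.ideal_zero)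

lemma class_form_flip: "R.class_form h a = L.class_form a h"
  unfolding L.class_form_def R.class_form_def L.free_form_def R.free_form_def by (rule ev_swap)

lemma class_form_antipode:
  assumes "a \<in> carrier L.A.H" "h \<in> carrier L.H.H"
  shows "L.class_form (antipode L.A.H a) h = L.class_form a (antipode L.H.H h)"
proof -
  have 1: "rep a \<in> carrier L.A.F" "rep h \<in> carrier L.H.F"
    using assms by (simp_all add: L.A.rep_carrier L.H.rep_carrier)
  have "L.class_form (antipode L.A.H a) h = L.class_form (antipode L.A.H a) (L.H.cl (rep h))"
    using assms by (simp add: L.H.cl_rep)
  also have "\<dots> = L.free_form (free_antipode dX sX (rep a)) (rep h)"
    using 1 by (simp add: L.class_form_cl L.A.free_antipode_carrier)
  also have "\<dots> = ev (\<lambda>u. ev (\<lambda>y. ev (\<lambda>w. \<Phi> w y) (list_antipode dX sX (letters u))) (rep h)) (rep a)"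
    unfolding L.free_form_def free_antipode_def ev_lin_ext by (intro ev_cong ev_swap)
  also have "\<dots> = ev (\<lambda>u. ev (\<lambda>y. ev (\<Phi> u) (list_antipode dY sY (letters y))) (rep h)) (rep a)"
  proof (intro L.A.ev_carrier_cong L.H.ev_carrier_cong 1)
    fix u y assume "u \<in> words X" "y \<in> words Y"
    then show "ev (\<lambda>w. \<Phi> w y) (list_antipode dX sX (letters u)) = ev (\<Phi> u) (list_antipode dY sY (letters y))"
      using antipode[of "letters u" "letters y"] by (simp add: words_def)
  qed
  also have "\<dots> = L.free_form (rep a) (free_antipode dY sY (rep h))"
    unfolding L.free_form_def free_antipode_def by simp
  also have "\<dots> = L.class_form (L.A.cl (rep a)) (antipode L.H.H h)"
    using 1 by (simp add: L.class_form_cl L.H.free_antipode_carrier)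
  also have "\<dots> = L.class_form a (antipode L.H.H h)"
    using assms by (simp add: L.A.cl_rep)
  finally show ?thesis .
qed

text \<open>Restriction to the carriers makes the form extensional, so that uniqueness can be stated
  as equality of functions.\<close>

definition pairing where
  "pairing = (\<lambda>(a, h)\<in>carrier L.A.H \<times> carrier L.H.H. L.class_form a h)"

lemma pairing_eq: "a \<in> carrier L.A.H \<Longrightarrow> h \<in> carrier L.H.H \<Longrightarrow> pairing (a, h) = L.class_form a h"
  by (simp add: pairing_def)

lemma hopf_pairing: "hopf_pairing L.A.H L.H.H pairing"
  unfolding hopf_pairing_def
proof (intro conjI allI impI ballI)
  have add: "a \<oplus>\<^bsub>L.A.H\<^esub> a' \<in> carrier L.A.H" "c \<odot>\<^bsub>L.A.H\<^esub> a \<in> carrier L.A.H"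
    "a \<otimes>\<^bsub>L.A.H\<^esub> a' \<in> carrier L.A.H" "\<one>\<^bsub>L.A.H\<^esub> \<in> carrier L.A.H" "antipode L.A.H a \<in> carrier L.A.H"
    if "a \<in> carrier L.A.H" "a' \<in> carrier L.A.H" for a a' c
    using that by (auto simp: L.A.carrier_H L.A.cl_add L.A.cl_smult L.A.cl_mult L.A.cl_one
        intro!: imageI L.A.free_antipode_carrier L.A.rep_carrier)
  have add': "a \<oplus>\<^bsub>L.H.H\<^esub> a' \<in> carrier L.H.H" "c \<odot>\<^bsub>L.H.H\<^esub> a \<in> carrier L.H.H"
    "a \<otimes>\<^bsub>L.H.H\<^esub> a' \<in> carrier L.H.H" "\<one>\<^bsub>L.H.H\<^esub> \<in> carrier L.H.H" "antipode L.H.H a \<in> carrier L.H.H"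
    if "a \<in> carrier L.H.H" "a' \<in> carrier L.H.H" for a a' c
    using that by (auto simp: L.H.carrier_H L.H.cl_add L.H.cl_smult L.H.cl_mult L.H.cl_one
        intro!: imageI L.H.free_antipode_carrier L.H.rep_carrier)
  have hA: "a \<in> homog L.A.H (hdeg L.A.H a)" "a \<in> carrier L.A.H" if "homogeneous L.A.H a" for a
    using L.A.homogeneous_hdeg[OF that] L.A.homog_carrier by blast+
  have hH: "h \<in> homog L.H.H (hdeg L.H.H h)" "h \<in> carrier L.H.H" if "homogeneous L.H.H h" for h
    using L.H.homogeneous_hdeg[OF that] L.H.homog_carrier by blast+
  show "bilinear_form L.A.H L.H.H pairing"
    unfolding bilinear_form_def
    by (intro conjI ballI allI) (simp_all only: pairing_eq add add' L.class_form_linear)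
  show "pairing (a, h) = 0" if "a \<in> homog L.A.H \<alpha>" "h \<in> homog L.H.H \<eta>" "\<alpha> \<noteq> \<eta>" for \<alpha> \<eta> a h
    using that L.class_form_even L.A.homog_carrier L.H.homog_carrier pairing_eq by metis
  show "pairing (\<one>\<^bsub>L.A.H\<^esub>, h) = counit L.H.H h" if "homogeneous L.H.H h" for h
    using hH[OF that] add L.A.carrier_H
    by (metis L.class_form_one L.A.cl_carrier L.A.cl_one L.A.carrier_closed(3) pairing_eq presented_sel(1,3))
  show "pairing (a, \<one>\<^bsub>L.H.H\<^esub>) = counit L.A.H a" if "homogeneous L.A.H a" for a
    using hA[OF that]
    by (metis R.class_form_one L.H.cl_carrier L.H.cl_one L.H.carrier_closed(3) class_form_flip pairing_eq presented_sel(1,3))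
  show "pairing (antipode L.A.H a, h) = pairing (a, antipode L.H.H h)"
    if "homogeneous L.A.H a \<and> homogeneous L.H.H h" for a h
    using that hA(2)[of a] hH(2)[of h] add(5)[of a a] add'(5)[of h h] by (simp only: pairing_eq class_form_antipode)
  show "pairing (a \<otimes>\<^bsub>L.A.H\<^esub> a', h) =
      (\<Sum>(h1, h2)\<leftarrow>hs. koszul (hdeg L.A.H a') (hdeg L.H.H h1) * pairing (a, h1) * pairing (a', h2))"
    if *: "homogeneous L.A.H a \<and> homogeneous L.A.H a' \<and> homogeneous L.H.H h \<and>
      (\<forall>(h1, h2)\<in>set hs. homogeneous L.H.H h1 \<and> homogeneous L.H.H h2) \<and> comult L.H.H h = tensor_sum L.H.H hs"
    for a a' h hs
  proof -
    have "pairing (a \<otimes>\<^bsub>L.A.H\<^esub> a', h) = L.class_form (a \<otimes>\<^bsub>L.A.H\<^esub> a') h"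
      using * hA(2) hH(2) add(3) by (simp only: pairing_eq)
    also have "\<dots> = (\<Sum>(h1, h2)\<leftarrow>hs. koszul (hdeg L.A.H a) (hdeg L.A.H a') * (L.class_form a h1 * L.class_form a' h2))"
      by (rule L.class_form_mult) (use * hA hH(2) in auto)
    also have "\<dots> = (\<Sum>(h1, h2)\<leftarrow>hs. koszul (hdeg L.A.H a') (hdeg L.H.H h1) * pairing (a, h1) * pairing (a', h2))"
    proof (intro arg_cong[where f = sum_list] map_cong refl, clarify)
      fix h1 h2 assume "(h1, h2) \<in> set hs"
      then have h: "homogeneous L.H.H h1" "homogeneous L.H.H h2" using * by auto
      \<comment> \<open>The summand vanishes unless \<open>a\<close> and \<open>h1\<close> have the
        same degree, and then the constant sign and the sign of the axiom coincide.\<close>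
      have 0: "L.class_form a h1 = 0" if "hdeg L.A.H a \<noteq> hdeg L.H.H h1"
        by (rule L.class_form_even[OF hA(1) hH(1) that]) (use * h in auto)
      have "pairing (a, h1) = L.class_form a h1" "pairing (a', h2) = L.class_form a' h2"
        by (rule pairing_eq; use * hA(2) hH(2) h in blast)+
      then show "koszul (hdeg L.A.H a) (hdeg L.A.H a') * (L.class_form a h1 * L.class_form a' h2) =
        koszul (hdeg L.A.H a') (hdeg L.H.H h1) * pairing (a, h1) * pairing (a', h2)"
        by (cases "hdeg L.A.H a = hdeg L.H.H h1") (simp_all add: 0 koszul_comm mult.assoc del: presented_sel)
    qed
    finally show ?thesis .
  qed
  show "pairing (a, h \<otimes>\<^bsub>L.H.H\<^esub> h') =
      (\<Sum>(a1, a2)\<leftarrow>as. koszul (hdeg L.A.H a2) (hdeg L.H.H h) * pairing (a1, h) * pairing (a2, h'))"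
    if *: "homogeneous L.A.H a \<and> homogeneous L.H.H h \<and> homogeneous L.H.H h' \<and>
      (\<forall>(a1, a2)\<in>set as. homogeneous L.A.H a1 \<and> homogeneous L.A.H a2) \<and> comult L.A.H a = tensor_sum L.A.H as"
    for a h h' as
  proof -
    have "pairing (a, h \<otimes>\<^bsub>L.H.H\<^esub> h') = R.class_form (h \<otimes>\<^bsub>L.H.H\<^esub> h') a"
      using * hA(2) hH(2) add'(3) by (simp only: pairing_eq class_form_flip)
    also have "\<dots> = (\<Sum>(a1, a2)\<leftarrow>as. koszul (hdeg L.H.H h) (hdeg L.H.H h') * (R.class_form h a1 * R.class_form h' a2))"
      by (rule R.class_form_mult) (use * hA(2) hH in auto)
    also have "\<dots> = (\<Sum>(a1, a2)\<leftarrow>as. koszul (hdeg L.A.H a2) (hdeg L.H.H h) * pairing (a1, h) * pairing (a2, h'))"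
    proof (intro arg_cong[where f = sum_list] map_cong refl, clarify)
      fix a1 a2 assume "(a1, a2) \<in> set as"
      then have a: "homogeneous L.A.H a1" "homogeneous L.A.H a2" using * by auto
      \<comment> \<open>Here the degrees of the second factors are compared, because the sign of
        this axiom involves \<open>a2\<close> and \<open>h\<close>.\<close>
      have 0: "L.class_form a2 h' = 0" if "hdeg L.A.H a2 \<noteq> hdeg L.H.H h'"
        by (rule L.class_form_even[OF hA(1) hH(1) that]) (use * a in auto)
      have "pairing (a1, h) = L.class_form a1 h" "pairing (a2, h') = L.class_form a2 h'"
        by (rule pairing_eq; use * hA(2) hH(2) a in blast)+
      then show "koszul (hdeg L.H.H h) (hdeg L.H.H h') * (R.class_form h a1 * R.class_form h' a2) =
        koszul (hdeg L.A.H a2) (hdeg L.H.H h) * pairing (a1, h) * pairing (a2, h')"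
        unfolding class_form_flip
        by (cases "hdeg L.A.H a2 = hdeg L.H.H h'") (simp_all add: 0 koszul_comm mult.assoc del: presented_sel)
    qed
    finally show ?thesis .
  qed
qed

end

section \<open>Uniqueness of pairings with given values on generators\<close>

text \<open>Linearity is available only on elements supported in \<open>S\<close>, so the induction
  runs over partial sums of \<open>p\<close>, which stay inside \<open>S\<close>.\<close>

lemma linear_functional_eq_ev:
  fixes f :: "('z \<Rightarrow>\<^sub>0 'k::field) \<Rightarrow> 'k"
  assumes p: "Poly_Mapping.keys p \<subseteq> S"
    and add: "\<And>p p'. Poly_Mapping.keys p \<subseteq> S \<Longrightarrow> Poly_Mapping.keys p' \<subseteq> S \<Longrightarrow> f (p + p') = f p + f p'"
    and scal: "\<And>c p. Poly_Mapping.keys p \<subseteq> S \<Longrightarrow> f (scal c p) = c * f p"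
  shows "f p = ev (\<lambda>u. f (Poly_Mapping.single u 1)) p"
proof -
  have f0: "f 0 = 0" using scal[of 0 0] by simp
  let ?s = "\<lambda>T. \<Sum>b\<in>T. Poly_Mapping.single b (Poly_Mapping.lookup p b)"
  have "f (?s T) = (\<Sum>b\<in>T. Poly_Mapping.lookup p b * f (Poly_Mapping.single b 1)) \<and>
      Poly_Mapping.keys (?s T) \<subseteq> S" if "T \<subseteq> S" for T
    using that
  proof (induction T rule: infinite_finite_induct)
    case (insert b T)
    let ?b = "Poly_Mapping.single b (Poly_Mapping.lookup p b)"
    have 1: "Poly_Mapping.keys ?b \<subseteq> S"
      using insert.prems by auto
    have 2: "f ?b = Poly_Mapping.lookup p b * f (Poly_Mapping.single b 1)"
      using scal[of "Poly_Mapping.single b 1" "Poly_Mapping.lookup p b"] insert.prems by auto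
    have 3: "Poly_Mapping.keys (?s T) \<subseteq> S" using insert by simp
    have "f (?b + ?s T) = f ?b + f (?s T)" by (rule add[OF 1 3])
    moreover have "Poly_Mapping.keys (?b + ?s T) \<subseteq> S"
      using Poly_Mapping.keys_add[of ?b "?s T"] 1 3 by blast
    ultimately show ?case using insert 2 by simp
  qed (simp_all add: f0)
  from this[OF p] show ?thesis by (simp add: ev_def flip: poly_mapping_sum_single)
qed

lemma bilinear_form_ev:
  assumes "presentation X RX DX sX" "presentation Y RY DY sY"
    and \<phi>: "bilinear_form (presented X dX RX DX eX sX) (presented Y dY RY DY eY sY) \<phi>"
    and p: "p \<in> carrier (free_alg X)" and h: "h \<in> carrier (free_alg Y)"
  shows "\<phi> (pres_class X RX p, pres_class Y RY h) = ev (\<lambda>u. ev (\<lambda>v.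
    \<phi> (pres_class X RX (Poly_Mapping.single u 1), pres_class Y RY (Poly_Mapping.single v 1))) h) p"
proof -
  interpret A: presentation X dX RX DX eX sX by (rule \<open>presentation X RX DX sX\<close>)
  interpret H: presentation Y dY RY DY eY sY by (rule \<open>presentation Y RY DY sY\<close>)
  have "\<phi> (A.cl p, H.cl h) = ev (\<lambda>u. \<phi> (A.cl (Poly_Mapping.single u 1), H.cl h)) p"
    by (rule linear_functional_eq_ev[of _ "words X"])
      (use \<phi> p h in \<open>auto simp: bilinear_form_def A.carrier_H H.carrier_H A.cl_add A.cl_smult
        simp flip: carrier_free_alg\<close>)
  also have "\<dots> = ev (\<lambda>u. ev (\<lambda>v. \<phi> (A.cl (Poly_Mapping.single u 1), H.cl (Poly_Mapping.single v 1))) h) p"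
  proof (rule A.ev_carrier_cong[OF p])
    fix u assume u: "u \<in> words X"
    show "\<phi> (A.cl (Poly_Mapping.single u 1), H.cl h) =
      ev (\<lambda>v. \<phi> (A.cl (Poly_Mapping.single u 1), H.cl (Poly_Mapping.single v 1))) h"
      by (rule linear_functional_eq_ev[of _ "words Y"])
        (use \<phi> h u in \<open>auto simp: bilinear_form_def A.carrier_H H.carrier_H H.cl_add H.cl_smult
          simp flip: carrier_free_alg\<close>)
  qed
  finally show ?thesis .
qed

text \<open>The value on a product \<open>x l\<close> is determined by the values on the letter
  \<open>x\<close> and on the shorter word \<open>l\<close>, through the coproduct of
  \<open>h\<close>. The axioms concern homogeneous elements, so the induction on word length takes
  \<open>h\<close> homogeneous; bilinearity and the basis of words, which are homogeneous, extend
  the result to all elements.\<close>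

lemma hopf_pairing_unique:
  assumes pA: "presentation X RX DX sX" and pH: "presentation Y RY DY sY"
    and \<phi>: "hopf_pairing (presented X dX RX DX eX sX) (presented Y dY RY DY eY sY) \<phi>"
    and \<psi>: "hopf_pairing (presented X dX RX DX eX sX) (presented Y dY RY DY eY sY) \<psi>"
    and gen: "\<And>x h. x \<in> X \<Longrightarrow> h \<in> carrier (presented Y dY RY DY eY sY) \<Longrightarrow>
      \<phi> (pres_class X RX (gen x), h) = \<psi> (pres_class X RX (gen x), h)"
    and a: "a \<in> carrier (presented X dX RX DX eX sX)" and h: "h \<in> carrier (presented Y dY RY DY eY sY)"
  shows "\<phi> (a, h) = \<psi> (a, h)"
proof -
  interpret A: presentation X dX RX DX eX sX by (rule \<open>presentation X RX DX sX\<close>)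
  interpret H: presentation Y dY RY DY eY sY by (rule \<open>presentation Y RY DY sY\<close>)
  have hc: "h \<in> carrier H.H" if "homogeneous H.H h" for h
    using H.homogeneous_hdeg[OF that] H.homog_carrier by blast
  have word: "\<phi> (A.cl (Poly_Mapping.single (FM l) 1), h) = \<psi> (A.cl (Poly_Mapping.single (FM l) 1), h)"
    if "set l \<subseteq> X" "homogeneous H.H h" for l h
    using that
  proof (induction l arbitrary: h)
    case Nil
    have "A.cl (Poly_Mapping.single (FM []) 1) = \<one>\<^bsub>A.H\<^esub>"
      by (simp add: A.cl_one FM_Nil)
    moreover have 1: "\<chi> (\<one>\<^bsub>A.H\<^esub>, h) = counit H.H h" if "hopf_pairing A.H H.H \<chi>" for \<chi>
      using that Nil.prems(2) unfolding hopf_pairing_def by blast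
    ultimately show ?case by (simp only: 1[OF \<phi>] 1[OF \<psi>])
  next
    case (Cons x l)
    let ?x = "A.cl (gen x)" and ?l = "A.cl (Poly_Mapping.single (FM l) 1)"
    have hom: "homogeneous A.H ?x" "homogeneous A.H ?l"
      using Cons.prems A.homogeneous_word[of "FM [x]" 1] A.homogeneous_word[of "FM l" 1] by (simp_all add: gen_def)
    have "A.cl (Poly_Mapping.single (FM (x # l)) 1) = ?x \<otimes>\<^bsub>A.H\<^esub> ?l"
      using Cons.prems by (subst FM_Cons) (simp add: A.cl_mult gen_def mult_single)
    moreover obtain hs where hs: "\<forall>(h1, h2)\<in>set hs. homogeneous H.H h1 \<and> homogeneous H.H h2"
      "comult H.H h = tensor_sum H.H hs"
      using H.coproduct_sum_exists[OF hc[OF Cons.prems(2)]] by blast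
    have 1: "\<chi> (?x \<otimes>\<^bsub>A.H\<^esub> ?l, h) = (\<Sum>(h1, h2)\<leftarrow>hs. koszul (hdeg A.H ?l) (hdeg H.H h1) * \<chi> (?x, h1) * \<chi> (?l, h2))"
      if "hopf_pairing A.H H.H \<chi>" for \<chi>
      using that hom hs Cons.prems(2) unfolding hopf_pairing_def by blast
    have 2: "(\<Sum>(h1, h2)\<leftarrow>hs. koszul (hdeg A.H ?l) (hdeg H.H h1) * \<phi> (?x, h1) * \<phi> (?l, h2)) =
      (\<Sum>(h1, h2)\<leftarrow>hs. koszul (hdeg A.H ?l) (hdeg H.H h1) * \<psi> (?x, h1) * \<psi> (?l, h2))"
      using hs(1) Cons gen hc by (intro arg_cong[where f = sum_list] map_cong refl) fastforce
    show ?case by (simp only: calculation 1[OF \<phi>] 1[OF \<psi>] 2)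
  qed
  obtain p where p: "a = A.cl p" "p \<in> carrier A.F" using a by (auto simp: A.carrier_H)
  obtain g where g: "h = H.cl g" "g \<in> carrier H.F" using h by (auto simp: H.carrier_H)
  have bil: "bilinear_form A.H H.H \<phi>" "bilinear_form A.H H.H \<psi>"
    using \<phi> \<psi> unfolding hopf_pairing_def by simp_all
  show ?thesis
    unfolding p(1) g(1) bilinear_form_ev[OF pA pH bil(1) p(2) g(2)] bilinear_form_ev[OF pA pH bil(2) p(2) g(2)]
  proof (intro A.ev_carrier_cong H.ev_carrier_cong p(2) g(2))
    fix u v assume "u \<in> words X" "v \<in> words Y"
    then show "\<phi> (A.cl (Poly_Mapping.single u 1), H.cl (Poly_Mapping.single v 1)) =
      \<psi> (A.cl (Poly_Mapping.single u 1), H.cl (Poly_Mapping.single v 1))"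
      using word[of "letters u"] H.homogeneous_word[of v 1] by (simp add: words_def)
  qed
qed

section \<open>Functionals generated by the skew derivations\<close>

definition chi :: "('l \<Rightarrow> 'l \<Rightarrow> 'k::field) \<Rightarrow> 'l \<Rightarrow> 'l list \<Rightarrow> 'k" where
  "chi ch k w = prod_list (map (ch k) w)"

lemma chi_simps [simp]: "chi ch k [] = 1" "chi ch k (j # w) = ch k j * chi ch k w"
  by (simp_all add: chi_def)

text \<open>\<open>pd\<close> is the transpose of \<open>pder\<close>; \<open>ch k j\<close> is the factor by which the derivation \<open>k\<close> passes the letter \<open>j\<close>.\<close>

primrec pd :: "('l \<Rightarrow> 'l \<Rightarrow> 'k::field) \<Rightarrow> 'l \<Rightarrow> 'l list \<Rightarrow> ('l list \<Rightarrow> 'k) \<Rightarrow> 'k" where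
  "pd ch k [] \<kappa> = 0"
| "pd ch k (j # w) \<kappa> = pd ch k w (\<lambda>u. \<kappa> (j # u)) + (if j = k then chi ch k w * \<kappa> w else 0)"

text \<open>On words over \<open>L\<close> these are the linear combinations of functionals that
  apply a sequence of skew derivations and then take the constant term. Values on other words are
  left free by \<open>cong\<close>.\<close>

inductive skew_functional :: "('l \<Rightarrow> 'l \<Rightarrow> 'k::field) \<Rightarrow> 'l set \<Rightarrow> ('l list \<Rightarrow> 'k) \<Rightarrow> bool"
  for ch :: "'l \<Rightarrow> 'l \<Rightarrow> 'k::field" and L :: "'l set" where
  empty: "skew_functional ch L (\<lambda>w. if w = [] then 1 else 0)"
| add: "skew_functional ch L \<kappa> \<Longrightarrow> skew_functional ch L \<mu> \<Longrightarrow> skew_functional ch L (\<lambda>w. \<kappa> w + \<mu> w)"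
| scale: "skew_functional ch L \<kappa> \<Longrightarrow> skew_functional ch L (\<lambda>w. c * \<kappa> w)"
| deriv: "k \<in> L \<Longrightarrow> skew_functional ch L \<kappa> \<Longrightarrow> skew_functional ch L (\<lambda>w. pd ch k w \<kappa>)"
| cong: "skew_functional ch L \<kappa> \<Longrightarrow> (\<And>w. set w \<subseteq> L \<Longrightarrow> \<mu> w = \<kappa> w) \<Longrightarrow> skew_functional ch L \<mu>"

lemma skew_functional_zero: "skew_functional ch L (\<lambda>w. 0)"
  using skew_functional.scale[OF skew_functional.empty, of ch L 0] by simp

lemma skew_functional_sum:
  "(\<And>a. a \<in> S \<Longrightarrow> skew_functional ch L (\<lambda>w. f w a)) \<Longrightarrow> skew_functional ch L (\<lambda>w. \<Sum>a\<in>S. f w a)"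
  by (induction S rule: infinite_finite_induct)
    (simp_all add: skew_functional_zero skew_functional.add)

lemma pd_add: "pd ch k w (\<lambda>u. \<kappa> u + \<mu> u) = pd ch k w \<kappa> + pd ch k w \<mu>"
  by (induction w arbitrary: \<kappa> \<mu>) (simp_all add: algebra_simps)

lemma pd_scale: "pd ch k w (\<lambda>u. c * \<kappa> u) = c * pd ch k w \<kappa>"
  by (induction w arbitrary: \<kappa>) (simp_all add: algebra_simps)

text \<open>The recursion of \<open>pd\<close> strips the first letter, but operators applied by
  \<open>foldr\<close> act with the last letter first; the commutator argument therefore uses this
  form.\<close>

lemma pd_snoc:
  "pd ch k (w @ [j]) \<kappa> = ch k j * pd ch k w (\<lambda>u. \<kappa> (u @ [j])) + (if j = k then \<kappa> w else 0)"
proof (induction w arbitrary: \<kappa>)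
  case (Cons i w)
  have "chi ch k (w @ [j]) = chi ch k w * ch k j" by (simp add: chi_def)
  then show ?case using Cons.IH[of "\<lambda>u. \<kappa> (i # u)"] by (simp add: algebra_simps)
qed simp

text \<open>A derivative deletes exactly one letter \<open>k\<close>, so a multiplicative function
  of the word changes by the factor \<open>c k\<close>.\<close>

lemma pd_twist:
  "prod_list (map c w) * pd ch k w \<kappa> = c k * pd ch k w (\<lambda>u. prod_list (map c u) * \<kappa> u)"
proof (induction w arbitrary: \<kappa>)
  case (Cons j w)
  have "pd ch k w (\<lambda>u. c j * prod_list (map c u) * \<kappa> (j # u)) = c j * pd ch k w (\<lambda>u. prod_list (map c u) * \<kappa> (j # u))"
    using pd_scale[of ch k w "c j"] by (simp add: mult.assoc)
  then show ?case using Cons.IH[of "\<lambda>u. \<kappa> (j # u)"] by (simp add: algebra_simps)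
qed simp

lemma skew_functional_twist:
  "skew_functional ch L \<kappa> \<Longrightarrow> skew_functional ch L (\<lambda>w. prod_list (map c w) * \<kappa> w)"
proof (induction rule: skew_functional.induct)
  case empty
  show ?case by (rule skew_functional.cong[OF skew_functional.empty]) simp
next
  case (add \<kappa> \<mu>) then show ?case by (simp add: distrib_left skew_functional.add)
next
  case (scale \<kappa> c') then show ?case using skew_functional.scale[of ch L _ c'] by (simp add: mult.left_commute)
next
  case (deriv k \<kappa>) then show ?case by (simp add: pd_twist skew_functional.scale skew_functional.deriv)
next
  case (cong \<kappa> \<mu>) from cong(3) show ?case by (rule skew_functional.cong) (simp add: cong)
qed

text \<open>The product of functionals dual to the coproduct \<open>E\<^bsub>j\<^esub> \<otimes> 1 + K\<^bsub>j\<^esub> \<otimes> E\<^bsub>j\<^esub>\<close>; the factor \<open>chi\<close> moves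
  \<open>K\<^bsub>j\<^esub>\<close> past the later letters in the first tensor factor.\<close>

primrec conv :: "('l \<Rightarrow> 'l \<Rightarrow> 'k::field) \<Rightarrow> 'l list \<Rightarrow> ('l list \<Rightarrow> 'k) \<Rightarrow> ('l list \<Rightarrow> 'k) \<Rightarrow> 'k" where
  "conv ch [] \<kappa> \<mu> = \<kappa> [] * \<mu> []"
| "conv ch (j # w) \<kappa> \<mu> = conv ch w (\<lambda>u. \<kappa> (j # u)) \<mu> + conv ch w (\<lambda>u. chi ch j u * \<kappa> u) (\<lambda>u. \<mu> (j # u))"

lemma conv_cong:
  "set w \<subseteq> L \<Longrightarrow> (\<And>u. set u \<subseteq> L \<Longrightarrow> \<kappa> u = \<kappa>' u) \<Longrightarrow> (\<And>u. set u \<subseteq> L \<Longrightarrow> \<mu> u = \<mu>' u) \<Longrightarrow>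
    conv ch w \<kappa> \<mu> = conv ch w \<kappa>' \<mu>'"
proof (induction w arbitrary: \<kappa> \<mu> \<kappa>' \<mu>')
  case (Cons j w)
  have "conv ch w (\<lambda>u. \<kappa> (j # u)) \<mu> = conv ch w (\<lambda>u. \<kappa>' (j # u)) \<mu>'"
    "conv ch w (\<lambda>u. chi ch j u * \<kappa> u) (\<lambda>u. \<mu> (j # u)) = conv ch w (\<lambda>u. chi ch j u * \<kappa>' u) (\<lambda>u. \<mu>' (j # u))"
    by (rule Cons.IH; use Cons.prems in simp)+
  then show ?case by simp
qed simp

lemma conv_add_right: "conv ch w \<kappa> (\<lambda>u. \<mu> u + \<mu>' u) = conv ch w \<kappa> \<mu> + conv ch w \<kappa> \<mu>'"
  by (induction w arbitrary: \<kappa> \<mu> \<mu>') (simp_all add: algebra_simps)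

lemma conv_scale_right: "conv ch w \<kappa> (\<lambda>u. c * \<mu> u) = c * conv ch w \<kappa> \<mu>"
  by (induction w arbitrary: \<kappa> \<mu>) (simp_all add: algebra_simps)

lemma conv_zero_right: "conv ch w \<kappa> (\<lambda>u. 0) = 0"
  using conv_scale_right[of ch w \<kappa> 0 "\<lambda>u. 0"] by simp

lemma conv_add_left: "conv ch w (\<lambda>u. \<kappa> u + \<kappa>' u) \<mu> = conv ch w \<kappa> \<mu> + conv ch w \<kappa>' \<mu>"
  by (induction w arbitrary: \<kappa> \<kappa>' \<mu>) (simp_all add: algebra_simps)

lemma conv_scale_left: "conv ch w (\<lambda>u. c * \<kappa> u) \<mu> = c * conv ch w \<kappa> \<mu>"
proof (induction w arbitrary: \<kappa> \<mu>)
  case (Cons j w)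
  show ?case using Cons.IH[of "\<lambda>u. chi ch j u * \<kappa> u"] by (simp add: Cons.IH algebra_simps)
qed simp

lemma conv_zero_left: "conv ch w (\<lambda>u. 0) \<mu> = 0"
  using conv_scale_left[of ch w 0 "\<lambda>u. 0"] by simp

lemma conv_sum_left: "conv ch w (\<lambda>u. \<Sum>a\<in>S. \<kappa> a u) \<mu> = (\<Sum>a\<in>S. conv ch w (\<kappa> a) \<mu>)"
  by (induction S rule: infinite_finite_induct) (simp_all add: conv_zero_left conv_add_left)

lemma conv_empty_right: "conv ch w \<kappa> (\<lambda>u. if u = [] then 1 else 0) = \<kappa> w"
  by (induction w arbitrary: \<kappa>) (simp_all add: conv_zero_right)

lemma conv_empty_left: "conv ch w (\<lambda>u. if u = [] then 1 else 0) \<mu> = \<mu> w"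
proof (induction w arbitrary: \<mu>)
  case (Cons j w)
  have "(\<lambda>u. chi ch j u * (if u = [] then 1 else 0)) = (\<lambda>u. if u = [] then 1 else 0)" by auto
  then show ?case using Cons.IH by (simp add: conv_zero_left)
qed simp

text \<open>\<open>chi\<close> is multiplicative in the word, hence splits over the two factors of a
  convolution.\<close>

lemma conv_chi: "conv ch w (\<lambda>u. chi ch k u * \<kappa> u) (\<lambda>u. chi ch k u * \<mu> u) = chi ch k w * conv ch w \<kappa> \<mu>"
proof (induction w arbitrary: \<kappa> \<mu>)
  case (Cons j w)
  have 1: "(\<lambda>u. chi ch k (j # u) * \<kappa> (j # u)) = (\<lambda>u. ch k j * (chi ch k u * \<kappa> (j # u)))"
    "(\<lambda>u. chi ch k (j # u) * \<mu> (j # u)) = (\<lambda>u. ch k j * (chi ch k u * \<mu> (j # u)))"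
    "(\<lambda>u. chi ch j u * (chi ch k u * \<kappa> u)) = (\<lambda>u. chi ch k u * (chi ch j u * \<kappa> u))"
    by (simp_all add: mult_ac)
  show ?case unfolding conv.simps 1 conv_scale_left conv_scale_right Cons.IH by (simp add: algebra_simps)
qed simp

text \<open>\<open>pd\<close> is convolution on the right with the functional dual to the letter
  \<open>k\<close>, so this is an instance of associativity.\<close>

lemma conv_pd: "conv ch w \<kappa> (\<lambda>u. pd ch k u \<mu>) = pd ch k w (\<lambda>u. conv ch u \<kappa> \<mu>)"
proof (induction w arbitrary: \<kappa> \<mu>)
  case (Cons j w)
  have "(\<lambda>u. pd ch k (j # u) \<mu>) =
    (\<lambda>u. pd ch k u (\<lambda>u. \<mu> (j # u)) + (if j = k then 1 else 0) * (chi ch k u * \<mu> u))" by auto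
  then have "conv ch w (\<lambda>u. chi ch j u * \<kappa> u) (\<lambda>u. pd ch k (j # u) \<mu>) =
    pd ch k w (\<lambda>u. conv ch u (\<lambda>u. chi ch j u * \<kappa> u) (\<lambda>u. \<mu> (j # u))) +
    (if j = k then 1 else 0) * (chi ch k w * conv ch w \<kappa> \<mu>)"
    by (cases "j = k") (simp_all only: conv_add_right conv_scale_right Cons.IH conv_chi mult_zero_left mult_1 if_True if_False conv_zero_right)
  then show ?case by (simp add: Cons.IH pd_add)
qed simp

text \<open>Only the right factor is built up: the constant term functional is a unit for
  \<open>conv\<close>, and derivations of the right factor pull out by
  \<open>conv_pd\<close>.\<close>

lemma skew_functional_conv:
  assumes "skew_functional ch L \<mu>" "skew_functional ch L \<kappa>"
  shows "skew_functional ch L (\<lambda>w. conv ch w \<kappa> \<mu>)"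
  using assms
proof (induction rule: skew_functional.induct)
  case empty then show ?case by (simp add: conv_empty_right)
next
  case (add \<mu> \<mu>') then show ?case by (simp add: conv_add_right skew_functional.add)
next
  case (scale \<mu> c) then show ?case by (simp add: conv_scale_right skew_functional.scale)
next
  case (deriv k \<mu>) then show ?case by (simp add: conv_pd skew_functional.deriv)
next
  case (cong \<mu> \<mu>')
  from cong.IH[OF cong.prems] show ?case
    by (rule skew_functional.cong) (rule conv_cong[where L = L], assumption, rule refl, rule cong.hyps(2))
qed

section \<open>Derivations from the left and inverse factors\<close>

primrec left_pd :: "('l \<Rightarrow> 'l \<Rightarrow> 'k::field) \<Rightarrow> 'l \<Rightarrow> 'l list \<Rightarrow> ('l list \<Rightarrow> 'k) \<Rightarrow> 'k" where
  "left_pd ch k [] \<kappa> = 0"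
| "left_pd ch k (j # w) \<kappa> = (if j = k then \<kappa> w else 0) + ch j k * left_pd ch k w (\<lambda>u. \<kappa> (j # u))"

text \<open>Deleting a letter from the left is convolution on the left with the functional dual to
  that letter. This is what keeps left derivatives within the skew functionals.\<close>

lemma left_pd_conv:
  fixes ch :: "'l \<Rightarrow> 'l \<Rightarrow> 'k::field"
  shows "conv ch w (\<lambda>u. if u = [k] then 1 else 0) \<kappa> = left_pd ch k w \<kappa>"
proof (induction w arbitrary: \<kappa>)
  case (Cons j w)
  have 1: "(\<lambda>u. if j # u = [k] then 1 else 0) = (\<lambda>u. (if j = k then 1 else 0) * (if u = [] then 1 else 0 :: 'k))"
    by auto
  have 2: "(\<lambda>u. chi ch j u * (if u = [k] then 1 else 0)) = (\<lambda>u. ch j k * (if u = [k] then 1 else 0))"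
    by auto
  show ?case unfolding conv.simps 1 2 conv_scale_left conv_empty_left Cons.IH by simp
qed simp

lemma skew_functional_left_pd:
  assumes "k \<in> L" "skew_functional ch L \<kappa>"
  shows "skew_functional ch L (\<lambda>w. left_pd ch k w \<kappa>)"
proof -
  have 0: "pd ch k w (\<lambda>u. 0) = 0" for w by (induction w) simp_all
  have "pd ch k w (\<lambda>w. if w = [] then 1 else 0) = (if w = [k] then 1 else 0)" for w
    by (cases w) (auto simp: 0)
  then have "skew_functional ch L (\<lambda>w. if w = [k] then 1 else 0)"
    using skew_functional.deriv[OF assms(1) skew_functional.empty, of ch] by simp
  from skew_functional_conv[OF assms(2) this] show ?thesis by (simp add: left_pd_conv)
qed

text \<open>The factor \<open>chi ch' k\<close> of the whole word contains the letters before
  \<open>k\<close>, the letter \<open>k\<close> and those after it. The weights of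
  \<open>left_pd\<close> cancel the first group, \<open>ch k k\<close> cancels the second, and the
  third is the weight of \<open>pd ch'\<close>. So inverse factors amount to a derivation from the
  left, twisted by a character.\<close>

lemma pd_inverse:
  assumes "\<And>j. ch' k j * ch j k = 1"
  shows "pd ch' k w \<kappa> = ch k k * (chi ch' k w * left_pd ch k w \<kappa>)"
proof (induction w arbitrary: \<kappa>)
  case (Cons j w)
  let ?L = "left_pd ch k w (\<lambda>u. \<kappa> (j # u))"
  have "ch k k * (chi ch' k (j # w) * left_pd ch k (j # w) \<kappa>) =
    (ch' k j * ch j k) * (ch k k * (chi ch' k w * ?L)) + (if j = k then (ch' k k * ch k k) * (chi ch' k w * \<kappa> w) else 0)"
    by (simp add: algebra_simps)
  also have "\<dots> = pd ch' k (j # w) \<kappa>"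
    unfolding assms by (simp add: Cons.IH)
  finally show ?case ..
qed simp

lemma skew_functional_pd_inverse:
  assumes "\<And>j. ch' k j * ch j k = 1" "k \<in> L" "skew_functional ch L \<kappa>"
  shows "skew_functional ch L (\<lambda>w. pd ch' k w \<kappa>)"
  unfolding pd_inverse[where ch' = ch' and ch = ch and k = k, OF assms(1)] chi_def
  by (intro skew_functional.scale skew_functional_twist skew_functional_left_pd assms)

text \<open>Commuting the lowering operator \<open>B k\<close> past a word in the raising operators \<open>A j\<close> leaves
  derivatives of shorter matrix coefficients.\<close>

lemma foldr_commutator:
  fixes A B T T' :: "'l \<Rightarrow> ('i \<Rightarrow> 'k::field) \<Rightarrow> ('i \<Rightarrow> 'k)"
  assumes lin: "\<And>j f g c. A j (\<lambda>i. f i + c * g i) = (\<lambda>i. A j f i + c * A j g i)"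
    and comm: "\<And>j f i. j \<in> L \<Longrightarrow> A j (B k f) i = s j * B k (A j f) i + (if j = k then c * (T k f i - T' k f i) else 0)"
    and T: "\<And>j f. j \<in> L \<Longrightarrow> T k (A j f) = (\<lambda>i. p j * A j (T k f) i)"
      "\<And>j f. j \<in> L \<Longrightarrow> T' k (A j f) = (\<lambda>i. p' j * A j (T' k f) i)"
    and ch: "\<And>j. ch k j = s j * p j" "\<And>j. ch' k j = s j * p' j"
    and w: "set w \<subseteq> L"
  shows "foldr A w (B k f) i = prod_list (map s w) * B k (foldr A w f) i
    + c * (pd ch k w (\<lambda>u. foldr A u (T k f) i) - pd ch' k w (\<lambda>u. foldr A u (T' k f) i))"
  using w
\<comment> \<open>The last letter acts first and is the one next to \<open>B k\<close>. Commuting it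
  leaves the same situation for a shorter word and the vector \<open>A j f\<close>, which is why
  \<open>f\<close> is arbitrary.\<close>
proof (induction w arbitrary: f rule: rev_induct)
  case (snoc j w)
  have lin': "foldr A w (\<lambda>i. f i + c * g i) i = foldr A w f i + c * foldr A w g i" for w f g c i
  proof -
    have "foldr A w (\<lambda>i. f i + c * g i) = (\<lambda>i. foldr A w f i + c * foldr A w g i)"
      by (induction w) (simp_all add: lin)
    then show ?thesis by simp
  qed
  have A0: "foldr A w (\<lambda>i. 0) i = 0" for w i using lin'[of w "\<lambda>i. 0" "-1" "\<lambda>i. 0" i] by simp
  have sc: "foldr A w (\<lambda>i. x * g i) i = x * foldr A w g i" for w g x i
    using lin'[of w "\<lambda>i. 0" x g i] by (simp add: A0)
  have j: "j \<in> L" and w: "set w \<subseteq> L" using snoc.prems by simp_all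
  have "foldr A (w @ [j]) (B k f) i = foldr A w (A j (B k f)) i" by simp
  also have "A j (B k f) = (\<lambda>i. (if j = k then c else 0) * T k f i + (-1) * ((if j = k then c else 0) * T' k f i)
      + s j * B k (A j f) i)"
    by (rule ext) (simp add: comm[OF j] algebra_simps)
  also have "foldr A w \<dots> i = (if j = k then c else 0) * (foldr A w (T k f) i - foldr A w (T' k f) i)
      + s j * foldr A w (B k (A j f)) i"
    unfolding lin' sc by (simp add: algebra_simps)
  also have "foldr A w (B k (A j f)) i = prod_list (map s w) * B k (foldr A (w @ [j]) f) i
    + c * (p j * pd ch k w (\<lambda>u. foldr A (u @ [j]) (T k f) i) - p' j * pd ch' k w (\<lambda>u. foldr A (u @ [j]) (T' k f) i))"
    unfolding snoc.IH[OF w] T[OF j] sc pd_scale by simp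
  finally show ?case
    unfolding pd_snoc ch by (cases "j = k") (simp_all add: algebra_simps)
qed simp

text \<open>\<open>P j\<close> models the action of \<open>E_j\<close> on a tensor product through
  \<open>E_j \<otimes> 1 + K_j \<otimes> E_j\<close>, with \<open>t j i\<close> the eigenvalue of
  \<open>K_j\<close>, including the Koszul sign, on the basis vector \<open>i\<close> of the first
  slot. A coefficient of a word in the \<open>P j\<close> is a finite sum of convolutions of
  coefficients in the two slots.\<close>

lemma two_slot_skew_functional:
  fixes A :: "'l \<Rightarrow> ('i \<Rightarrow> 'k::field) \<Rightarrow> ('i \<Rightarrow> 'k)" and R :: "'l \<Rightarrow> ('b \<Rightarrow> 'k) \<Rightarrow> ('b \<Rightarrow> 'k)"
    and P :: "'l \<Rightarrow> ('i \<times> 'b \<Rightarrow> 'k) \<Rightarrow> ('i \<times> 'b \<Rightarrow> 'k)"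
  defines "e a \<equiv> (\<lambda>i. if i = a then 1 else 0)"
  assumes S: "finite S"
    and A: "\<And>j f i. j \<in> L \<Longrightarrow> A j f i = (\<Sum>a\<in>S. A j (e a) i * f a)"
    and R: "\<And>j f g c x. R j (\<lambda>y. f y + c * g y) x = R j f x + c * R j g x"
    and P: "\<And>j g i x. j \<in> L \<Longrightarrow> i \<in> S \<Longrightarrow> P j g (i, x) = A j (\<lambda>a. g (a, x)) i + t j i * R j (\<lambda>y. g (i, y)) x"
    and t: "\<And>j j' i a. j \<in> L \<Longrightarrow> j' \<in> L \<Longrightarrow> i \<in> S \<Longrightarrow> a \<in> S \<Longrightarrow> A j (e a) i \<noteq> 0 \<Longrightarrow> t j' i = t j' a * ch j' j"
    and DA: "\<And>i a. i \<in> S \<Longrightarrow> a \<in> S \<Longrightarrow> skew_functional ch L (\<lambda>w. foldr A w (e a) i)"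
    and DR: "\<And>f. skew_functional ch L (\<lambda>w. foldr R w f x)"
    and i: "i \<in> S"
  shows "skew_functional ch L (\<lambda>w. foldr P w g (i, x))"
proof -
  have R0: "R j (\<lambda>y. 0) x = 0" for j x using R[of j "\<lambda>y. 0" "-1" "\<lambda>y. 0" x] by simp
  have Rsc: "R j (\<lambda>y. c * g y) x = c * R j g x" for j c g x using R[of j "\<lambda>y. 0" c g x] by (simp add: R0)
  have Radd: "R j (\<lambda>y. f y + g y) x = R j f x + R j g x" for j f g x using R[of j f 1 g x] by simp
  have Rsum: "R j (\<lambda>y. \<Sum>a\<in>S. f a y) x = (\<Sum>a\<in>S. R j (f a) x)" for j f x
    by (induction S rule: infinite_finite_induct) (simp_all add: R0 Radd)
  have Rconv: "R j (\<lambda>y. conv ch w \<kappa> (\<lambda>v. \<nu> v y)) x = conv ch w \<kappa> (\<lambda>v. R j (\<nu> v) x)" for j w \<kappa> \<nu> x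
    by (induction w arbitrary: \<kappa> \<nu>) (simp_all add: Rsc Radd)
  \<comment> \<open>Along a nonzero path from \<open>a\<close> to \<open>i\<close> each letter
    changes the eigenvalue by a factor of \<open>ch\<close>; together these factors are
    \<open>chi\<close> of the word.\<close>
  have tw: "t j i * foldr A u (e a) i = t j a * (chi ch j u * foldr A u (e a) i)"
    if "set u \<subseteq> L" "j \<in> L" "i \<in> S" "a \<in> S" for u j i a
    using that
  proof (induction u arbitrary: i)
    case Nil then show ?case by (simp add: e_def)
  next
    case (Cons j' u)
    have "t j i * (A j' (e b) i * foldr A u (e a) b) = t j a * (chi ch j (j' # u) * (A j' (e b) i * foldr A u (e a) b))"
      if b: "b \<in> S" for b
    proof (cases "A j' (e b) i = 0")
      case False
      have "t j i * (A j' (e b) i * foldr A u (e a) b) = ch j j' * A j' (e b) i * (t j b * foldr A u (e a) b)"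
        using t[OF _ _ _ b False, of j] Cons.prems by simp
      also have "\<dots> = t j a * (chi ch j (j' # u) * (A j' (e b) i * foldr A u (e a) b))"
        using Cons b by simp
      finally show ?thesis .
    qed simp
    then have "(\<Sum>b\<in>S. t j i * (A j' (e b) i * foldr A u (e a) b)) =
        (\<Sum>b\<in>S. t j a * (chi ch j (j' # u) * (A j' (e b) i * foldr A u (e a) b)))"
      by (intro sum.cong) simp_all
    then show ?case using Cons.prems by (simp add: A[of j' "foldr A u (e a)"] sum_distrib_left)
  qed
  let ?l = "\<lambda>i a u. foldr A u (e a) i"
  let ?m = "\<lambda>g x a v. prod_list (map (\<lambda>j. t j a) v) * foldr R v (\<lambda>y. g (a, y)) x"
  \<comment> \<open>The sum is over the index \<open>a\<close> from which the first slot starts.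
    Letters acting on the second slot contribute their eigenvalue at \<open>a\<close>, and the
    change of eigenvalue along the first slot is the \<open>chi\<close> factor built into
    \<open>conv\<close>.\<close>
  have main: "foldr P w g (i, x) = (\<Sum>a\<in>S. conv ch w (?l i a) (?m g x a))"
    if "set w \<subseteq> L" "i \<in> S" for w g i x
    using that
  proof (induction w arbitrary: i x)
    case Nil
    have "(\<Sum>a\<in>S. conv ch [] (?l i a) (?m g x a)) = (\<Sum>a\<in>S. if a = i then g (i, x) else 0)"
      by (intro sum.cong) (auto simp: e_def)
    then show ?case using S Nil by simp
  next
    case (Cons j w)
    have jw: "j \<in> L" "set w \<subseteq> L" using Cons.prems by simp_all
    have "A j (\<lambda>b. foldr P w g (b, x)) i = (\<Sum>b\<in>S. A j (e b) i * (\<Sum>a\<in>S. conv ch w (?l b a) (?m g x a)))"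
      using jw Cons.IH by (subst A) simp_all
    also have "\<dots> = (\<Sum>a\<in>S. conv ch w (\<lambda>u. \<Sum>b\<in>S. A j (e b) i * ?l b a u) (?m g x a))"
      unfolding conv_sum_left conv_scale_left sum_distrib_left by (rule sum.swap)
    also have "\<dots> = (\<Sum>a\<in>S. conv ch w (\<lambda>u. ?l i a (j # u)) (?m g x a))"
      using jw by (simp add: A[of j "foldr A _ _", symmetric])
    finally have 1: "A j (\<lambda>b. foldr P w g (b, x)) i = (\<Sum>a\<in>S. conv ch w (\<lambda>u. ?l i a (j # u)) (?m g x a))" .
    have "t j i * R j (\<lambda>y. foldr P w g (i, y)) x = t j i * R j (\<lambda>y. \<Sum>a\<in>S. conv ch w (?l i a) (?m g y a)) x"
      using jw Cons by simp
    also have "\<dots> = (\<Sum>a\<in>S. conv ch w (\<lambda>u. t j i * ?l i a u) (\<lambda>v. prod_list (map (\<lambda>j. t j a) v) * foldr R (j # v) (\<lambda>y. g (a, y)) x))"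
      unfolding Rsum Rconv Rsc sum_distrib_left conv_scale_left by simp
    also have "\<dots> = (\<Sum>a\<in>S. conv ch w (\<lambda>u. t j a * (chi ch j u * ?l i a u)) (\<lambda>v. prod_list (map (\<lambda>j. t j a) v) * foldr R (j # v) (\<lambda>y. g (a, y)) x))"
      by (intro sum.cong conv_cong[of _ L] refl jw tw Cons.prems)
    also have "\<dots> = (\<Sum>a\<in>S. conv ch w (\<lambda>u. chi ch j u * ?l i a u) (\<lambda>v. ?m g x a (j # v)))"
      unfolding conv_scale_left conv_scale_right[symmetric] by (simp add: mult.assoc)
    finally show ?case
      using Cons.prems by (simp add: P 1 sum.distrib)
  qed
  have "skew_functional ch L (\<lambda>w. \<Sum>a\<in>S. conv ch w (?l i a) (?m g x a))"
    by (intro skew_functional_sum skew_functional_conv skew_functional_twist DA DR i)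
  then show ?thesis by (rule skew_functional.cong) (simp add: main i)
qed

section \<open>Skew functionals annihilate the higher order Serre relations\<close>

definition serre_char :: "nat \<Rightarrow> nat \<Rightarrow> 'k::field \<Rightarrow> nat \<Rightarrow> nat \<Rightarrow> 'k" where
  "serre_char n m q k j = koszul (rdeg n k) (rdeg n j) * q powi (form n m (sroot k) (sroot j))"

lemma form_commute: "form n m x y = form n m y x"
  by (simp add: form_def mult_ac)

lemma form_add_right: "form n m x (\<lambda>a. y a + z a) = form n m x y + form n m x z"
  by (simp add: form_def distrib_left sum.distrib)

lemma chi_serre:
  assumes "q \<noteq> 0"
  shows "chi (serre_char n m q) k w = koszul (rdeg n k) (wdeg (rdeg n) (FM w)) * q powi (form n m (sroot k) (word_wt (FM w)))"
proof (induction w)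
  case Nil then show ?case by (simp add: word_wt_def form_def)
next
  case (Cons j w)
  have "word_wt (FM (j # w)) = (\<lambda>a. sroot j a + word_wt (FM w) a)"
    by (simp add: word_wt_def fun_eq_iff)
  then have "form n m (sroot k) (word_wt (FM (j # w))) = form n m (sroot k) (sroot j) + form n m (sroot k) (word_wt (FM w))"
    by (simp add: form_add_right)
  then show ?case
    using assms unfolding chi_simps Cons.IH wdeg_Cons koszul_add_right
    by (simp add: serre_char_def power_int_add)
qed

lemma ev_list_pder:
  assumes "q \<noteq> 0"
  shows "ev \<kappa> (list_pder n m q k w) = pd (serre_char n m q) k w (\<lambda>u. \<kappa> (FM u))"
proof (induction w arbitrary: \<kappa>)
  case (Cons j w)
  have "ev \<kappa> (gen j * list_pder n m q k w) = pd (serre_char n m q) k w (\<lambda>u. \<kappa> (FM (j # u)))"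
    using Cons.IH[of "\<lambda>v. \<kappa> (FM [j] + v)"] by (simp add: plus_free_monoid_def)
  then show ?case using assms by (simp add: chi_serre)
qed simp

lemma ev_pder:
  assumes "q \<noteq> 0"
  shows "ev \<kappa> (pder n m q k x) = ev (\<lambda>w. pd (serre_char n m q) k (letters w) (\<lambda>u. \<kappa> (FM u))) x"
  using assms by (simp add: pder_def ev_list_pder)

lemma keys_list_pder:
  "u \<in> Poly_Mapping.keys (list_pder n m q k w) \<Longrightarrow> set (letters u) \<subseteq> set w \<and> Suc (length (letters u)) = length w"
proof (induction w arbitrary: u)
  case (Cons j w)
  let ?s = "if j = k then Poly_Mapping.single (FM w)
        (koszul (rdeg n k) (wdeg (rdeg n) (FM w)) * q powi (form n m (sroot k) (word_wt (FM w)))) else 0"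
  have "u \<in> Poly_Mapping.keys (gen j * list_pder n m q k w) \<union> Poly_Mapping.keys ?s"
    using Cons.prems Poly_Mapping.keys_add[of "gen j * list_pder n m q k w" ?s] by auto
  then consider v where "v \<in> Poly_Mapping.keys (list_pder n m q k w)" "u = FM [j] + v" | "u = FM w"
    using keys_mult[of "gen j" "list_pder n m q k w"] by (auto simp: gen_def split: if_splits)
  then show ?case
  proof cases
    case 1 then show ?thesis using Cons.IH[of v] by (auto simp: plus_free_monoid_def)
  qed auto
qed simp

lemma skew_functional_serre:
  assumes q: "q \<noteq> 0" and \<kappa>: "skew_functional (serre_char n m q) L \<kappa>" and x: "x \<in> carrier (free_alg L)"
    and N: "\<forall>w\<in>Poly_Mapping.keys x. length (letters w) = N"
    and d: "\<And>ks. length ks = N \<Longrightarrow> set ks \<subseteq> L \<Longrightarrow> foldr (pder n m q) ks x = 0"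
  shows "ev (\<lambda>w. \<kappa> (letters w)) x = 0"
  using \<kappa> x N d
proof (induction arbitrary: x N rule: skew_functional.induct)
  case empty
  show ?case
  proof (cases "N = 0")
    case True then show ?thesis using empty(3)[of "[]"] by simp
  next
    case False then show ?thesis using empty(2) by (intro ev_fun_zero) auto
  qed
next
  case (add \<kappa> \<mu>)
  show ?case unfolding ev_fun_add using add.IH(1,2)[OF add.prems] by simp
next
  case (scale \<kappa> c) from scale.IH[OF scale.prems] show ?case by (simp add: ev_fun_mult)
next
  case (deriv k \<kappa>)
  have "ev (\<lambda>w. \<kappa> (letters w)) (pder n m q k x) = 0"
  proof (cases N)
    case 0 then show ?thesis using deriv.prems(3)[of "[]"] by (simp add: pder_def)
  next
    case (Suc M)
    have k: "\<exists>w\<in>Poly_Mapping.keys x. u \<in> Poly_Mapping.keys (list_pder n m q k (letters w))"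
      if "u \<in> Poly_Mapping.keys (pder n m q k x)" for u
      using that keys_lin_ext unfolding pder_def by fastforce
    show ?thesis
    proof (rule deriv.IH)
      show "pder n m q k x \<in> carrier (free_alg L)"
        using deriv.prems(1) k keys_list_pder unfolding carrier_free_alg words_def by fastforce
      show "\<forall>w\<in>Poly_Mapping.keys (pder n m q k x). length (letters w) = M"
        using deriv.prems(2) k keys_list_pder Suc by fastforce
      show "foldr (pder n m q) ks (pder n m q k x) = 0" if "length ks = M" "set ks \<subseteq> L" for ks
        \<comment> \<open>\<open>foldr\<close> applies the last entry first, so the derivative
          already taken stands at the end of the list.\<close>
        using deriv.prems(3)[of "ks @ [k]"] that deriv.hyps Suc by simp
    qed
  qed
  then show ?case unfolding ev_pder[OF q] by simp
next
  case (cong \<kappa> \<mu>)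
  have "ev (\<lambda>w. \<mu> (letters w)) x = ev (\<lambda>w. \<kappa> (letters w)) x"
    using cong.prems(1) cong.hyps(2) by (intro ev_cong) (auto simp: carrier_free_alg words_def)
  then show ?case using cong.IH[OF cong.prems] by simp
qed

lemma ev_serre_space:
  assumes q: "q \<noteq> 0" and \<kappa>: "skew_functional (serre_char n m q) {1..n + m} \<kappa>" and x: "x \<in> serre_space n m q"
  shows "ev (\<lambda>w. \<kappa> (letters w)) x = 0"
proof -
  have "serre_space n m q \<subseteq> {x. ev (\<lambda>w. \<kappa> (letters w)) x = 0}"
    unfolding serre_space_def
    by (rule scal.span_minimal)
      (use skew_functional_serre[OF q \<kappa>] in \<open>auto simp: scal.subspace_def\<close>)
  then show ?thesis using x by auto
qed

lemma ev_subst_gens: "ev f (subst_gens g x) = ev (\<lambda>w. f (FM (map g (letters w)))) x"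
  by (simp add: subst_gens_def)

section \<open>The action of the quantum superalgebra on tensor powers\<close>

text \<open>Parities are kept as ring elements, so that the Koszul rules for sums remain
  applicable.\<close>

declare add_bit_eq_xor [simp del] mult_bit_eq_and [simp del]

locale spo =
  fixes n m :: nat and q :: "'k::field_char_0"
  assumes q0: "q \<noteq> 0" and q_root: "\<forall>k>0. q ^ k \<noteq> 1" and n1: "n \<ge> 1"
begin

abbreviation "I \<equiv> idx n m"
abbreviation "L \<equiv> {1..n + m}"
abbreviation "G \<equiv> uq_gens n m"

lemma finite_I [simp]: "finite I"
  by (simp add: idx_def)

lemma neg_idx [simp]: "- i \<in> I \<longleftrightarrow> i \<in> I"
  by (auto simp: idx_def)

lemma eta_neg [simp]: "eta n (- i) = eta n i"
  by (simp add: eta_def)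

lemma eps_neg: "eps (- i) a = - eps i a"
  by (simp add: eps_def sgn_if)

lemma sig_square [simp]: "sig n i j * sig n i j = (1::'a::ring_1)"
  by (simp add: sig_def)

section \<open>The vector representation in coordinates\<close>

definition kap :: "nat \<Rightarrow> int \<Rightarrow> 'k" where
  "kap j i = q powi (form n m (sroot j) (eps i))"

definition kapi :: "nat \<Rightarrow> int \<Rightarrow> 'k" where
  "kapi j i = q powi (- form n m (sroot j) (eps i))"

text \<open>In coordinates \<open>E_k\<close> and \<open>F_k\<close> shift the index by a fixed
  amount, with entries \<open>ec\<close> and \<open>fc\<close>. For \<open>k = 1\<close> the shift
  joins -1 and 1 across the missing index 0, hence the 2.\<close>

definition step :: "nat \<Rightarrow> int" where
  "step k = (if k = 1 then 2 else 1)"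

definition ec :: "nat \<Rightarrow> int \<Rightarrow> 'k" where
  "ec k i = (if k = 1 then (if i = - 1 then 1 else 0)
     else if i = - int k then 1 else if i = int k - 1 then - sig n (int k) (int k) * sig n (int k) (int k - 1) else 0)"

definition fc :: "nat \<Rightarrow> int \<Rightarrow> 'k" where
  "fc k i = (if k = 1 then (if i = 1 then 1 else 0)
     else if i = - int k + 1 then sig n (int k) (int k) else if i = int k then - sig n (int k) (int k) else 0)"

lemma vec_gen_E: "k \<ge> 1 \<Longrightarrow> vec_gen n m q (UE k) f i = ec k i * f (i + step k)"
  by (auto simp: ec_def step_def munit_def ebasis_def)

lemma vec_gen_F: "k \<ge> 1 \<Longrightarrow> vec_gen n m q (UF k) f i = fc k i * f (i - step k)"
  by (cases "i = - int k + 1") (auto simp: fc_def step_def munit_def ebasis_def)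

lemma kap_kapi [simp]: "kap j i * kapi j i = 1" "kapi j i * kap j i = 1" "kap j i \<noteq> 0" "kapi j i \<noteq> 0"
  using q0 by (simp_all add: kap_def kapi_def power_int_minus)

lemma eps_step:
  assumes "k \<ge> 1" "ec k i \<noteq> 0"
  shows "eps i = (\<lambda>a. eps (i + step k) a + sroot k a)"
  using assms by (auto simp: ec_def step_def sroot_def fun_eq_iff eps_neg[of 1] eps_neg[of "int k"]
      eps_neg[of "int k - 1", simplified] split: if_splits)

text \<open>The nonzero entries of \<open>F_k\<close> sit at the transposed positions of those of
  \<open>E_k\<close>; weight and parity facts for \<open>F_k\<close> are deduced from this.\<close>

lemma fc_ec: "fc k i \<noteq> 0 \<longleftrightarrow> ec k (i - step k) \<noteq> 0"
  by (auto simp: fc_def ec_def step_def sig_def)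

lemma kap_ec:
  assumes "k \<ge> 1" "ec k i \<noteq> 0"
  shows "kap j i = q powi (form n m (sroot j) (sroot k)) * kap j (i + step k)"
    "kapi j i = q powi (- form n m (sroot j) (sroot k)) * kapi j (i + step k)"
  unfolding kap_def kapi_def eps_step[OF assms] form_add_right using q0
  by (simp_all add: power_int_add power_int_diff power_int_minus field_simps)

lemma kap_fc:
  assumes "k \<ge> 1" "fc k i \<noteq> 0"
  shows "kap j i = q powi (- form n m (sroot j) (sroot k)) * kap j (i - step k)"
    "kapi j i = q powi (form n m (sroot j) (sroot k)) * kapi j (i - step k)"
  using kap_ec[of k "i - step k" j] assms fc_ec[of k i] q0
  by (simp_all add: power_int_minus field_simps)

lemma eta_ec:
  assumes "k \<in> L" "ec k i \<noteq> 0"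
  shows "eta n i = rdeg n k + eta n (i + step k)"
  using assms n1 by (auto simp: ec_def step_def eta_def rdeg_def split: if_splits)

lemma eta_fc:
  assumes "k \<in> L" "fc k i \<noteq> 0"
  shows "eta n i = rdeg n k + eta n (i - step k)"
proof -
  have "eta n (i - step k) = rdeg n k + eta n (i - step k + step k)"
    by (rule eta_ec[OF assms(1)]) (use assms(2) fc_ec in blast)
  then show ?thesis by (simp add: add.assoc[symmetric])
qed

lemma ec_idx:
  assumes "k \<in> L" "ec k i \<noteq> 0"
  shows "i \<in> I" "i + step k \<in> I"
  using assms by (auto simp: ec_def step_def idx_def split: if_splits)

lemma fc_idx:
  assumes "k \<in> L" "fc k i \<noteq> 0"
  shows "i \<in> I" "i - step k \<in> I"
  using assms by (auto simp: fc_def step_def idx_def split: if_splits)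

lemma form_eps: "form n m x (eps i) = (if 1 \<le> \<bar>i\<bar> \<and> \<bar>i\<bar> \<le> int (n + m) then sig n i i * x (nat \<bar>i\<bar>) * sgn i else 0)"
proof -
  have "form n m x (eps i) = (\<Sum>a=1..n + m. if a = nat \<bar>i\<bar> then sig n i i * x (nat \<bar>i\<bar>) * sgn i else 0)"
    unfolding form_def by (rule sum.cong) (auto simp: eps_def sig_def eta_def)
  then show ?thesis by (auto simp: nat_le_iff)
qed

lemma form_sroot_eps:
  assumes "k \<in> L"
  shows "form n m (sroot k) (eps i) = (if k = 1 then (if i = - 1 then 2 else if i = 1 then - 2 else 0)
     else if i = - int k then sig n i i else if i = int k then - sig n i i
     else if i = int k - 1 then sig n i i else if i = - int k + 1 then - sig n i i else 0)"
  using assms n1 unfolding form_eps by (auto simp: sroot_def eps_def sig_def eta_def koszul_def)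

text \<open>For distinct \<open>j\<close> and \<open>k\<close> each of the two products vanishes on
  its own. For \<open>j = k\<close> both return to the index \<open>i\<close>, and a scalar identity
  remains.\<close>

lemma ec_fc_comm:
  assumes "j \<in> L" "k \<in> L"
  shows "ec j i * (fc k (i + step j) * f (i + step j - step k)) - koszul (rdeg n j) (rdeg n k) * (fc k i * (ec j (i - step k) * f (i - step k + step j)))
    = (if j = k then inverse (qj q j - inverse (qj q j)) * (kap j i - kapi j i) * f i else 0)"
proof (cases "j = k")
  case False
  have "ec j i * fc k (i + step j) = 0" "fc k i * ec j (i - step k) = 0"
    using False assms by (auto simp: ec_def fc_def step_def)
  then show ?thesis using False by (metis (no_types, lifting) diff_zero mult.assoc mult_zero_left mult_zero_right)
next
  case True
  \<comment> \<open>The denominators \<open>q_j - 1/q_j\<close> are nonzero because the second and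
    fourth powers of \<open>q\<close> differ from 1.\<close>
  have q2: "q - inverse q \<noteq> 0" "inverse q - q \<noteq> 0" "q\<^sup>2 - inverse (q\<^sup>2) \<noteq> 0" "inverse (q\<^sup>2) - q\<^sup>2 \<noteq> 0"
    using q_root[rule_format, of 2] q_root[rule_format, of 4] q0 by (auto simp: field_simps power2_eq_square power4_eq_xxxx)
  have inv: "inverse (x - y) * (y - x) = - 1" if "x \<noteq> y" for x y :: 'k
    using that by (simp add: field_simps)
  define X where "X = inverse (qj q j - inverse (qj q j)) * (kap j i - kapi j i)"
  have eq: "ec j i * fc j (i + step j) - koszul (rdeg n j) (rdeg n j) * (fc j i * ec j (i - step j)) = X"
  proof (cases "j = 1")
    case j1: True
    then show ?thesis
      using q2 n1 assms unfolding X_def kap_def kapi_def form_sroot_eps[OF assms(1)]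
      by (simp add: ec_def fc_def step_def qj_def rdeg_def power_int_minus inv)
  next
    case False
    \<comment> \<open>Odd indices are those of large absolute value, so \<open>j\<close> cannot be
      even when \<open>j - 1\<close> is odd; this discards one parity case below.\<close>
    then have "eta n (int j) = rdeg n j + eta n (int j - 1)" "eta n (int j - 1) = 1 \<Longrightarrow> eta n (int j) = 1"
      using assms by (auto simp: eta_def rdeg_def split: if_splits)
    then show ?thesis
      using False q2 assms unfolding X_def kap_def kapi_def form_sroot_eps[OF assms(1)]
      by (cases "i = int j - 1"; cases "i = 1 - int j"; cases "eta n (int j)"; cases "eta n (int j - 1)")
        (auto simp: ec_def fc_def step_def qj_def sig_def koszul_def power_int_minus inv eta_neg[of "int j - 1", simplified])
  qed
  show ?thesis
    using arg_cong[OF eq, of "\<lambda>x. x * f i"] True unfolding X_def by (simp add: algebra_simps)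
qed

section \<open>Tensor powers and their matrix coefficients\<close>

definition etas :: "int list \<Rightarrow> bit" where "etas is = sum_list (map (eta n) is)"
definition kaps :: "nat \<Rightarrow> int list \<Rightarrow> 'k" where "kaps j is = prod_list (map (kap j) is)"
definition kapis :: "nat \<Rightarrow> int list \<Rightarrow> 'k" where "kapis j is = prod_list (map (kapi j) is)"

lemma list_simps [simp]:
  "etas [] = 0" "etas (i # is) = eta n i + etas is" "etas (is @ is') = etas is + etas is'"
  "kaps j [] = 1" "kaps j (i # is) = kap j i * kaps j is" "kaps j (is @ is') = kaps j is * kaps j is'"
  "kapis j [] = 1" "kapis j (i # is) = kapi j i * kapis j is" "kapis j (is @ is') = kapis j is * kapis j is'"
  by (simp_all add: etas_def kaps_def kapis_def)

lemma kaps_kapis [simp]: "kaps j is * kapis j is = 1" "kapis j is * kaps j is = 1"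
  by (induction "is") (simp_all, metis kap_kapi(1) mult.assoc mult.left_commute mult_1_right,
      metis kap_kapi(2) mult.assoc mult.left_commute mult_1_right)

text \<open>Vectors of all tensor powers of the vector representation at once, in coordinates.\<close>

fun tens :: "uq_gen \<Rightarrow> (int list \<Rightarrow> 'k) \<Rightarrow> (int list \<Rightarrow> 'k)" where
  "tens (UK j) f is = kaps j is * f is"
| "tens (UKinv j) f is = kapis j is * f is"
| "tens (UE j) f [] = 0"
| "tens (UF j) f [] = 0"
| "tens (UE j) f (i # is) = ec j i * f ((i + step j) # is)
     + koszul (rdeg n j) (eta n i) * kap j i * tens (UE j) (\<lambda>ks. f (i # ks)) is"
| "tens (UF j) f (i # is) = fc j i * kapis j is * f ((i - step j) # is)
     + koszul (rdeg n j) (eta n i) * tens (UF j) (\<lambda>ks. f (i # ks)) is"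

lemma tens_linear: "tens g (\<lambda>ks. f ks + c * h ks) is = tens g f is + c * tens g h is"
  by (induction g f "is" arbitrary: h rule: tens.induct) (simp_all add: algebra_simps)

lemma tens_zero [simp]: "tens g (\<lambda>ks. 0) is = 0"
  using tens_linear[of g "\<lambda>ks. 0" "-1" "\<lambda>ks. 0"] by simp

lemma tens_add: "tens g (\<lambda>ks. f ks + h ks) is = tens g f is + tens g h is"
  using tens_linear[of g f 1 h] by simp

lemma tens_scale: "tens g (\<lambda>ks. c * h ks) is = c * tens g h is"
  using tens_linear[of g "\<lambda>ks. 0" c h] by simp

lemma tens_sum: "tens g (\<lambda>ks. \<Sum>a\<in>S. h a ks) is = (\<Sum>a\<in>S. tens g (h a) is)"
  by (induction S rule: infinite_finite_induct) (simp_all add: tens_add)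

definition idx_lists :: "nat \<Rightarrow> int list set" where
  "idx_lists l = {ks. length ks = l \<and> set ks \<subseteq> I}"

lemma finite_idx_lists [simp]: "finite (idx_lists l)"
  unfolding idx_lists_def using finite_lists_length_eq[of I l] by (simp add: conj_commute)

lemma idx_lists_Suc: "idx_lists (Suc l) = (\<lambda>(k, ks). k # ks) ` (I \<times> idx_lists l)"
  by (auto simp: idx_lists_def length_Suc_conv image_iff)

lemma sum_idx_lists_Suc: "(\<Sum>ks\<in>idx_lists (Suc l). f ks) = (\<Sum>k\<in>I. \<Sum>ks\<in>idx_lists l. f (k # ks))"
  unfolding idx_lists_Suc sum.cartesian_product by (subst sum.reindex) (auto simp: inj_on_def case_prod_unfold)

lemma idx_lists_0 [simp]: "idx_lists 0 = {[]}"
  by (auto simp: idx_lists_def)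

lemma idx_lists_add: "idx_lists (l + l') = (\<lambda>(ks, ks'). ks @ ks') ` (idx_lists l \<times> idx_lists l')"
proof
  show "idx_lists (l + l') \<subseteq> (\<lambda>(ks, ks'). ks @ ks') ` (idx_lists l \<times> idx_lists l')"
  proof
    fix ks assume "ks \<in> idx_lists (l + l')"
    then show "ks \<in> (\<lambda>(ks, ks'). ks @ ks') ` (idx_lists l \<times> idx_lists l')"
      using set_take_subset[of l ks] set_drop_subset[of l ks]
      by (intro image_eqI[of _ _ "(take l ks, drop l ks)"]) (auto simp: idx_lists_def)
  qed
qed (auto simp: idx_lists_def)

lemma sum_idx_lists_add: "(\<Sum>ks\<in>idx_lists (l + l'). f ks) = (\<Sum>ks\<in>idx_lists l. \<Sum>ks'\<in>idx_lists l'. f (ks @ ks'))"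
  unfolding idx_lists_add sum.cartesian_product by (subst sum.reindex) (auto simp: inj_on_def idx_lists_def case_prod_unfold)

text \<open>Vectors are arbitrary functions on integer lists. Since \<open>ec\<close> and
  \<open>fc\<close> vanish as soon as either end of a shift lies outside the index set, values
  outside it do not influence the coordinates that matter.\<close>

lemma tens_local:
  assumes "g \<in> G" "is \<in> idx_lists l" "\<And>ks. ks \<in> idx_lists l \<Longrightarrow> f ks = h ks"
  shows "tens g f is = tens g h is"
  using assms
proof (induction g f "is" arbitrary: l h rule: tens.induct)
  case (5 j f i "is")
  then obtain l' where l: "l = Suc l'" "i \<in> I" "is \<in> idx_lists l'" by (auto simp: idx_lists_def)
  have j: "j \<in> L" using 5 by (auto simp: uq_gens_def)
  have "tens (UE j) (\<lambda>ks. f (i # ks)) is = tens (UE j) (\<lambda>ks. h (i # ks)) is"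
    by (rule "5.IH"[OF _ l(3)]) (use 5 l in \<open>auto simp: idx_lists_def\<close>)
  moreover have "ec j i * f ((i + step j) # is) = ec j i * h ((i + step j) # is)"
    using 5 l ec_idx[OF j, of i] by (cases "ec j i = 0") (auto simp: idx_lists_def)
  ultimately show ?case by simp
next
  case (6 j f i "is")
  then obtain l' where l: "l = Suc l'" "i \<in> I" "is \<in> idx_lists l'" by (auto simp: idx_lists_def)
  have j: "j \<in> L" using 6 by (auto simp: uq_gens_def)
  have "tens (UF j) (\<lambda>ks. f (i # ks)) is = tens (UF j) (\<lambda>ks. h (i # ks)) is"
    by (rule "6.IH"[OF _ l(3)]) (use 6 l in \<open>auto simp: idx_lists_def\<close>)
  moreover have "fc j i * kapis j is * f ((i - step j) # is) = fc j i * kapis j is * h ((i - step j) # is)"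
    using 6 l fc_idx[OF j, of i] by (cases "fc j i = 0") (auto simp: idx_lists_def)
  ultimately show ?case by simp
qed simp_all

definition delta :: "int list \<Rightarrow> int list \<Rightarrow> 'k" where
  "delta js = (\<lambda>is. if is = js then 1 else 0)"

definition mat :: "uq_gen list \<Rightarrow> int list \<Rightarrow> int list \<Rightarrow> 'k" where
  "mat w is js = foldr tens w (delta js) is"

lemma foldr_tens_expand:
  assumes "set w \<subseteq> G" "is \<in> idx_lists l"
  shows "foldr tens w f is = (\<Sum>ks\<in>idx_lists l. mat w is ks * f ks)"
  using assms
proof (induction w arbitrary: "is")
  case Nil
  have "(\<Sum>ks\<in>idx_lists l. mat [] is ks * f ks) = (\<Sum>ks\<in>idx_lists l. if ks = is then f is else 0)"
    by (intro sum.cong) (auto simp: mat_def delta_def)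
  then show ?case using Nil by simp
next
  case (Cons g w)
  have "foldr tens (g # w) f is = tens g (\<lambda>js. \<Sum>ks\<in>idx_lists l. f ks * mat w js ks) is"
    using Cons by (auto intro!: tens_local simp: mult.commute)
  also have "\<dots> = (\<Sum>ks\<in>idx_lists l. f ks * tens g (\<lambda>js. mat w js ks) is)"
    unfolding tens_sum tens_scale ..
  finally show ?case by (simp add: mat_def mult.commute)
qed

lemma mat_append:
  assumes "set w \<subseteq> G" "is \<in> idx_lists l"
  shows "mat (w @ w') is js = (\<Sum>ks\<in>idx_lists l. mat w is ks * mat w' ks js)"
  unfolding mat_def[of "w @ w'"] foldr_append comp_def foldr_tens_expand[OF assms] mat_def[of w'] ..

lemma mat_Cons:
  assumes "g \<in> G" "is \<in> idx_lists l"
  shows "mat (g # w) is js = (\<Sum>ks\<in>idx_lists l. mat [g] is ks * mat w ks js)"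
  using mat_append[of "[g]" "is" l w js] assms by simp

lemma mat_Nil: "mat [] is js = (if is = js then 1 else 0)"
  by (simp add: mat_def delta_def)

text \<open>Generators preserve the tensor degree and shift parity by their own degree. For words
  this gives \<open>mat_support\<close>, which makes the Koszul signs below computable from degrees
  of words.\<close>

lemma tens_support:
  assumes "g \<in> G" "\<And>ks. length ks \<noteq> l \<or> etas ks \<noteq> \<alpha> \<Longrightarrow> f ks = 0"
    and "length is \<noteq> l \<or> etas is \<noteq> uq_deg n g + \<alpha>"
  shows "tens g f is = 0"
  using assms
proof (induction g f "is" arbitrary: l \<alpha> rule: tens.induct)
  case (5 j f i "is")
  have j: "j \<in> L" using 5 by (auto simp: uq_gens_def)
  have "ec j i * f ((i + step j) # is) = 0"
  proof (cases "ec j i = 0")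
    case False
    have "length ((i + step j) # is) \<noteq> l \<or> etas ((i + step j) # is) \<noteq> \<alpha>"
      using "5.prems"(3) eta_ec[OF j False] by (auto simp: ac_simps)
    from "5.prems"(2)[OF this] show ?thesis by simp
  qed simp
  moreover have "tens (UE j) (\<lambda>ks. f (i # ks)) is = 0"
  proof (cases l)
    case 0 then have "(\<lambda>ks. f (i # ks)) = (\<lambda>ks. 0)" using "5.prems"(2) by auto
    then show ?thesis by simp
  next
    case (Suc l')
    show ?thesis
    proof (rule "5.IH")
      show "UE j \<in> G" by (rule 5)
      show "f (i # ks) = 0" if "length ks \<noteq> l' \<or> etas ks \<noteq> eta n i + \<alpha>" for ks
        using that Suc by (intro "5.prems"(2)) (auto simp: ac_simps)
      show "length is \<noteq> l' \<or> etas is \<noteq> uq_deg n (UE j) + (eta n i + \<alpha>)"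
        using 5(4) Suc by (auto simp: ac_simps)
    qed
  qed
  ultimately show ?case by simp
next
  case (6 j f i "is")
  have j: "j \<in> L" using 6 by (auto simp: uq_gens_def)
  have "fc j i * f ((i - step j) # is) = 0"
  proof (cases "fc j i = 0")
    case False
    have "length ((i - step j) # is) \<noteq> l \<or> etas ((i - step j) # is) \<noteq> \<alpha>"
      using "6.prems"(3) eta_fc[OF j False] by (auto simp: ac_simps)
    from "6.prems"(2)[OF this] show ?thesis by simp
  qed simp
  moreover have "tens (UF j) (\<lambda>ks. f (i # ks)) is = 0"
  proof (cases l)
    case 0 then have "(\<lambda>ks. f (i # ks)) = (\<lambda>ks. 0)" using "6.prems"(2) by auto
    then show ?thesis by simp
  next
    case (Suc l')
    show ?thesis
    proof (rule "6.IH")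
      show "UF j \<in> G" by (rule 6)
      show "f (i # ks) = 0" if "length ks \<noteq> l' \<or> etas ks \<noteq> eta n i + \<alpha>" for ks
        using that Suc by (intro "6.prems"(2)) (auto simp: ac_simps)
      show "length is \<noteq> l' \<or> etas is \<noteq> uq_deg n (UF j) + (eta n i + \<alpha>)"
        using 6(4) Suc by (auto simp: ac_simps)
    qed
  qed
  ultimately show ?case by auto
qed auto

lemma mat_support:
  assumes "set w \<subseteq> G" "length is \<noteq> length js \<or> etas is \<noteq> wdeg (uq_deg n) (FM w) + etas js"
  shows "mat w is js = 0"
  using assms
proof (induction w arbitrary: "is")
  case Nil then show ?case by (auto simp: mat_Nil)
next
  case (Cons g w)
  have "tens g (\<lambda>ks. mat w ks js) is = 0"
  proof (rule tens_support)
    show "g \<in> G" using Cons.prems by simp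
    show "mat w ks js = 0" if "length ks \<noteq> length js \<or> etas ks \<noteq> wdeg (uq_deg n) (FM w) + etas js" for ks
      using Cons that by simp
    show "length is \<noteq> length js \<or> etas is \<noteq> uq_deg n g + (wdeg (uq_deg n) (FM w) + etas js)"
      using Cons.prems by (simp add: ac_simps)
  qed
  then show ?case by (simp add: mat_def)
qed

lemma mat_single: "mat w [i] [j] = foldr (vec_gen n m q) w (ebasis j) i" if "set w \<subseteq> G"
  using that
proof (induction w arbitrary: i)
  case Nil show ?case by (simp add: mat_Nil ebasis_def)
next
  case (Cons g w)
  have "tens g f [i] = vec_gen n m q g (\<lambda>a. f [a]) i" for f
    using Cons.prems by (cases g) (auto simp: vec_gen_E vec_gen_F kap_def kapi_def uq_gens_def simp del: vec_gen.simps(3,4))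
  from this[of "\<lambda>ks. mat w ks [j]"] show ?case using Cons by (simp add: mat_def)
qed

text \<open>The action on a product of two tensor powers is given by the coproduct; the sign arises
  from moving \<open>v\<close> past the vector on which \<open>u\<close> acts.\<close>

lemma tens_append:
  "tens g f (is @ is') = ev (\<lambda>(u, v). foldr tens (letters u)
     (\<lambda>ks. koszul (wdeg (uq_deg n) v) (etas ks) * foldr tens (letters v) (\<lambda>ks'. f (ks @ ks')) is') is) (uq_comult g)"
proof (induction "is" arbitrary: f)
  case Nil
  show ?case by (cases g) (auto simp: zero_free_monoid_def)
next
  case (Cons i "is")
  show ?case
  proof (cases g)
    case (UE j)
    then show ?thesis using Cons.IH[of "\<lambda>ks. f (i # ks)"]
      by (simp add: zero_free_monoid_def koszul_add_right algebra_simps)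
  next
    case (UF j)
    then show ?thesis using Cons.IH[of "\<lambda>ks. f (i # ks)"]
      by (simp add: zero_free_monoid_def koszul_add_right algebra_simps tens_scale)
  qed (simp_all add: algebra_simps)
qed

lemma uq_comult_words: "g \<in> G \<Longrightarrow> Poly_Mapping.keys (uq_comult g) \<subseteq> words G \<times> words G"
  using Poly_Mapping.keys_add by (cases g) (fastforce simp: uq_gens_def)+

lemma mat_append_gen:
  assumes "g \<in> G" "is \<in> idx_lists l" "is' \<in> idx_lists l'" "ks \<in> idx_lists l" "ks' \<in> idx_lists l'"
  shows "mat [g] (is @ is') (ks @ ks') = ev (\<lambda>(u, v). koszul (wdeg (uq_deg n) v) (etas ks) *
    (mat (letters u) is ks * mat (letters v) is' ks')) (uq_comult g)"
proof -
  have "foldr tens (letters u)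
     (\<lambda>js. koszul (wdeg (uq_deg n) v) (etas js) * foldr tens (letters v) (\<lambda>js'. delta (ks @ ks') (js @ js')) is') is
    = koszul (wdeg (uq_deg n) v) (etas ks) * (mat (letters u) is ks * mat (letters v) is' ks')"
    if "(u, v) \<in> Poly_Mapping.keys (uq_comult g)" for u v
  proof -
    have u: "set (letters u) \<subseteq> G" and v: "set (letters v) \<subseteq> G"
      using that uq_comult_words[OF assms(1)] by (auto simp: words_def)
    have 1: "foldr tens (letters v) (\<lambda>js'. delta (ks @ ks') (js @ js')) is' = (if js = ks then mat (letters v) is' ks' else 0)"
      if "js \<in> idx_lists l" for js
    proof -
      have "foldr tens (letters v) (\<lambda>js'. delta (ks @ ks') (js @ js')) is' =
        (\<Sum>js'\<in>idx_lists l'. mat (letters v) is' js' * delta (ks @ ks') (js @ js'))"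
        by (rule foldr_tens_expand[OF v assms(3)])
      also have "\<dots> = (\<Sum>js'\<in>idx_lists l'. if js' = ks' then (if js = ks then mat (letters v) is' ks' else 0) else 0)"
        using that assms by (intro sum.cong) (auto simp: delta_def idx_lists_def)
      finally show ?thesis using assms by simp
    qed
    have "foldr tens (letters u)
       (\<lambda>js. koszul (wdeg (uq_deg n) v) (etas js) * foldr tens (letters v) (\<lambda>js'. delta (ks @ ks') (js @ js')) is') is =
      (\<Sum>js\<in>idx_lists l. mat (letters u) is js * (koszul (wdeg (uq_deg n) v) (etas js) * foldr tens (letters v) (\<lambda>js'. delta (ks @ ks') (js @ js')) is'))"
      by (rule foldr_tens_expand[OF u assms(2)])
    also have "\<dots> = (\<Sum>js\<in>idx_lists l. if js = ks then koszul (wdeg (uq_deg n) v) (etas ks) * (mat (letters u) is ks * mat (letters v) is' ks') else 0)"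
      by (intro sum.cong) (auto simp: 1)
    finally show ?thesis using assms by simp
  qed
  from ev_split_cong[OF this] show ?thesis
    unfolding mat_def[of "[g]"] by (simp add: tens_append)
qed

abbreviation "uqc \<equiv> word_comult (uq_deg n) (uq_comult :: uq_gen \<Rightarrow> _ \<Rightarrow>\<^sub>0 'k)"

lemma uqc_words: "set w \<subseteq> G \<Longrightarrow> Poly_Mapping.keys (uqc w) \<subseteq> words G \<times> words G"
proof (induction w)
  case (Cons g w)
  then show ?case
    using keys_tmul[of "uq_deg n" "uq_comult g" "uqc w"] uq_comult_words[of g] by fastforce
qed simp

text \<open>The Koszul sign of the graded product on the tensor square is matched by parity: a
  nonzero coefficient of \<open>u'\<close> from \<open>js\<close> to \<open>ks\<close> changes the
  parity by the degree of \<open>u'\<close>.\<close>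

lemma mat_append_word:
  assumes "set w \<subseteq> G" "is \<in> idx_lists l" "is' \<in> idx_lists l'" "js \<in> idx_lists l" "js' \<in> idx_lists l'"
  shows "mat w (is @ is') (js @ js') = ev (\<lambda>(u, v). koszul (wdeg (uq_deg n) v) (etas js) *
    (mat (letters u) is js * mat (letters v) is' js')) (uqc w)"
  using assms(1-3)
proof (induction w arbitrary: "is" is')
  case Nil
  then show ?case using assms by (auto simp: mat_Nil idx_lists_def zero_free_monoid_def)
next
  case (Cons g w)
  have g: "g \<in> G" and w: "set w \<subseteq> G" using Cons.prems by simp_all
  have ii: "is @ is' \<in> idx_lists (l + l')" using Cons.prems by (simp add: idx_lists_def)
  let ?K = "\<lambda>v js. koszul (wdeg (uq_deg n) v) (etas js) :: 'k"
  let ?M = "\<lambda>u. mat (letters u)"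
  have "mat (g # w) (is @ is') (js @ js') = (\<Sum>ks\<in>idx_lists l. \<Sum>ks'\<in>idx_lists l'. mat [g] (is @ is') (ks @ ks') * mat w (ks @ ks') (js @ js'))"
    by (subst mat_Cons[OF g ii]) (rule sum_idx_lists_add)
  also have "\<dots> = (\<Sum>ks\<in>idx_lists l. \<Sum>ks'\<in>idx_lists l'. ev (\<lambda>(u, v). ev (\<lambda>(u', v'). (?K v ks * (?M u is ks * ?M v is' ks')) *
      (?K v' js * (?M u' ks js * ?M v' ks' js'))) (uqc w)) (uq_comult g))"
  proof (intro sum.cong refl)
    fix ks ks' assume ks: "ks \<in> idx_lists l" "ks' \<in> idx_lists l'"
    show "mat [g] (is @ is') (ks @ ks') * mat w (ks @ ks') (js @ js') =
      ev (\<lambda>(u, v). ev (\<lambda>(u', v'). (?K v ks * (?M u is ks * ?M v is' ks')) *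
      (?K v' js * (?M u' ks js * ?M v' ks' js'))) (uqc w)) (uq_comult g)"
      unfolding mat_append_gen[OF g Cons.prems(2,3) ks] Cons.IH[OF w ks]
      unfolding case_prod_unfold ev_prod ..
  qed
  also have "\<dots> = ev (\<lambda>(u, v). ev (\<lambda>(u', v'). (\<Sum>ks\<in>idx_lists l. \<Sum>ks'\<in>idx_lists l'. (?K v ks * (?M u is ks * ?M v is' ks')) *
      (?K v' js * (?M u' ks js * ?M v' ks' js')))) (uqc w)) (uq_comult g)"
    unfolding ev_split_sum ..
  also have "\<dots> = ev (\<lambda>(u, v). ev (\<lambda>(u', v'). koszul (wdeg (uq_deg n) v) (wdeg (uq_deg n) u') * (?K (v + v') js *
      (?M (u + u') is js * ?M (v + v') is' js'))) (uqc w)) (uq_comult g)"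
  proof (intro ev_split_cong)
    fix u v u' v' assume "(u, v) \<in> Poly_Mapping.keys (uq_comult g :: _ \<Rightarrow>\<^sub>0 'k)" "(u', v') \<in> Poly_Mapping.keys (uqc w)"
    then have uv: "set (letters u) \<subseteq> G" "set (letters v) \<subseteq> G" "set (letters u') \<subseteq> G" "set (letters v') \<subseteq> G"
      using uq_comult_words[OF g] uqc_words[OF w] by (auto simp: words_def)
    have *: "(?K v ks * (?M u is ks * ?M v is' ks')) * (?K v' js * (?M u' ks js * ?M v' ks' js')) =
      koszul (wdeg (uq_deg n) v) (wdeg (uq_deg n) u') * ?K (v + v') js * ((?M u is ks * ?M u' ks js) * (?M v is' ks' * ?M v' ks' js'))" for ks ks'
    proof (cases "?M u' ks js = 0")
      case False
      then have "etas ks = wdeg (uq_deg n) u' + etas js"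
        using mat_support[OF uv(3), of ks js] by (cases u') auto
      then show ?thesis by (simp add: koszul_add_left koszul_add_right mult_ac)
    qed simp
    have "(\<Sum>ks\<in>idx_lists l. \<Sum>ks'\<in>idx_lists l'. (?K v ks * (?M u is ks * ?M v is' ks')) * (?K v' js * (?M u' ks js * ?M v' ks' js'))) =
      koszul (wdeg (uq_deg n) v) (wdeg (uq_deg n) u') * ?K (v + v') js *
        ((\<Sum>ks\<in>idx_lists l. ?M u is ks * ?M u' ks js) * (\<Sum>ks'\<in>idx_lists l'. ?M v is' ks' * ?M v' ks' js'))"
      unfolding * sum_product by (simp only: sum_distrib_left)
    also have "\<dots> = koszul (wdeg (uq_deg n) v) (wdeg (uq_deg n) u') * (?K (v + v') js * (?M (u + u') is js * ?M (v + v') is' js'))"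
      unfolding mat_append[OF uv(1) Cons.prems(2), symmetric] mat_append[OF uv(2) Cons.prems(3), symmetric]
      by (simp add: plus_free_monoid_def mult.assoc)
    finally show "(\<Sum>ks\<in>idx_lists l. \<Sum>ks'\<in>idx_lists l'. (?K v ks * (?M u is ks * ?M v is' ks')) * (?K v' js * (?M u' ks js * ?M v' ks' js'))) =
      koszul (wdeg (uq_deg n) v) (wdeg (uq_deg n) u') * (?K (v + v') js * (?M (u + u') is js * ?M (v + v') is' js'))" .
  qed
  finally show ?case by simp
qed

section \<open>The pairing of words\<close>

text \<open>The signs \<open>\<sigma>(deg a', deg h\<^sub>1)\<close> of a pairing differ from the sign \<open>\<sigma>(deg h\<^sub>2, deg x)\<close> of the action on
  a tensor product by \<open>\<sigma>(deg a', \<eta>\<^sub>i)\<close>, if \<open>a = t\<^bsub>i,j\<^esub>\<close>; \<open>word_sign\<close> collects these factors.\<close>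

fun word_sign :: "(int \<times> int) list \<Rightarrow> 'k" where
  "word_sign [] = 1"
| "word_sign ((i, j) # u) = koszul (wdeg (tdeg n) (FM u)) (eta n i) * word_sign u"

definition rows :: "(int \<times> int) list \<Rightarrow> int list" where "rows = map fst"
definition cols :: "(int \<times> int) list \<Rightarrow> int list" where "cols = map snd"

lemma rows_cols_simps [simp]:
  "rows [] = []" "rows (x # u) = fst x # rows u" "rows (u @ v) = rows u @ rows v" "length (rows u) = length u"
  "cols [] = []" "cols (x # u) = snd x # cols u" "cols (u @ v) = cols u @ cols v" "length (cols u) = length u"
  by (simp_all add: rows_def cols_def)

definition word_form :: "(int \<times> int) free_monoid \<Rightarrow> uq_gen free_monoid \<Rightarrow> 'k" where
  "word_form u y = word_sign (letters u) * mat (letters y) (rows (letters u)) (cols (letters u))"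

abbreviation "T \<equiv> I \<times> I"

lemma wdeg_tdeg: "wdeg (tdeg n) (FM u) = etas (rows u) + etas (cols u)"
  by (induction u) (auto simp: tdeg_def ac_simps)

lemma rows_cols_idx_lists: "set u \<subseteq> T \<Longrightarrow> rows u \<in> idx_lists (length u) \<and> cols u \<in> idx_lists (length u)"
  by (auto simp: idx_lists_def rows_def cols_def)

lemma word_sign_append: "word_sign (u @ v) = koszul (wdeg (tdeg n) (FM v)) (etas (rows u)) * (word_sign u * word_sign v)"
proof (induction u)
  case (Cons x u)
  have "wdeg (tdeg n) (FM (u @ v)) = wdeg (tdeg n) (FM u) + wdeg (tdeg n) (FM v)"
    by (simp add: FM_append)
  then show ?case using Cons by (cases x) (simp add: koszul_add_left koszul_add_right mult_ac)
qed simp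

lemma word_form_even:
  assumes "u \<in> words T" "y \<in> words G" "wdeg (tdeg n) u \<noteq> wdeg (uq_deg n) y"
  shows "word_form u y = 0"
proof -
  obtain u' y' where [simp]: "u = FM u'" "y = FM y'" by (cases u; cases y) blast
  have "etas (rows u') \<noteq> wdeg (uq_deg n) y + etas (cols u')"
    using assms(3) by (auto simp: wdeg_tdeg add.assoc)
  then show ?thesis using assms(2) by (simp add: word_form_def mat_support)
qed

lemma word_form_mult_left:
  assumes "u \<in> words T" "v \<in> words T" "y \<in> words G"
  shows "word_form (u + v) y = koszul (wdeg (tdeg n) u) (wdeg (tdeg n) v) *
    ev (\<lambda>(y1, y2). word_form u y1 * word_form v y2) (uqc (letters y))"
proof -
  obtain u' v' y' where [simp]: "u = FM u'" "v = FM v'" "y = FM y'" by (cases u; cases v; cases y) blast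
  have u: "rows u' \<in> idx_lists (length u')" "cols u' \<in> idx_lists (length u')"
    and v: "rows v' \<in> idx_lists (length v')" "cols v' \<in> idx_lists (length v')"
    and y: "set y' \<subseteq> G"
    using assms rows_cols_idx_lists by auto
  have "word_form (u + v) y = word_sign (u' @ v') * mat y' (rows u' @ rows v') (cols u' @ cols v')"
    by (simp add: word_form_def plus_free_monoid_def)
  also have "\<dots> = ev (\<lambda>(y1, y2). word_sign (u' @ v') * (koszul (wdeg (uq_deg n) y2) (etas (cols u')) *
      (mat (letters y1) (rows u') (cols u') * mat (letters y2) (rows v') (cols v')))) (uqc y')"
    unfolding mat_append_word[OF y u(1) v(1) u(2) v(2)] ev_split_mult ..
  also have "\<dots> = ev (\<lambda>(y1, y2). koszul (wdeg (tdeg n) u) (wdeg (tdeg n) v) * (word_form u y1 * word_form v y2)) (uqc y')"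
  proof (rule ev_split_cong)
    fix y1 y2 assume "(y1, y2) \<in> Poly_Mapping.keys (uqc y')"
    then have y12: "y1 \<in> words G" "y2 \<in> words G" using uqc_words[OF y] by auto
    show "word_sign (u' @ v') * (koszul (wdeg (uq_deg n) y2) (etas (cols u')) *
      (mat (letters y1) (rows u') (cols u') * mat (letters y2) (rows v') (cols v'))) =
      koszul (wdeg (tdeg n) u) (wdeg (tdeg n) v) * (word_form u y1 * word_form v y2)"
    \<comment> \<open>A nonzero factor forces \<open>v\<close> and \<open>y2\<close> to have equal
      degrees, so the sign of the tensor action becomes a sign in the degrees of words in the
      t's.\<close>
    proof (cases "word_form v y2 = 0")
      case True
      have "word_sign v' \<noteq> 0" by (induction v') auto
      then show ?thesis using True by (auto simp: word_form_def)
    next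
      case False
      then have "wdeg (uq_deg n) y2 = wdeg (tdeg n) v" using word_form_even[OF assms(2) y12(2)] by metis
      then show ?thesis
        unfolding word_sign_append by (simp add: word_form_def wdeg_tdeg[of u'] koszul_add_left koszul_add_right koszul_comm[of "wdeg (tdeg n) (FM v')"] mult_ac)
    qed
  qed
  also have "\<dots> = koszul (wdeg (tdeg n) u) (wdeg (tdeg n) v) *
    ev (\<lambda>(y1, y2). word_form u y1 * word_form v y2) (uqc (letters y))"
    unfolding ev_split_mult by simp
  finally show ?thesis .
qed

abbreviation "spc \<equiv> word_comult (tdeg n) (spo_comult n m :: _ \<Rightarrow> _ \<Rightarrow>\<^sub>0 'k)"

section \<open>The coproduct of words in the t's\<close>

fun split_sign :: "(int \<times> int) list \<Rightarrow> int list \<Rightarrow> 'k" where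
  "split_sign ((i, j) # u) (k # ks) = koszul (eta n k - eta n i) (eta n k - eta n j) *
     koszul (eta n k + eta n j) (wdeg (tdeg n) (FM (zip (rows u) ks))) * split_sign u ks"
| "split_sign _ _ = 1"

text \<open>The coproduct is that of matrix entries, with one intermediate index per letter.
  \<open>split_sign\<close> combines the signs on generators with those of the graded
  product.\<close>

lemma ev_spc:
  "ev f (spc u) = (\<Sum>ks\<in>idx_lists (length u). split_sign u ks * f (FM (zip (rows u) ks), FM (zip ks (cols u))))"
proof (induction u arbitrary: f)
  case Nil then show ?case by (simp add: zero_free_monoid_def)
next
  case (Cons x u)
  obtain i j where [simp]: "x = (i, j)" by fastforce
  have "ev f (spc (x # u)) = (\<Sum>k\<in>I. koszul (eta n k - eta n i) (eta n k - eta n j) *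
    ev (\<lambda>(u', v'). koszul (tdeg n (k, j)) (wdeg (tdeg n) u') * f (FM [(i, k)] + u', FM [(k, j)] + v')) (spc u))"
    by (simp add: spo_comult_def)
  also have "\<dots> = (\<Sum>ks\<in>idx_lists (Suc (length u)). split_sign (x # u) ks * f (FM (zip (rows (x # u)) ks), FM (zip ks (cols (x # u)))))"
    unfolding sum_idx_lists_Suc Cons.IH sum_distrib_left
    by (intro sum.cong refl) (simp add: tdeg_def plus_free_monoid_def add.commute)
  finally show ?case by simp
qed

text \<open>The signs attached to words compensate those of the graded matrix coproduct, up to one
  Koszul sign of total parities. This reduces multiplicativity in the second argument to the product
  of matrices.\<close>

lemma word_sign_zip:
  assumes "length ks = length u"
  shows "word_sign u = koszul (etas (rows u) + etas ks) (etas ks + etas (cols u)) * (split_sign u ks *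
    (word_sign (zip (rows u) ks) * word_sign (zip ks (cols u))))"
  using assms
proof (induction u arbitrary: ks)
  case (Cons x u)
  obtain i j where x: "x = (i, j)" by fastforce
  obtain k ks' where ks: "ks = k # ks'" using Cons.prems by (cases ks) auto
  have len: "length ks' = length u" using Cons.prems ks by simp
  have rc: "rows (zip (rows u) ks') = rows u" "cols (zip (rows u) ks') = ks'"
    "rows (zip ks' (cols u)) = ks'" "cols (zip ks' (cols u)) = cols u"
    using len by (simp_all add: rows_def cols_def map_fst_zip map_snd_zip)
  show ?case
    unfolding x ks
    apply (simp add: Cons.IH[OF len] wdeg_tdeg rc)
    \<comment> \<open>What remains is an identity of Koszul signs in six parities, checked on all
      their values.\<close>
    apply (cases "eta n i"; cases "eta n j"; cases "eta n k"; cases "etas (rows u)"; cases "etas (cols u)"; cases "etas ks'")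
    by (simp_all add: koszul_def)
qed simp

lemma word_form_mult_right:
  assumes "u \<in> words T" "y \<in> words G" "y' \<in> words G"
  shows "word_form u (y + y') = koszul (wdeg (uq_deg n) y) (wdeg (uq_deg n) y') *
    ev (\<lambda>(u1, u2). word_form u1 y * word_form u2 y') (spc (letters u))"
proof -
  obtain v w w' where [simp]: "u = FM v" "y = FM w" "y' = FM w'" by (cases u; cases y; cases y') blast
  have v: "rows v \<in> idx_lists (length v)" "cols v \<in> idx_lists (length v)" and w: "set w \<subseteq> G" "set w' \<subseteq> G"
    using assms rows_cols_idx_lists by auto
  have "word_form u (y + y') = (\<Sum>ks\<in>idx_lists (length v). word_sign v * (mat w (rows v) ks * mat w' ks (cols v)))"
    unfolding word_form_def by (simp add: plus_free_monoid_def mat_append[OF w(1) v(1)] sum_distrib_left)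
  also have "\<dots> = (\<Sum>ks\<in>idx_lists (length v). koszul (wdeg (uq_deg n) y) (wdeg (uq_deg n) y') * (split_sign v ks *
     (word_form (FM (zip (rows v) ks)) y * word_form (FM (zip ks (cols v))) y')))"
  proof (intro sum.cong refl)
    fix ks assume "ks \<in> idx_lists (length v)"
    then have len: "length ks = length v" by (simp add: idx_lists_def)
    have rc: "rows (zip (rows v) ks) = rows v" "cols (zip (rows v) ks) = ks"
      "rows (zip ks (cols v)) = ks" "cols (zip ks (cols v)) = cols v"
      using len by (simp_all add: rows_def cols_def map_fst_zip map_snd_zip)
    show "word_sign v * (mat w (rows v) ks * mat w' ks (cols v)) = koszul (wdeg (uq_deg n) y) (wdeg (uq_deg n) y') * (split_sign v ks *
     (word_form (FM (zip (rows v) ks)) y * word_form (FM (zip ks (cols v))) y'))"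
    proof (cases "mat w (rows v) ks = 0 \<or> mat w' ks (cols v) = 0")
      case True then show ?thesis by (auto simp: word_form_def rc)
    next
      case False
      then have "etas (rows v) = wdeg (uq_deg n) y + etas ks" "etas ks = wdeg (uq_deg n) y' + etas (cols v)"
        using mat_support[OF w(1), of "rows v" ks] mat_support[OF w(2), of ks "cols v"] by auto
      then have "etas (rows v) + etas ks = wdeg (uq_deg n) y" "etas ks + etas (cols v) = wdeg (uq_deg n) y'"
        by (simp_all add: add.assoc)
      then show ?thesis
        unfolding word_sign_zip[OF len] by (simp add: word_form_def rc mult_ac)
    qed
  qed
  also have "\<dots> = koszul (wdeg (uq_deg n) y) (wdeg (uq_deg n) y') *
    ev (\<lambda>(u1, u2). word_form u1 y * word_form u2 y') (spc (letters u))"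
    unfolding ev_spc by (simp add: sum_distrib_left)
  finally show ?thesis .
qed

lemma mat_Nil_Nil: "set w \<subseteq> G \<Longrightarrow> mat w [] [] = prod_list (map uq_counit w)"
proof (induction w)
  case (Cons g w)
  have "tens g f [] = uq_counit g * f []" for f by (cases g) simp_all
  then show ?case using Cons by (simp add: mat_def)
qed (simp add: mat_Nil)

lemma word_form_unit_left: "y \<in> words G \<Longrightarrow> word_form 0 y = prod_list (map uq_counit (letters y))"
  by (simp add: word_form_def zero_free_monoid_def words_def mat_Nil_Nil)

lemma word_form_unit_right:
  "word_form u 0 = prod_list (map (\<lambda>(i, j). if i = j then 1 else 0) (letters u))"
proof -
  have "word_sign u * mat [] (rows u) (cols u) = prod_list (map (\<lambda>(i, j). if i = j then 1 else 0) u)" for u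
  proof (induction u)
    case (Cons x u)
    show ?case
    proof (cases "rows u = cols u")
      case True
      then have "wdeg (tdeg n) (FM u) = 0" by (simp add: wdeg_tdeg)
      then show ?thesis using Cons by (cases x) (auto simp: mat_Nil)
    next
      case False then show ?thesis using Cons by (cases x) (auto simp: mat_Nil)
    qed
  qed (simp add: mat_Nil)
  then show ?thesis by (simp add: word_form_def zero_free_monoid_def)
qed

section \<open>The antipodes\<close>

lemma kap_neg [simp]: "kap j (- i) = kapi j i" "kapi j (- i) = kap j i"
proof -
  have "form n m (sroot j) (eps (- i)) = - form n m (sroot j) (eps i)"
    by (simp add: form_def eps_neg sum_negf)
  then show "kap j (- i) = kapi j i" "kapi j (- i) = kap j i" by (simp_all add: kap_def kapi_def)
qed

text \<open>The index pattern of the antipode: \<open>t_{i,j}\<close> is sent to a multiple of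
  \<open>t_{-j,-i}\<close>, and products are reversed.\<close>

definition neg_rev :: "int list \<Rightarrow> int list" where "neg_rev is = rev (map uminus is)"

lemma neg_rev_simps [simp]: "neg_rev [] = []" "neg_rev (i # is) = neg_rev is @ [- i]" "neg_rev (neg_rev is) = is" "length (neg_rev is) = length is"
  "neg_rev is = neg_rev js \<longleftrightarrow> is = js"
  by (simp_all add: neg_rev_def rev_map comp_def)

lemma neg_rev_idx_lists [simp]: "neg_rev is \<in> idx_lists l \<longleftrightarrow> is \<in> idx_lists l"
  by (auto simp: idx_lists_def neg_rev_def)

lemma etas_neg_rev [simp]: "etas (neg_rev is) = etas is"
  by (induction "is") (simp_all add: ac_simps)

lemma kaps_neg_rev [simp]: "kaps j (neg_rev is) = kapis j is" "kapis j (neg_rev is) = kaps j is"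
  by (induction "is") (simp_all add: ac_simps)

lemma sum_idx_lists_neg_rev: "(\<Sum>ks\<in>idx_lists l. f (neg_rev ks)) = (\<Sum>ks\<in>idx_lists l. f ks)"
  by (rule sum.reindex_bij_witness[of _ neg_rev neg_rev]) auto

definition cc :: "int \<Rightarrow> 'k" where "cc i = Cq n q i (- i)"

text \<open>The part of the antipode coefficient of \<open>t_{i,j}\<close> that depends on the row;
  \<open>cc (- j)\<close> is the part that depends on the column.\<close>

definition th :: "int \<Rightarrow> 'k" where "th i = sig n i i * inverse (cc (- i))"

lemma cc_nonzero [simp]: "cc i \<noteq> 0"
  using q0 by (auto simp: cc_def Cq_def sig_def)

text \<open>All entries of C involved in \<open>E_k\<close> and \<open>F_k\<close> are expressed
  through the single entry at \<open>k - 1\<close>, so that it cancels from the identities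
  below.\<close>

lemma cc_values:
  assumes "k \<ge> 2"
  shows "cc (int k) = q powi (sig n (int k) (int k)) * cc (int k - 1)"
    and "cc (1 - int k) = - sig n (int k - 1) (int k - 1) * q powi (sig n (int k - 1) (int k - 1)) * inverse q * inverse (cc (int k - 1))"
    and "cc (- int k) = - sig n (int k) (int k) * inverse q * inverse (cc (int k - 1))"
proof -
  have S: "{1..i} = insert i {1..i - 1}" if "i \<ge> 1" for i :: int using that by auto
  let ?S = "\<lambda>i. \<Sum>k=1..i. sig n k k :: int"
  have S1: "?S (int k) = sig n (int k) (int k) + ?S (int k - 1)"
    by (subst S) (use assms in auto)
  have S2: "?S (int k - 1) = sig n (int k - 1) (int k - 1) + ?S (int k - 2)"
    by (subst S) (use assms in auto)
  show "cc (int k) = q powi (sig n (int k) (int k)) * cc (int k - 1)"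
    using assms q0 unfolding cc_def Cq_def by (simp add: S1 power_int_add)
  have p: "q powi (- 1 - x) = inverse q * inverse (q powi x)" for x :: int
    using q0 by (simp add: power_int_diff power_int_minus field_simps)
  show "cc (1 - int k) = - sig n (int k - 1) (int k - 1) * q powi (sig n (int k - 1) (int k - 1)) * inverse q * inverse (cc (int k - 1))"
    using assms q0 unfolding cc_def Cq_def by (simp add: S2 p power_int_add)
  show "cc (- int k) = - sig n (int k) (int k) * inverse q * inverse (cc (int k - 1))"
    using assms q0 unfolding cc_def Cq_def by (simp add: p)
qed

lemma cc_values_1: "cc 1 = q" "cc (- 1) = - inverse q"
  using n1 by (auto simp: cc_def Cq_def sig_def eta_def power_int_minus)

lemma koszul_th: "koszul (eta n i) (eta n j) * (th i * cc (- j)) = sig n i i * sig n i j * Cq_inv n q i (- i) * Cq n q (- j) j"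
  by (simp add: th_def cc_def Cq_inv_def sig_def)

text \<open>The identity \<open>S(E_k) = - K_k^{-1} E_k\<close> on \<open>V\<close>, entry by entry:
  the form C identifies \<open>V\<close> with its dual. Both sides vanish except at the two
  positions treated separately.\<close>

lemma antipode_ec:
  assumes "k \<in> L" "i + step k = j"
  shows "koszul (eta n i) (eta n j) * (th i * cc (- j)) * ec k (- j) = - kapi k i * ec k i"
proof (cases "k = 1")
  case True
  then show ?thesis
    using assms n1 q0 unfolding th_def kapi_def form_sroot_eps[OF assms(1)]
    by (cases "i = - 1") (auto simp: ec_def step_def cc_values_1 sig_def eta_def power_int_minus power2_eq_square)
next
  case False
  then have k: "k \<ge> 2" using assms by simp
  note cv = cc_values[OF k]
  have e: "eta n (int k) = 0 \<Longrightarrow> eta n (int k - 1) = 0" "eta n (1 - int k) = eta n (int k - 1)"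
    using k by (auto simp: eta_def split: if_splits)
  consider "i = - int k" | "i = int k - 1" | "ec k i = 0" "ec k (- j) = 0"
  proof -
    have "ec k i = 0 \<and> ec k (- j) = 0" if i: "i \<noteq> - int k" "i \<noteq> int k - 1"
    proof -
      have "- j \<noteq> - int k" "- j \<noteq> int k - 1" using i False assms(2) by (simp_all add: step_def)
      then show ?thesis using i False by (simp add: ec_def)
    qed
    then show ?thesis using that by blast
  qed
  then show ?thesis
  proof cases
    case 1
    then have j: "j = 1 - int k" using assms False by (simp add: step_def)
    show ?thesis
      using k q0 unfolding 1 j th_def kapi_def form_sroot_eps[OF assms(1)]
      by (cases "eta n (int k)"; cases "eta n (int k - 1)")
        (auto simp: ec_def cv e sig_def koszul_def power_int_minus field_simps)
  next
    case 2
    then have j: "j = int k" using assms False by (simp add: step_def)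
    show ?thesis
      using k q0 unfolding 2 j th_def kapi_def form_sroot_eps[OF assms(1)]
      by (cases "eta n (int k)"; cases "eta n (int k - 1)")
        (auto simp: ec_def cv e sig_def koszul_def power_int_minus field_simps)
  qed simp
qed

text \<open>The companion for \<open>S(F_k) = - F_k K_k\<close>. Here \<open>K_k\<close> acts first,
  so its eigenvalue is taken at the column index \<open>j\<close>.\<close>

lemma antipode_fc:
  assumes "k \<in> L" "i - step k = j"
  shows "koszul (eta n i) (eta n j) * (th i * cc (- j)) * fc k (- j) = - kap k j * fc k i"
proof (cases "k = 1")
  case True
  then show ?thesis
    using assms n1 q0 unfolding th_def kap_def form_sroot_eps[OF assms(1)]
    by (cases "i = 1") (auto simp: fc_def step_def cc_values_1 sig_def eta_def power_int_minus power2_eq_square)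
next
  case False
  then have k: "k \<ge> 2" using assms by simp
  note cv = cc_values[OF k]
  have e: "eta n (int k) = 0 \<Longrightarrow> eta n (int k - 1) = 0" "eta n (1 - int k) = eta n (int k - 1)"
    using k by (auto simp: eta_def split: if_splits)
  consider "i = 1 - int k" | "i = int k" | "fc k i = 0" "fc k (- j) = 0"
  proof -
    have "fc k i = 0 \<and> fc k (- j) = 0" if i: "i \<noteq> 1 - int k" "i \<noteq> int k"
    proof -
      have "- j \<noteq> - int k + 1" "- j \<noteq> int k" using i False assms(2) by (simp_all add: step_def)
      then show ?thesis using i False by (simp add: fc_def)
    qed
    then show ?thesis using that by blast
  qed
  then show ?thesis
  proof cases
    case 1
    then have j: "j = - int k" using assms False by (simp add: step_def)
    show ?thesis
      using k q0 unfolding 1 j th_def kap_def form_sroot_eps[OF assms(1)]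
      by (cases "eta n (int k)"; cases "eta n (int k - 1)")
        (auto simp: fc_def cv e sig_def koszul_def power_int_minus field_simps)
  next
    case 2
    then have j: "j = int k - 1" using assms False by (simp add: step_def)
    show ?thesis
      using k q0 unfolding 2 j th_def kap_def form_sroot_eps[OF assms(1)]
      by (cases "eta n (int k)"; cases "eta n (int k - 1)")
        (auto simp: fc_def cv e sig_def koszul_def power_int_minus field_simps)
  qed simp
qed

lemma mat_E_Cons: "mat [UE k] (i # is) (j # js) = (if is = js \<and> i + step k = j then ec k i else 0)
    + (if i = j then koszul (rdeg n k) (eta n i) * kap k i * mat [UE k] is js else 0)"
proof -
  have "(\<lambda>ks. delta (j # js) (i # ks)) = (if i = j then delta js else (\<lambda>_. 0))"
    by (auto simp: delta_def)
  then show ?thesis by (auto simp: mat_def delta_def)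
qed

lemma mat_F_Cons: "mat [UF k] (i # is) (j # js) = (if is = js \<and> i - step k = j then fc k i * kapis k is else 0)
    + (if i = j then koszul (rdeg n k) (eta n i) * mat [UF k] is js else 0)"
proof -
  have "(\<lambda>ks. delta (j # js) (i # ks)) = (if i = j then delta js else (\<lambda>_. 0))"
    by (auto simp: delta_def)
  then show ?thesis by (auto simp: mat_def delta_def)
qed

lemma tens_E_snoc: "tens (UE k) f (is @ [i]) = tens (UE k) (\<lambda>ks. f (ks @ [i])) is
    + kaps k is * koszul (rdeg n k) (etas is) * ec k i * f (is @ [i + step k])"
  by (simp add: tens_append zero_free_monoid_def)

lemma tens_F_snoc: "tens (UF k) f (is @ [i]) = kapi k i * tens (UF k) (\<lambda>ks. f (ks @ [i])) is
    + koszul (rdeg n k) (etas is) * fc k i * f (is @ [i - step k])"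
  by (simp add: tens_append zero_free_monoid_def tens_scale)

lemma mat_E_snoc: "mat [UE k] (is @ [i]) (js @ [j]) = (if i = j then mat [UE k] is js else 0)
    + (if is = js \<and> i + step k = j then kaps k is * koszul (rdeg n k) (etas is) * ec k i else 0)"
proof -
  have "(\<lambda>ks. delta (js @ [j]) (ks @ [i])) = (if i = j then delta js else (\<lambda>_. 0))"
    by (auto simp: delta_def)
  then show ?thesis by (auto simp: mat_def delta_def tens_E_snoc)
qed

lemma mat_F_snoc: "mat [UF k] (is @ [i]) (js @ [j]) = (if i = j then kapi k i * mat [UF k] is js else 0)
    + (if is = js \<and> i - step k = j then koszul (rdeg n k) (etas is) * fc k i else 0)"
proof -
  have "(\<lambda>ks. delta (js @ [j]) (ks @ [i])) = (if i = j then delta js else (\<lambda>_. 0))"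
    by (auto simp: delta_def)
  then show ?thesis by (auto simp: mat_def delta_def tens_F_snoc)
qed

definition ths :: "int list \<Rightarrow> 'k" where "ths is = prod_list (map th is)"
definition ccs :: "int list \<Rightarrow> 'k" where "ccs is = prod_list (map (\<lambda>j. cc (- j)) is)"

lemma ths_simps [simp]: "ths [] = 1" "ths (i # is) = th i * ths is" "ccs [] = 1" "ccs (i # is) = cc (- i) * ccs is"
  by (simp_all add: ths_def ccs_def)

lemma th_cc: "th i * cc (- i) = koszul (eta n i) (eta n i)"
  by (simp add: th_def sig_def)

lemma ths_ccs: "ths is * ccs is = koszul (etas is) (etas is)"
proof (induction "is")
  case (Cons i "is")
  have "ths (i # is) * ccs (i # is) = (th i * cc (- i)) * (ths is * ccs is)" by (simp add: mult_ac)
  then show ?case unfolding th_cc Cons by (cases "eta n i"; cases "etas is") (simp_all add: koszul_def)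
qed simp

text \<open>The contragredient matrix coefficients, that is the values on the antipode of a word in the \<open>t\<^bsub>i,j\<^esub>\<close>.\<close>

definition contra_mat :: "uq_gen list \<Rightarrow> int list \<Rightarrow> int list \<Rightarrow> 'k" where
  "contra_mat y is js = koszul (etas is) (etas js) * (ths is * ccs js) * mat y (neg_rev js) (neg_rev is)"

lemma contra_mat_Nil: "contra_mat [] is js = (if is = js then 1 else 0)"
  using ths_ccs[of "is"] by (auto simp: contra_mat_def mat_Nil mult.assoc)

text \<open>Graded anti-multiplicativity. At the intermediate index the factors \<open>ths\<close>
  and \<open>ccs\<close> collapse to a sign by \<open>ths_ccs\<close>, and parity turns all signs
  into the one of the reversed product.\<close>

lemma contra_mat_Cons:
  assumes "set (g # y) \<subseteq> G" "is \<in> idx_lists l" "js \<in> idx_lists l"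
  shows "contra_mat (g # y) is js = koszul (uq_deg n g) (wdeg (uq_deg n) (FM y)) * (\<Sum>ks\<in>idx_lists l. contra_mat y is ks * contra_mat [g] ks js)"
proof -
  have g: "g \<in> G" "set [g] \<subseteq> G" "set y \<subseteq> G" using assms by simp_all
  have "mat (g # y) (neg_rev js) (neg_rev is) = (\<Sum>ks\<in>idx_lists l. mat [g] (neg_rev js) (neg_rev ks) * mat y (neg_rev ks) (neg_rev is))"
    unfolding sum_idx_lists_neg_rev[of "\<lambda>ks. mat [g] (neg_rev js) ks * mat y ks (neg_rev is)"]
    by (rule mat_Cons) (use assms in simp_all)
  then have "contra_mat (g # y) is js = (\<Sum>ks\<in>idx_lists l. koszul (etas is) (etas js) * (ths is * ccs js) * (mat [g] (neg_rev js) (neg_rev ks) * mat y (neg_rev ks) (neg_rev is)))"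
    by (simp add: contra_mat_def sum_distrib_left)
  also have "\<dots> = (\<Sum>ks\<in>idx_lists l. koszul (uq_deg n g) (wdeg (uq_deg n) (FM y)) * (contra_mat y is ks * contra_mat [g] ks js))"
  proof (intro sum.cong refl)
    fix ks
    show "koszul (etas is) (etas js) * (ths is * ccs js) * (mat [g] (neg_rev js) (neg_rev ks) * mat y (neg_rev ks) (neg_rev is)) =
      koszul (uq_deg n g) (wdeg (uq_deg n) (FM y)) * (contra_mat y is ks * contra_mat [g] ks js)"
    proof (cases "mat [g] (neg_rev js) (neg_rev ks) = 0 \<or> mat y (neg_rev ks) (neg_rev is) = 0")
      case True then show ?thesis by (auto simp: contra_mat_def)
    next
      case False
      then have e: "etas js = uq_deg n g + etas ks" "etas ks = wdeg (uq_deg n) (FM y) + etas is"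
        using mat_support[OF g(2), of "neg_rev js" "neg_rev ks"] mat_support[OF g(3), of "neg_rev ks" "neg_rev is"] by auto
      have "koszul (uq_deg n g) (wdeg (uq_deg n) (FM y)) * (contra_mat y is ks * contra_mat [g] ks js) =
        koszul (uq_deg n g) (wdeg (uq_deg n) (FM y)) * koszul (etas is) (etas ks) * koszul (etas ks) (etas js) * (ths ks * ccs ks) *
        ((ths is * ccs js) * (mat [g] (neg_rev js) (neg_rev ks) * mat y (neg_rev ks) (neg_rev is)))"
        by (simp add: contra_mat_def mult_ac)
      also have "koszul (uq_deg n g) (wdeg (uq_deg n) (FM y)) * koszul (etas is) (etas ks) * koszul (etas ks) (etas js) * (ths ks * ccs ks)
        = koszul (etas is) (etas js)"
        unfolding ths_ccs unfolding e
        by (cases "uq_deg n g"; cases "wdeg (uq_deg n) (FM y)"; cases "etas is") (simp_all add: koszul_def)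
      finally show ?thesis by (simp add: mult.assoc)
    qed
  qed
  finally show ?thesis by (simp add: sum_distrib_left)
qed

text \<open>Removing the first tensor factor removes the last one from the reversed lists, so the
  recursion at the front is compared with that at the back. The \<open>K_k\<close> factors then sit
  on opposite sides, and \<open>kapis\<close> accounts for the difference, as
  \<open>S(E_k) = - K_k^{-1} E_k\<close> predicts.\<close>

lemma contra_mat_E:
  assumes "k \<in> L" "length is = length js"
  shows "contra_mat [UE k] is js = - (kapis k is * mat [UE k] is js)"
  using assms(2)
proof (induction "is" js rule: list_induct2)
  case Nil then show ?case by (simp add: contra_mat_def mat_def)
next
  case (Cons i "is" j js)
  have G: "set [UE k] \<subseteq> G" using assms by (auto simp: uq_gens_def)
  have 1: "koszul (eta n i + etas is) (eta n i + etas js) * (th i * ths is * (cc (- i) * ccs js)) * mat [UE k] (neg_rev js) (neg_rev is)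
    = koszul (rdeg n k) (eta n i) * contra_mat [UE k] is js"
  proof (cases "mat [UE k] (neg_rev js) (neg_rev is) = 0")
    case False
    then have e: "etas js = rdeg n k + etas is" using mat_support[OF G, of "neg_rev js" "neg_rev is"] by auto
    have "koszul (eta n i + etas is) (eta n i + etas js) * (th i * ths is * (cc (- i) * ccs js)) * mat [UE k] (neg_rev js) (neg_rev is)
      = koszul (eta n i + etas is) (eta n i + etas js) * (th i * cc (- i)) * (ths is * ccs js) * mat [UE k] (neg_rev js) (neg_rev is)"
      by (simp add: mult_ac)
    also have "\<dots> = koszul (rdeg n k) (eta n i) * contra_mat [UE k] is js"
      unfolding th_cc contra_mat_def e
      by (cases "eta n i"; cases "etas is"; cases "rdeg n k") (simp_all add: koszul_def)
    finally show ?thesis .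
  qed (simp add: contra_mat_def)
  have 2: "koszul (eta n i + etas is) (eta n j + etas is) * (th i * ths is * (cc (- j) * ccs is)) *
      (kapis k is * koszul (rdeg n k) (etas is) * ec k (- j)) = - (kapi k i * kapis k is * ec k i)"
    if "i + step k = j"
  proof (cases "ec k i = 0")
    case True
    then show ?thesis using antipode_ec[OF assms(1) that] by auto
  next
    case False
    from eta_ec[OF assms(1) this] that have e: "eta n i = rdeg n k + eta n j" by simp
    have "koszul (eta n i + etas is) (eta n j + etas is) * (th i * ths is * (cc (- j) * ccs is)) *
      (kapis k is * koszul (rdeg n k) (etas is) * ec k (- j)) =
      koszul (eta n i + etas is) (eta n j + etas is) * koszul (rdeg n k) (etas is) * (ths is * ccs is) * koszul (eta n i) (eta n j) *
       (kapis k is * (koszul (eta n i) (eta n j) * (th i * cc (- j)) * ec k (- j)))"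
      by (simp add: mult_ac)
    also have "koszul (eta n i + etas is) (eta n j + etas is) * koszul (rdeg n k) (etas is) * (ths is * ccs is) * koszul (eta n i) (eta n j) = 1"
      unfolding ths_ccs e by (cases "eta n j"; cases "etas is"; cases "rdeg n k") (simp_all add: koszul_def)
    finally show ?thesis unfolding antipode_ec[OF assms(1) that] by simp
  qed
  have "contra_mat [UE k] (i # is) (j # js) = (if i = j then koszul (eta n i + etas is) (eta n i + etas js) * (th i * ths is * (cc (- i) * ccs js)) * mat [UE k] (neg_rev js) (neg_rev is) else 0)
    + (if is = js \<and> i + step k = j then koszul (eta n i + etas is) (eta n j + etas is) * (th i * ths is * (cc (- j) * ccs is)) *
      (kapis k is * koszul (rdeg n k) (etas is) * ec k (- j)) else 0)"
    unfolding contra_mat_def by (auto simp: mat_E_snoc algebra_simps)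
  also have "\<dots> = (if i = j then koszul (rdeg n k) (eta n i) * contra_mat [UE k] is js else 0)
    + (if is = js \<and> i + step k = j then - (kapi k i * kapis k is * ec k i) else 0)"
    by (intro arg_cong2[where f = "(+)"] if_cong refl 1 2) simp
  also have "\<dots> = - (kapis k (i # is) * mat [UE k] (i # is) (j # js))"
  proof -
    have "kapi k i * (kap k i * x) = x" for x by (simp add: mult.assoc[symmetric])
    then show ?thesis unfolding mat_E_Cons Cons.IH by (auto simp: algebra_simps)
  qed
  finally show ?case .
qed

lemma contra_mat_F:
  assumes "k \<in> L" "length is = length js"
  shows "contra_mat [UF k] is js = - (mat [UF k] is js * kaps k js)"
  using assms(2)
proof (induction "is" js rule: list_induct2)
  case Nil then show ?case by (simp add: contra_mat_def mat_def)
next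
  case (Cons i "is" j js)
  have G: "set [UF k] \<subseteq> G" using assms by (auto simp: uq_gens_def)
  have 1: "koszul (eta n i + etas is) (eta n i + etas js) * (th i * ths is * (cc (- i) * ccs js)) * mat [UF k] (neg_rev js) (neg_rev is)
    = koszul (rdeg n k) (eta n i) * contra_mat [UF k] is js"
  proof (cases "mat [UF k] (neg_rev js) (neg_rev is) = 0")
    case False
    then have e: "etas js = rdeg n k + etas is" using mat_support[OF G, of "neg_rev js" "neg_rev is"] by auto
    have "koszul (eta n i + etas is) (eta n i + etas js) * (th i * ths is * (cc (- i) * ccs js)) * mat [UF k] (neg_rev js) (neg_rev is)
      = koszul (eta n i + etas is) (eta n i + etas js) * (th i * cc (- i)) * (ths is * ccs js) * mat [UF k] (neg_rev js) (neg_rev is)"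
      by (simp add: mult_ac)
    also have "\<dots> = koszul (rdeg n k) (eta n i) * contra_mat [UF k] is js"
      unfolding th_cc contra_mat_def e
      by (cases "eta n i"; cases "etas is"; cases "rdeg n k") (simp_all add: koszul_def)
    finally show ?thesis .
  qed (simp add: contra_mat_def)
  have 2: "koszul (eta n i + etas is) (eta n j + etas is) * (th i * ths is * (cc (- j) * ccs is)) *
      (koszul (rdeg n k) (etas is) * fc k (- j)) = - (kap k j * fc k i)"
    if "i - step k = j"
  proof (cases "fc k i = 0")
    case True
    then show ?thesis using antipode_fc[OF assms(1) that] by auto
  next
    case False
    from eta_fc[OF assms(1) this] that have e: "eta n i = rdeg n k + eta n j" by simp
    have "koszul (eta n i + etas is) (eta n j + etas is) * (th i * ths is * (cc (- j) * ccs is)) *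
      (koszul (rdeg n k) (etas is) * fc k (- j)) =
      koszul (eta n i + etas is) (eta n j + etas is) * koszul (rdeg n k) (etas is) * (ths is * ccs is) * koszul (eta n i) (eta n j) *
       (koszul (eta n i) (eta n j) * (th i * cc (- j)) * fc k (- j))"
      by (simp add: mult_ac)
    also have "koszul (eta n i + etas is) (eta n j + etas is) * koszul (rdeg n k) (etas is) * (ths is * ccs is) * koszul (eta n i) (eta n j) = 1"
      unfolding ths_ccs e by (cases "eta n j"; cases "etas is"; cases "rdeg n k") (simp_all add: koszul_def)
    finally show ?thesis unfolding antipode_fc[OF assms(1) that] by simp
  qed
  have "contra_mat [UF k] (i # is) (j # js) = (if i = j then kap k i * (koszul (eta n i + etas is) (eta n i + etas js) * (th i * ths is * (cc (- i) * ccs js)) * mat [UF k] (neg_rev js) (neg_rev is)) else 0)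
    + (if is = js \<and> i - step k = j then koszul (eta n i + etas is) (eta n j + etas is) * (th i * ths is * (cc (- j) * ccs is)) *
      (koszul (rdeg n k) (etas is) * fc k (- j)) else 0)"
    unfolding contra_mat_def by (auto simp: mat_F_snoc algebra_simps)
  also have "\<dots> = (if i = j then kap k i * (koszul (rdeg n k) (eta n i) * contra_mat [UF k] is js) else 0)
    + (if is = js \<and> i - step k = j then - (kap k j * fc k i) else 0)"
    by (intro arg_cong2[where f = "(+)"] if_cong refl arg_cong[OF 1] 2) simp
  also have "\<dots> = - (mat [UF k] (i # is) (j # js) * kaps k (j # js))"
  proof -
    have "kapis k is * (kaps k is * x) = x" for x "is" by (simp add: mult.assoc[symmetric])
    then show ?thesis unfolding mat_F_Cons Cons.IH by (auto simp: algebra_simps)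
  qed
  finally show ?case .
qed

section \<open>Matrix coefficients of the antipode of the quantum superalgebra\<close>

definition antipode_mat :: "uq_gen list \<Rightarrow> int list \<Rightarrow> int list \<Rightarrow> 'k" where
  "antipode_mat y is js = ev (\<lambda>w. mat (letters w) is js) (list_antipode (uq_deg n) uq_antipode y)"

lemma uq_antipode_words: "g \<in> G \<Longrightarrow> Poly_Mapping.keys (uq_antipode g :: (uq_gen, 'k) free_algebra) \<subseteq> words G"
  by (cases g) (auto simp: uq_gens_def gen_def mult_single plus_free_monoid_def)

lemma list_antipode_words:
  assumes "set y \<subseteq> G"
  shows "Poly_Mapping.keys (list_antipode (uq_deg n) uq_antipode y :: (uq_gen, 'k) free_algebra) \<subseteq> words G"
proof -
  \<comment> \<open>The closure of the antipode under the alphabet comes from the general locale,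
    instantiated with no relations.\<close>
  have "presentation G {} uq_comult (uq_antipode :: uq_gen \<Rightarrow> (uq_gen, 'k) free_algebra)"
    by unfold_locales (simp_all add: uq_comult_words uq_antipode_words carrier_free_alg)
  from presentation.list_antipode_carrier[OF this assms] show ?thesis
    by (simp add: carrier_free_alg)
qed

lemma antipode_mat_Cons:
  assumes "set (g # y) \<subseteq> G" "is \<in> idx_lists l"
  shows "antipode_mat (g # y) is js = koszul (uq_deg n g) (wdeg (uq_deg n) (FM y)) *
    (\<Sum>ks\<in>idx_lists l. antipode_mat y is ks * ev (\<lambda>w. mat (letters w) ks js) (uq_antipode g))"
proof -
  let ?S = "list_antipode (uq_deg n) uq_antipode y :: (uq_gen, 'k) free_algebra"
  have "antipode_mat (g # y) is js = koszul (uq_deg n g) (wdeg (uq_deg n) (FM y)) *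
      ev (\<lambda>u. ev (\<lambda>v. mat (letters u @ letters v) is js) (uq_antipode g)) ?S"
    by (simp add: antipode_mat_def plus_free_monoid_def)
  also have "ev (\<lambda>u. ev (\<lambda>v. mat (letters u @ letters v) is js) (uq_antipode g)) ?S =
     ev (\<lambda>u. ev (\<lambda>v. \<Sum>ks\<in>idx_lists l. mat (letters u) is ks * mat (letters v) ks js) (uq_antipode g)) ?S"
    using list_antipode_words[of y] assms
    by (intro ev_cong mat_append[OF _ assms(2)]) (auto simp: words_def)
  also have "\<dots> = (\<Sum>ks\<in>idx_lists l. antipode_mat y is ks * ev (\<lambda>w. mat (letters w) ks js) (uq_antipode g))"
    unfolding antipode_mat_def ev_prod ev_fun_sum ..
  finally show ?thesis .
qed

lemma contra_mat_gen:
  assumes "g \<in> G" "is \<in> idx_lists l" "js \<in> idx_lists l"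
  shows "contra_mat [g] is js = ev (\<lambda>w. mat (letters w) is js) (uq_antipode g)"
proof -
  have len: "length is = length js" using assms by (simp add: idx_lists_def)
  have d: "koszul (etas is) (etas is) * (ths is * ccs is) = 1" unfolding ths_ccs by simp
  show ?thesis
  proof (cases g)
    case (UK k) then show ?thesis using d by (auto simp: contra_mat_def mat_def delta_def)
  next
    case (UKinv k) then show ?thesis using d by (auto simp: contra_mat_def mat_def delta_def)
  next
    case (UE k)
    then have "k \<in> L" using assms by (auto simp: uq_gens_def)
    from contra_mat_E[OF this len] UE show ?thesis
      by (simp add: plus_free_monoid_def gen_def mat_def)
  next
    case (UF k)
    then have k: "k \<in> L" using assms by (auto simp: uq_gens_def)
    have "tens (UK k) (delta js) = (\<lambda>ks. kaps k js * delta js ks)" by (auto simp: fun_eq_iff delta_def)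
    moreover have "contra_mat [UF k] is js = - (kaps k js * mat [UF k] is js)"
      using contra_mat_F[OF k len] by (simp add: mult.commute)
    ultimately show ?thesis
      using UF by (simp add: plus_free_monoid_def gen_def mat_def tens_scale)
  qed
qed

text \<open>Both families agree on single generators and satisfy the same reversed recursion in the
  word.\<close>

lemma contra_mat_antipode_mat:
  assumes "set y \<subseteq> G" "is \<in> idx_lists l" "js \<in> idx_lists l"
  shows "contra_mat y is js = antipode_mat y is js"
  using assms(1,3)
proof (induction y arbitrary: js)
  case Nil then show ?case by (simp add: contra_mat_Nil antipode_mat_def mat_Nil zero_free_monoid_def)
next
  case (Cons g y)
  show ?case
    unfolding contra_mat_Cons[OF Cons.prems(1) assms(2) Cons.prems(2)] antipode_mat_Cons[OF Cons.prems(1) assms(2)]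
    using Cons by (simp add: contra_mat_gen)
qed

definition neg_rev_word :: "(int \<times> int) list \<Rightarrow> (int \<times> int) list" where
  "neg_rev_word u = rev (map (\<lambda>(i, j). (- j, - i)) u)"

lemma rows_neg_rev_word: "rows (neg_rev_word u) = neg_rev (cols u)" "cols (neg_rev_word u) = neg_rev (rows u)"
  by (auto simp: rows_def cols_def neg_rev_word_def neg_rev_def rev_map case_prod_unfold)

fun antipode_coeff :: "(int \<times> int) list \<Rightarrow> 'k" where
  "antipode_coeff [] = 1"
| "antipode_coeff ((i, j) # u) = koszul (tdeg n (i, j)) (wdeg (tdeg n) (FM u)) * (koszul (eta n i) (eta n j) * (th i * cc (- j))) * antipode_coeff u"

lemma spo_antipode_eq:
  "spo_antipode n q (i, j) = scal (koszul (eta n i) (eta n j) * (th i * cc (- j))) (gen (- j, - i))"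
  unfolding koszul_th by (simp add: spo_antipode_def)

lemma list_antipode_t: "list_antipode (tdeg n) (spo_antipode n q) u = Poly_Mapping.single (FM (neg_rev_word u)) (antipode_coeff u)"
proof (induction u)
  case Nil then show ?case by (metis FM_Nil antipode_coeff.simps(1) list.simps(8) list_antipode.simps(1) rev.simps(1) single_one neg_rev_word_def)
next
  case (Cons x u)
  then show ?case
    by (cases x) (simp add: spo_antipode_eq gen_def mult_single plus_free_monoid_def neg_rev_word_def mult_ac)
qed

text \<open>The signs of the graded antipode and those of the reversed word combine to a single
  Koszul sign of the total row and column parities.\<close>

lemma antipode_coeff_word_sign: "antipode_coeff u * word_sign (neg_rev_word u) = word_sign u * (koszul (etas (rows u)) (etas (cols u)) * (ths (rows u) * ccs (cols u)))"
proof (induction u)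
  case Nil then show ?case by (simp add: neg_rev_word_def)
next
  case (Cons x u)
  obtain i j where x: "x = (i, j)" by fastforce
  have t: "tdeg n (a, b) = eta n b + eta n a" for a b by (simp add: tdeg_def)
  have s: "neg_rev_word (x # u) = neg_rev_word u @ [(- j, - i)]" by (simp add: neg_rev_word_def x)
  have "antipode_coeff (x # u) * word_sign (neg_rev_word (x # u)) = koszul (eta n j + eta n i) (etas (rows u) + etas (cols u)) * koszul (eta n i) (eta n j)
     * koszul (eta n i + eta n j) (etas (cols u)) * (th i * cc (- j)) * (antipode_coeff u * word_sign (neg_rev_word u))"
    unfolding s word_sign_append by (simp add: x wdeg_tdeg t rows_neg_rev_word mult_ac)
  also have "\<dots> = word_sign (x # u) * (koszul (etas (rows (x # u))) (etas (cols (x # u))) * (ths (rows (x # u)) * ccs (cols (x # u))))"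
    unfolding Cons x
    by (simp add: wdeg_tdeg, cases "eta n i"; cases "eta n j"; cases "etas (rows u)"; cases "etas (cols u)")
      (simp_all add: koszul_def)
  finally show ?case .
qed

lemma word_form_antipode:
  assumes "set u \<subseteq> T" "set y \<subseteq> G"
  shows "ev (\<lambda>w. word_form w (FM y)) (list_antipode (tdeg n) (spo_antipode n q) u) =
    ev (word_form (FM u)) (list_antipode (uq_deg n) uq_antipode y)"
proof -
  have "ev (\<lambda>w. word_form w (FM y)) (list_antipode (tdeg n) (spo_antipode n q) u) =
    (antipode_coeff u * word_sign (neg_rev_word u)) * mat y (neg_rev (cols u)) (neg_rev (rows u))"
    unfolding list_antipode_t by (simp add: word_form_def rows_neg_rev_word mult.assoc)
  also have "\<dots> = word_sign u * contra_mat y (rows u) (cols u)"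
    unfolding antipode_coeff_word_sign contra_mat_def by (simp add: mult.assoc)
  also have "\<dots> = word_sign u * antipode_mat y (rows u) (cols u)"
    using contra_mat_antipode_mat[OF assms(2), of "rows u" "length u" "cols u"] rows_cols_idx_lists[OF assms(1)] by simp
  also have "\<dots> = ev (word_form (FM u)) (list_antipode (uq_deg n) uq_antipode y)"
    unfolding antipode_mat_def ev_fun_mult[symmetric] word_form_def by simp
  finally show ?thesis .
qed

section \<open>The relations of the quantum superalgebra\<close>

definition qform :: "nat \<Rightarrow> nat \<Rightarrow> 'k" where
  "qform j k = q powi (form n m (sroot j) (sroot k))"

definition qformi :: "nat \<Rightarrow> nat \<Rightarrow> 'k" where
  "qformi j k = q powi (- form n m (sroot j) (sroot k))"

lemma qform_simps [simp]: "qform j k * qformi j k = 1" "qformi j k * qform j k = 1"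
  "qform j k * (qformi j k * x) = x" "qformi j k * (qform j k * x) = x"
  using q0 by (simp_all add: qform_def qformi_def power_int_minus)

lemma qform_commute: "qform j k = qform k j" "qformi j k = qformi k j"
  by (simp_all add: qform_def qformi_def form_commute)

text \<open>Keeping the factor \<open>ec\<close> or \<open>fc\<close> on both sides makes the weight
  and parity rules unconditional, so they can be used as rewriting rules inside products.\<close>

lemma weights:
  assumes "k \<in> L"
  shows "ec k i * kap j i = ec k i * (qform j k * kap j (i + step k))"
    "ec k i * kapi j i = ec k i * (qformi j k * kapi j (i + step k))"
    "fc k i * kap j i = fc k i * (qformi j k * kap j (i - step k))"
    "fc k i * kapi j i = fc k i * (qform j k * kapi j (i - step k))"
    "ec k i * koszul (rdeg n j) (eta n (i + step k)) = ec k i * (koszul (rdeg n j) (rdeg n k) * koszul (rdeg n j) (eta n i))"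
    "fc k i * koszul (rdeg n j) (eta n i) = fc k i * (koszul (rdeg n j) (rdeg n k) * koszul (rdeg n j) (eta n (i - step k)))"
proof -
  have k: "k \<ge> 1" using assms by simp
  show "ec k i * kap j i = ec k i * (qform j k * kap j (i + step k))"
    "ec k i * kapi j i = ec k i * (qformi j k * kapi j (i + step k))"
    using kap_ec[OF k, of i j] by (auto simp: qform_def qformi_def)
  show "fc k i * kap j i = fc k i * (qformi j k * kap j (i - step k))"
    "fc k i * kapi j i = fc k i * (qform j k * kapi j (i - step k))"
    using kap_fc[OF k, of i j] by (auto simp: qform_def qformi_def)
  show "ec k i * koszul (rdeg n j) (eta n (i + step k)) = ec k i * (koszul (rdeg n j) (rdeg n k) * koszul (rdeg n j) (eta n i))"
    using eta_ec[OF assms, of i] by (cases "ec k i = 0") (simp_all add: koszul_add_right)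
  show "fc k i * koszul (rdeg n j) (eta n i) = fc k i * (koszul (rdeg n j) (rdeg n k) * koszul (rdeg n j) (eta n (i - step k)))"
    using eta_fc[OF assms, of i] by (cases "fc k i = 0") (simp_all add: koszul_add_right)
qed

lemma tens_E_kapis:
  assumes "k \<in> L"
  shows "tens (UE k) (\<lambda>ks. kapis j ks * h ks) is = qform j k * (kapis j is * tens (UE k) h is)"
proof (induction "is" arbitrary: h)
  case (Cons i "is")
  have 1: "tens (UE k) (\<lambda>ks. kapis j (i # ks) * h (i # ks)) is = kapi j i * (qform j k * (kapis j is * tens (UE k) (\<lambda>ks. h (i # ks)) is))"
    using Cons.IH[of "\<lambda>ks. h (i # ks)"] by (simp add: mult.assoc tens_scale)
  have "ec k i * kapi j (i + step k) = qform j k * (qformi j k * (ec k i * kapi j (i + step k)))"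
    by (simp only: qform_simps)
  also have "\<dots> = qform j k * (ec k i * kapi j i)"
    unfolding weights(2)[OF assms] by (simp only: mult_ac)
  finally have 2: "ec k i * kapi j (i + step k) = qform j k * (ec k i * kapi j i)" .
  have "tens (UE k) (\<lambda>ks. kapis j ks * h ks) (i # is) =
      (ec k i * kapi j (i + step k)) * (kapis j is * h ((i + step k) # is))
      + koszul (rdeg n k) (eta n i) * kap k i * (kapi j i * (qform j k * (kapis j is * tens (UE k) (\<lambda>ks. h (i # ks)) is)))"
    unfolding 1[symmetric] by (simp add: mult_ac)
  also have "\<dots> = qform j k * (kapis j (i # is) * tens (UE k) h (i # is))"
    unfolding 2 by (simp add: algebra_simps)
  finally show ?case .
qed simp

lemma tens_F_kapis:
  assumes "k \<in> L"
  shows "tens (UF k) (\<lambda>ks. kapis j ks * h ks) is = qformi j k * (kapis j is * tens (UF k) h is)"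
proof (induction "is" arbitrary: h)
  case (Cons i "is")
  have 1: "tens (UF k) (\<lambda>ks. kapis j (i # ks) * h (i # ks)) is = kapi j i * (qformi j k * (kapis j is * tens (UF k) (\<lambda>ks. h (i # ks)) is))"
    using Cons.IH[of "\<lambda>ks. h (i # ks)"] by (simp add: mult.assoc tens_scale)
  have "fc k i * kapi j (i - step k) = qformi j k * (qform j k * (fc k i * kapi j (i - step k)))"
    by (simp only: qform_simps)
  also have "\<dots> = qformi j k * (fc k i * kapi j i)"
    unfolding weights(4)[OF assms] by (simp only: mult_ac)
  finally have 2: "fc k i * kapi j (i - step k) = qformi j k * (fc k i * kapi j i)" .
  have "tens (UF k) (\<lambda>ks. kapis j ks * h ks) (i # is) =
      (fc k i * kapi j (i - step k)) * (kapis j is * kapis k is * h ((i - step k) # is))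
      + koszul (rdeg n k) (eta n i) * (kapi j i * (qformi j k * (kapis j is * tens (UF k) (\<lambda>ks. h (i # ks)) is)))"
    unfolding 1[symmetric] by (simp add: mult_ac)
  also have "\<dots> = qformi j k * (kapis j (i # is) * tens (UF k) h (i # is))"
    unfolding 2 by (simp add: algebra_simps)
  finally show ?case .
qed simp

text \<open>Induction on the number of tensor factors. The mixed terms cancel, and the two remaining
  commutators combine by \<open>K \<otimes> K - K' \<otimes> K' = (K - K') \<otimes> K' + K
  \<otimes> (K - K')\<close>, with K' the inverse of K.\<close>

lemma tens_E_F:
  assumes j: "j \<in> L" and k: "k \<in> L"
  shows "tens (UE j) (tens (UF k) f) is - koszul (rdeg n j) (rdeg n k) * tens (UF k) (tens (UE j) f) is
    = (if j = k then inverse (qj q j - inverse (qj q j)) * (kaps j is - kapis j is) * f is else 0)"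
proof (induction "is" arbitrary: f)
  case (Cons i "is")
  let ?s = "koszul (rdeg n j) (rdeg n k) :: 'k" and ?K = "\<lambda>j i. koszul (rdeg n j) (eta n i) :: 'k"
  let ?f = "\<lambda>i ks. f (i # ks)"
  let ?EF = "tens (UE j) (tens (UF k) (?f i)) is" and ?FE = "tens (UF k) (tens (UE j) (?f i)) is"
  have F: "tens (UF k) f (i # ks) = fc k i * (kapis k ks * ?f (i - step k) ks) + ?K k i * tens (UF k) (?f i) ks" for ks
    by (simp add: mult.assoc)
  have E: "tens (UE j) f (i # ks) = ec j i * ?f (i + step j) ks + ?K j i * kap j i * tens (UE j) (?f i) ks" for ks
    by simp
  have lin: "tens g (\<lambda>ks. a * u ks + b * v ks) is = a * tens g u is + b * tens g v is" for g a b u v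
    by (simp add: tens_add tens_scale)
  have EF: "tens (UE j) (tens (UF k) f) (i # is) =
    ec j i * (fc k (i + step j) * (kapis k is * ?f (i + step j - step k) is) + ?K k (i + step j) * tens (UF k) (?f (i + step j)) is)
    + ?K j i * kap j i * (fc k i * (qform k j * (kapis k is * tens (UE j) (?f (i - step k)) is)) + ?K k i * ?EF)"
    unfolding tens.simps(5)[of j "tens (UF k) f"] F lin tens_E_kapis[OF j] by (simp add: mult.assoc)
  have FE: "tens (UF k) (tens (UE j) f) (i # is) =
    fc k i * kapis k is * (ec j (i - step k) * ?f (i - step k + step j) is + ?K j (i - step k) * kap j (i - step k) * tens (UE j) (?f (i - step k)) is)
    + ?K k i * (ec j i * tens (UF k) (?f (i + step j)) is + ?K j i * kap j i * ?FE)"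
    unfolding tens.simps(6)[of k "tens (UE j) f"] E lin by simp
  \<comment> \<open>\<open>A2\<close> and \<open>A3\<close> are the cancellations of the mixed
    terms: \<open>E_j\<close> on one part and \<open>F_k\<close> on the other commute up to the
    Koszul sign.\<close>
  have A2: "ec j i * ?K k (i + step j) = ec j i * (?s * ?K k i)"
    using weights(5)[OF j, of i k] by (simp add: koszul_comm)
  have "fc k i * (?K j i * kap j i) = (fc k i * ?K j i) * kap j i" by (simp only: mult.assoc)
  also have "\<dots> = (?s * ?K j (i - step k)) * (fc k i * kap j i)"
    unfolding weights(6)[OF k] by (simp only: mult_ac)
  also have "\<dots> = (?s * ?K j (i - step k)) * (fc k i * (qformi j k * kap j (i - step k)))"
    unfolding weights(3)[OF k] ..
  finally have "fc k i * (?K j i * kap j i) * qform k j =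
      (qformi j k * qform j k) * (fc k i * (?s * (?K j (i - step k) * kap j (i - step k))))"
    unfolding qform_commute(1)[of k j] by (simp only: mult_ac)
  then have A3: "fc k i * (?K j i * kap j i) * qform k j = fc k i * (?s * (?K j (i - step k) * kap j (i - step k)))"
    by simp
  have "tens (UE j) (tens (UF k) f) (i # is) - ?s * tens (UF k) (tens (UE j) f) (i # is) =
    kapis k is * (ec j i * (fc k (i + step j) * ?f (i + step j - step k) is) - ?s * (fc k i * (ec j (i - step k) * ?f (i - step k + step j) is)))
    + (ec j i * ?K k (i + step j) - ec j i * (?s * ?K k i)) * tens (UF k) (?f (i + step j)) is
    + (fc k i * (?K j i * kap j i) * qform k j - fc k i * (?s * (?K j (i - step k) * kap j (i - step k)))) * (kapis k is * tens (UE j) (?f (i - step k)) is)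
    + ?K j i * ?K k i * kap j i * (?EF - ?s * ?FE)"
    unfolding EF FE by (simp only: algebra_simps)
  also have "\<dots> = kapis k is * (if j = k then inverse (qj q j - inverse (qj q j)) * (kap j i - kapi j i) * ?f i is else 0)
    + ?K j i * ?K k i * kap j i * (if j = k then inverse (qj q j - inverse (qj q j)) * (kaps j is - kapis j is) * ?f i is else 0)"
    unfolding A2 A3 ec_fc_comm[OF j k, of i "\<lambda>x. ?f x is"] Cons.IH by simp
  also have "\<dots> = (if j = k then inverse (qj q j - inverse (qj q j)) * (kaps j (i # is) - kapis j (i # is)) * f (i # is) else 0)"
    by (simp add: algebra_simps)
  finally show ?case .
qed simp

lemma ev_utilde_rels:
  assumes "r \<in> utilde_rels n m q"
  shows "ev (\<lambda>w. foldr tens (letters w) f is) r = 0"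
proof -
  obtain j k where jk: "j \<in> L" "k \<in> L" and r: "r \<in>
     {gen (UK j) * gen (UK k) - gen (UK k) * gen (UK j),
      gen (UK j) * gen (UKinv k) - gen (UKinv k) * gen (UK j),
      gen (UKinv j) * gen (UKinv k) - gen (UKinv k) * gen (UKinv j),
      gen (UK j) * gen (UKinv j) - 1,
      gen (UK j) * gen (UE k) * gen (UKinv j) - scal (q powi (form n m (sroot j) (sroot k))) (gen (UE k)),
      gen (UK j) * gen (UF k) * gen (UKinv j) - scal (q powi (- form n m (sroot j) (sroot k))) (gen (UF k)),
      gen (UE j) * gen (UF k) - scal (koszul (rdeg n j) (rdeg n k)) (gen (UF k) * gen (UE j))
        - (if j = k then scal (inverse (qj q j - inverse (qj q j))) (gen (UK j) - gen (UKinv j)) else 0)}"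
    using assms unfolding utilde_rels_def by blast
  have K: "tens (UK j) f = (\<lambda>ks. kaps j ks * f ks)" "tens (UKinv j) f = (\<lambda>ks. kapis j ks * f ks)" for j f
    by auto
  have c: "kaps j is * (kapis j is * x) = x" for j x by (simp add: mult.assoc[symmetric])
  have "ev (\<lambda>w. foldr tens (letters w) f is) (gen (UE j) * gen (UF k) - scal (koszul (rdeg n j) (rdeg n k)) (gen (UF k) * gen (UE j))
        - (if j = k then scal (inverse (qj q j - inverse (qj q j))) (gen (UK j) - gen (UKinv j)) else 0)) = 0"
    using tens_E_F[OF jk, of f "is"] by (simp add: plus_free_monoid_def algebra_simps)
  moreover have "kaps j is * (qform j k * (kapis j is * x)) = qform j k * x"
    "kaps j is * (qformi j k * (kapis j is * x)) = qformi j k * x" for x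
    by (simp_all add: c mult.left_commute[of "kaps j is"])
  ultimately show ?thesis
    using r jk by (auto simp: plus_free_monoid_def zero_free_monoid_def K tens_E_kapis tens_F_kapis c mult.left_commute
        simp flip: qform_def qformi_def)
qed

section \<open>Matrix coefficients of raising and lowering operators\<close>

abbreviation "ch \<equiv> serre_char n m q"
abbreviation "skew \<equiv> skew_functional ch L"

definition ch_inv :: "nat \<Rightarrow> nat \<Rightarrow> 'k" where
  "ch_inv k j = koszul (rdeg n k) (rdeg n j) * qformi k j"

lemma ch_eq: "ch k j = koszul (rdeg n k) (rdeg n j) * qform k j"
  by (simp add: serre_char_def qform_def)

lemma ch_inv: "ch_inv k j * ch j k = 1"
  by (simp add: ch_inv_def ch_eq koszul_comm[of "rdeg n j"] qform_commute[of j] mult_ac)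

definition AE :: "nat \<Rightarrow> (int \<Rightarrow> 'k) \<Rightarrow> int \<Rightarrow> 'k" where "AE j f = (\<lambda>i. ec j i * f (i + step j))"
definition AF :: "nat \<Rightarrow> (int \<Rightarrow> 'k) \<Rightarrow> int \<Rightarrow> 'k" where "AF j f = (\<lambda>i. fc j i * f (i - step j))"
definition unit :: "int \<Rightarrow> int \<Rightarrow> 'k" where "unit a = (\<lambda>i. if i = a then 1 else 0)"

lemma foldr_scale:
  assumes "\<And>j c f. A j (\<lambda>i. c * f i) = (\<lambda>i. c * A j f i)"
  shows "foldr A w (\<lambda>i. c * f i) = (\<lambda>i. c * foldr A w f i :: 'k)"
  by (induction w) (simp_all add: assms)

text \<open>If all operators kill \<open>f\<close>, only the empty word contributes, and the
  coefficient is a multiple of the constant term functional.\<close>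

lemma skew_initial:
  assumes "\<And>j. j \<in> L \<Longrightarrow> A j f = (\<lambda>i. 0)" "\<And>j c f. A j (\<lambda>i. c * f i) = (\<lambda>i. c * A j f i)"
  shows "skew (\<lambda>w. foldr A w f i)"
proof -
  have 0: "foldr A w (\<lambda>i. 0) = (\<lambda>i. 0)" for w using foldr_scale[of A w 0 "\<lambda>_. 0"] assms(2) by simp
  have "foldr A w f i = f i * (if w = [] then 1 else 0)" if "set w \<subseteq> L" for w
    using that by (cases w rule: rev_cases) (simp_all add: assms(1) 0)
  then show ?thesis by (intro skew_functional.cong[OF skew_functional.scale[OF skew_functional.empty]])
qed

text \<open>Every \<open>E_j\<close> lowers the index, so the vector with the smallest index is
  killed. Any other basis vector is a multiple of \<open>F_k\<close> applied to its predecessor, and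
  the commutator formula expresses its coefficients by derivatives of those of the
  predecessor.\<close>

lemma skew_E_vector:
  assumes "a \<in> I"
  shows "skew (\<lambda>w. foldr AE w (unit a) i)"
  using assms
proof (induction "nat (a + int (n + m))" arbitrary: a i rule: less_induct)
  case less
  have sc: "AE j (\<lambda>i. c * f i) = (\<lambda>i. c * AE j f i)" for j c f by (auto simp: AE_def)
  show ?case
  proof (cases "a = - int (n + m)")
    case True
    have "AE j (unit a) = (\<lambda>i. 0)" if "j \<in> L" for j
    proof
      fix i show "AE j (unit a) i = 0"
        using ec_idx(1)[OF that, of i] True by (cases "ec j i = 0") (auto simp: AE_def unit_def idx_def step_def)
    qed
    from skew_initial[where A = AE, OF this sc] show ?thesis by simp
  next
    case False
    \<comment> \<open>The generator whose F raises the preceding index to \<open>a\<close>: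
      \<open>F_1\<close> across 0, \<open>F_a\<close> for positive \<open>a\<close>, and
      \<open>F_{1-a}\<close> for negative \<open>a\<close>.\<close>
    define k where "k = nat (if a = 1 then 1 else if a > 0 then a else 1 - a)"
    have k: "k \<in> L" "fc k a \<noteq> 0" using less.prems False by (auto simp: k_def idx_def fc_def sig_def)
    let ?b = "a - step k"
    have b: "?b \<in> I" "nat (?b + int (n + m)) < nat (a + int (n + m))"
      using fc_idx[OF k] by (auto simp: idx_def step_def split: if_splits)
    have IH: "skew (\<lambda>w. foldr AE w (unit ?b) i)" for i by (rule less.hyps[OF b(2,1)])
    let ?c = "inverse (qj q k - inverse (qj q k))"
    have lower: "AF k (unit ?b) = (\<lambda>i. fc k a * unit a i)" by (auto simp: AF_def unit_def)
    have comm: "foldr AE w (AF k (unit ?b)) i = prod_list (map (\<lambda>j. koszul (rdeg n j) (rdeg n k)) w) * AF k (foldr AE w (unit ?b)) i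
      + ?c * (pd ch k w (\<lambda>u. foldr AE u (\<lambda>i. kap k i * unit ?b i) i) - pd ch_inv k w (\<lambda>u. foldr AE u (\<lambda>i. kapi k i * unit ?b i) i))"
      if "set w \<subseteq> L" for w
    proof (rule foldr_commutator[where T = "\<lambda>k f i. kap k i * f i" and T' = "\<lambda>k f i. kapi k i * f i"
          and s = "\<lambda>j. koszul (rdeg n j) (rdeg n k)" and p = "\<lambda>j. qform k j" and p' = "\<lambda>j. qformi k j", OF _ _ _ _ _ _ that])
      show "AE j (\<lambda>i. f i + c * g i) = (\<lambda>i. AE j f i + c * AE j g i)" for j f g c by (auto simp: AE_def algebra_simps)
      show "AE j (AF k f) i = koszul (rdeg n j) (rdeg n k) * AF k (AE j f) i + (if j = k then ?c * (kap k i * f i - kapi k i * f i) else 0)"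
        if "j \<in> L" for j f i
        using ec_fc_comm[OF that k(1), of i f] by (auto simp: AE_def AF_def algebra_simps)
      show "(\<lambda>i. kap k i * AE j f i) = (\<lambda>i. qform k j * AE j (\<lambda>i. kap k i * f i) i)" if "j \<in> L" for j f
        using weights(1)[OF that, of _ k] by (simp add: AE_def fun_eq_iff mult_ac) (metis mult.assoc mult.commute)
      show "(\<lambda>i. kapi k i * AE j f i) = (\<lambda>i. qformi k j * AE j (\<lambda>i. kapi k i * f i) i)" if "j \<in> L" for j f
        using weights(2)[OF that, of _ k] by (simp add: AE_def fun_eq_iff mult_ac) (metis mult.assoc mult.commute)
      show "ch k j = koszul (rdeg n j) (rdeg n k) * qform k j" "ch_inv k j = koszul (rdeg n j) (rdeg n k) * qformi k j" for j
        by (simp_all add: ch_eq ch_inv_def koszul_comm)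
    qed
    have T: "(\<lambda>i. kap k i * unit ?b i) = (\<lambda>i. kap k ?b * unit ?b i)" "(\<lambda>i. kapi k i * unit ?b i) = (\<lambda>i. kapi k ?b * unit ?b i)"
      by (auto simp: unit_def)
    have "skew (\<lambda>w. inverse (fc k a) * (prod_list (map (\<lambda>j. koszul (rdeg n j) (rdeg n k)) w) * (fc k i * foldr AE w (unit ?b) (i - step k))
      + (?c * (kap k ?b * pd ch k w (\<lambda>u. foldr AE u (unit ?b) i)) + (- ?c) * (kapi k ?b * pd ch_inv k w (\<lambda>u. foldr AE u (unit ?b) i)))))"
      by (intro skew_functional.scale skew_functional.add skew_functional_twist skew_functional.deriv
          skew_functional_pd_inverse ch_inv IH k(1))
    then show ?thesis
    proof (rule skew_functional.cong)
      fix w assume w: "set w \<subseteq> L"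
      have "foldr AE w (unit a) i = inverse (fc k a) * foldr AE w (AF k (unit ?b)) i"
        unfolding lower foldr_scale[OF sc] using k by simp
      also have "foldr AE w (AF k (unit ?b)) i = prod_list (map (\<lambda>j. koszul (rdeg n j) (rdeg n k)) w) * (fc k i * foldr AE w (unit ?b) (i - step k))
      + (?c * (kap k ?b * pd ch k w (\<lambda>u. foldr AE u (unit ?b) i)) + (- ?c) * (kapi k ?b * pd ch_inv k w (\<lambda>u. foldr AE u (unit ?b) i)))"
        unfolding comm[OF w] T foldr_scale[OF sc] pd_scale by (simp add: AF_def algebra_simps)
      finally show "foldr AE w (unit a) i = inverse (fc k a) * (prod_list (map (\<lambda>j. koszul (rdeg n j) (rdeg n k)) w) * (fc k i * foldr AE w (unit ?b) (i - step k))
      + (?c * (kap k ?b * pd ch k w (\<lambda>u. foldr AE u (unit ?b) i)) + (- ?c) * (kapi k ?b * pd ch_inv k w (\<lambda>u. foldr AE u (unit ?b) i))))" .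
    qed
  qed
qed

text \<open>The mirror image, starting from the largest index and climbing down by
  \<open>E_k\<close>. Solving the commutation relation for \<open>F_j E_k\<close> exchanges
  \<open>K_k\<close> with its inverse, so the same factors \<open>ch\<close> occur as for the
  E's.\<close>

lemma skew_F_vector:
  assumes "a \<in> I"
  shows "skew (\<lambda>w. foldr AF w (unit a) i)"
  using assms
proof (induction "nat (int (n + m) - a)" arbitrary: a i rule: less_induct)
  case less
  have sc: "AF j (\<lambda>i. c * f i) = (\<lambda>i. c * AF j f i)" for j c f by (auto simp: AF_def)
  show ?case
  proof (cases "a = int (n + m)")
    case True
    have "AF j (unit a) = (\<lambda>i. 0)" if "j \<in> L" for j
    proof
      fix i show "AF j (unit a) i = 0"
        using fc_idx(1)[OF that, of i] True by (cases "fc j i = 0") (auto simp: AF_def unit_def idx_def step_def)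
    qed
    from skew_initial[where A = AF, OF this sc] show ?thesis by simp
  next
    case False
    define k where "k = nat (if a = - 1 then 1 else if a > 0 then a + 1 else - a)"
    have k: "k \<in> L" "ec k a \<noteq> 0" using less.prems False by (auto simp: k_def idx_def ec_def sig_def)
    let ?b = "a + step k"
    have b: "?b \<in> I" "nat (int (n + m) - ?b) < nat (int (n + m) - a)"
      using ec_idx[OF k] by (auto simp: idx_def step_def split: if_splits)
    have IH: "skew (\<lambda>w. foldr AF w (unit ?b) i)" for i by (rule less.hyps[OF b(2,1)])
    \<comment> \<open>The additional sign comes from multiplying the relation by the Koszul sign in
      order to isolate \<open>F_j E_k\<close>.\<close>
    let ?c = "koszul (rdeg n k) (rdeg n k) * inverse (qj q k - inverse (qj q k))"
    have lower: "AE k (unit ?b) = (\<lambda>i. ec k a * unit a i)" by (auto simp: AE_def unit_def)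
    have comm: "foldr AF w (AE k (unit ?b)) i = prod_list (map (\<lambda>j. koszul (rdeg n j) (rdeg n k)) w) * AE k (foldr AF w (unit ?b)) i
      + ?c * (pd ch k w (\<lambda>u. foldr AF u (\<lambda>i. kapi k i * unit ?b i) i) - pd ch_inv k w (\<lambda>u. foldr AF u (\<lambda>i. kap k i * unit ?b i) i))"
      if "set w \<subseteq> L" for w
    proof (rule foldr_commutator[where T = "\<lambda>k f i. kapi k i * f i" and T' = "\<lambda>k f i. kap k i * f i"
          and s = "\<lambda>j. koszul (rdeg n j) (rdeg n k)" and p = "\<lambda>j. qform k j" and p' = "\<lambda>j. qformi k j", OF _ _ _ _ _ _ that])
      show "AF j (\<lambda>i. f i + c * g i) = (\<lambda>i. AF j f i + c * AF j g i)" for j f g c by (auto simp: AF_def algebra_simps)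
      show "AF j (AE k f) i = koszul (rdeg n j) (rdeg n k) * AE k (AF j f) i + (if j = k then ?c * (kapi k i * f i - kap k i * f i) else 0)"
        if "j \<in> L" for j f i
        using arg_cong[OF ec_fc_comm[OF k(1) that, of i f], of "\<lambda>x. koszul (rdeg n k) (rdeg n j) * x"]
        by (auto simp: AE_def AF_def algebra_simps koszul_comm[of "rdeg n j"])
      show "(\<lambda>i. kapi k i * AF j f i) = (\<lambda>i. qform k j * AF j (\<lambda>i. kapi k i * f i) i)" if "j \<in> L" for j f
        using weights(4)[OF that, of _ k] by (simp add: AF_def fun_eq_iff mult_ac) (metis mult.assoc mult.commute)
      show "(\<lambda>i. kap k i * AF j f i) = (\<lambda>i. qformi k j * AF j (\<lambda>i. kap k i * f i) i)" if "j \<in> L" for j f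
        using weights(3)[OF that, of _ k] by (simp add: AF_def fun_eq_iff mult_ac) (metis mult.assoc mult.commute)
      show "ch k j = koszul (rdeg n j) (rdeg n k) * qform k j" "ch_inv k j = koszul (rdeg n j) (rdeg n k) * qformi k j" for j
        by (simp_all add: ch_eq ch_inv_def koszul_comm)
    qed
    have T: "(\<lambda>i. kap k i * unit ?b i) = (\<lambda>i. kap k ?b * unit ?b i)" "(\<lambda>i. kapi k i * unit ?b i) = (\<lambda>i. kapi k ?b * unit ?b i)"
      by (auto simp: unit_def)
    have "skew (\<lambda>w. inverse (ec k a) * (prod_list (map (\<lambda>j. koszul (rdeg n j) (rdeg n k)) w) * (ec k i * foldr AF w (unit ?b) (i + step k))
      + (?c * (kapi k ?b * pd ch k w (\<lambda>u. foldr AF u (unit ?b) i)) + (- ?c) * (kap k ?b * pd ch_inv k w (\<lambda>u. foldr AF u (unit ?b) i)))))"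
      by (intro skew_functional.scale skew_functional.add skew_functional_twist skew_functional.deriv
          skew_functional_pd_inverse ch_inv IH k(1))
    then show ?thesis
    proof (rule skew_functional.cong)
      fix w assume w: "set w \<subseteq> L"
      have "foldr AF w (unit a) i = inverse (ec k a) * foldr AF w (AE k (unit ?b)) i"
        unfolding lower foldr_scale[OF sc] using k by simp
      also have "foldr AF w (AE k (unit ?b)) i = prod_list (map (\<lambda>j. koszul (rdeg n j) (rdeg n k)) w) * (ec k i * foldr AF w (unit ?b) (i + step k))
      + (?c * (kapi k ?b * pd ch k w (\<lambda>u. foldr AF u (unit ?b) i)) + (- ?c) * (kap k ?b * pd ch_inv k w (\<lambda>u. foldr AF u (unit ?b) i)))"
        unfolding comm[OF w] T foldr_scale[OF sc] pd_scale by (simp add: AE_def algebra_simps)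
      finally show "foldr AF w (unit a) i = inverse (ec k a) * (prod_list (map (\<lambda>j. koszul (rdeg n j) (rdeg n k)) w) * (ec k i * foldr AF w (unit ?b) (i + step k))
      + (?c * (kapi k ?b * pd ch k w (\<lambda>u. foldr AF u (unit ?b) i)) + (- ?c) * (kap k ?b * pd ch_inv k w (\<lambda>u. foldr AF u (unit ?b) i))))" .
    qed
  qed
qed

text \<open>Splitting off the first tensor factor gives the shape
  \<open>E \<otimes> 1 + K \<otimes> E\<close> of the two-slot lemma; \<open>?t\<close> is the
  eigenvalue of \<open>K_j\<close> with the sign of moving \<open>E_j\<close> past
  \<open>e_i\<close>.\<close>

lemma skew_E_tens:
  assumes "set is \<subseteq> I"
  shows "skew (\<lambda>w. foldr (\<lambda>j. tens (UE j)) w f is)"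
  using assms
proof (induction "is" arbitrary: f)
  case Nil
  have "foldr (\<lambda>j. tens (UE j)) w f [] = f [] * (if w = [] then 1 else 0)" for w
    by (cases w) simp_all
  then show ?case by (simp add: skew_functional.scale skew_functional.empty)
next
  case (Cons i "is")
  let ?t = "\<lambda>j i. koszul (rdeg n j) (eta n i) * kap j i"
  define P where "P = (\<lambda>j g (i, x). AE j (\<lambda>a. g (a, x)) i + ?t j i * tens (UE j) (\<lambda>y. g (i, y)) x)"
  have "foldr (\<lambda>j. tens (UE j)) w f (i # is) = foldr P w (\<lambda>(a, y). f (a # y)) (i, is)" for w i "is"
    by (induction w arbitrary: i "is") (simp_all add: P_def AE_def)
  moreover have "skew (\<lambda>w. foldr P w (\<lambda>(a, y). f (a # y)) (i, is))"
  proof (rule two_slot_skew_functional[where S = I and A = AE and R = "\<lambda>j. tens (UE j)" and t = ?t, folded unit_def])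
    show "AE j f i = (\<Sum>a\<in>I. AE j (unit a) i * f a)" if "j \<in> L" for j f i
    proof -
      have "(\<Sum>a\<in>I. AE j (unit a) i * f a) = (\<Sum>a\<in>I. if a = i + step j then ec j i * f a else 0)"
        by (intro sum.cong) (auto simp: AE_def unit_def)
      also have "\<dots> = AE j f i" using ec_idx(2)[OF that, of i] by (auto simp: AE_def)
      finally show ?thesis ..
    qed
    show "?t j' i = ?t j' a * ch j' j" if "j \<in> L" "AE j (unit a) i \<noteq> 0" for j j' i a
    proof -
      have e: "ec j i \<noteq> 0" "a = i + step j" using that(2) by (auto simp: AE_def unit_def split: if_splits)
      then show ?thesis
        using kap_ec(1)[of j i j'] eta_ec[OF that(1) e(1)] that(1)
        by (simp add: ch_eq koszul_add_right qform_def mult_ac)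
    qed
    show "i \<in> I" "skew (\<lambda>w. foldr (\<lambda>j. tens (UE j)) w f is)" for f using Cons by simp_all
    show "skew (\<lambda>w. foldr AE w (unit a) i)" if "a \<in> I" for i a by (rule skew_E_vector[OF that])
  qed (simp_all add: tens_linear P_def)
  ultimately show ?case by simp
qed

lemma tens_F_parity: "k \<in> L \<Longrightarrow> tens (UF k) (\<lambda>ks. koszul (etas ks) \<beta> * h ks) is =
    koszul (etas is + rdeg n k) \<beta> * tens (UF k) h is"
proof (induction "is" arbitrary: h)
  case (Cons i "is")
  have "tens (UF k) (\<lambda>ks. koszul (etas (i # ks)) \<beta> * h (i # ks)) is =
    koszul (eta n i) \<beta> * (koszul (etas is + rdeg n k) \<beta> * tens (UF k) (\<lambda>ks. h (i # ks)) is)"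
    using Cons.IH[of "\<lambda>ks. h (i # ks)"] Cons.prems by (simp add: koszul_add_left mult.assoc tens_scale)
  moreover have "fc k i * koszul (eta n (i - step k)) \<beta> = fc k i * (koszul (eta n i) \<beta> * koszul (rdeg n k) \<beta>)"
  proof (cases "fc k i = 0")
    case False
    from eta_fc[OF Cons.prems this] have "eta n (i - step k) = eta n i + rdeg n k" by (simp add: ac_simps)
    then show ?thesis by (simp add: koszul_add_left)
  qed simp
  ultimately show ?case by (simp add: koszul_add_left algebra_simps)
    (metis (no_types, lifting) mult.assoc mult.left_commute)
qed simp

text \<open>The coproduct of \<open>F_j\<close> has its Cartan factor on the right, so the last
  tensor factor is split off and brought to the front; there it plays the role that the first factor
  has for the E's.\<close>

lemma skew_F_tens:
  assumes "set is \<subseteq> I"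
  shows "skew (\<lambda>w. foldr (\<lambda>j. tens (UF j)) w f is)"
  using assms
proof (induction "is" arbitrary: f rule: rev_induct)
  case Nil
  have "foldr (\<lambda>j. tens (UF j)) w f [] = f [] * (if w = [] then 1 else 0)" for w
    by (cases w) simp_all
  then show ?case by (simp add: skew_functional.scale skew_functional.empty)
next
  case (snoc i "is")
  \<comment> \<open>the sign \<open>koszul (etas x) (eta n i)\<close> of the flip moves the last tensor factor to the front\<close>
  let ?t = "\<lambda>j i. koszul (rdeg n j) (eta n i) * kapi j i"
  let ?g = "\<lambda>f (a, y). koszul (etas y) (eta n a) * f (y @ [a])"
  define P where "P = (\<lambda>j g (i, x). AF j (\<lambda>a. g (a, x)) i + ?t j i * tens (UF j) (\<lambda>y. g (i, y)) x)"
  have step: "?g (tens (UF j) h) (i, x) = P j (?g h) (i, x)" if j: "j \<in> L" for j h i x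
  proof -
    have w: "fc j i * koszul (etas x) (eta n (i - step j)) = fc j i * (koszul (etas x) (eta n i) * koszul (rdeg n j) (etas x))"
    proof (cases "fc j i = 0")
      case False
      from eta_fc[OF j this] have "eta n (i - step j) = eta n i + rdeg n j" by (simp add: ac_simps)
      then show ?thesis by (simp add: koszul_add_right koszul_comm)
    qed simp
    have "P j (?g h) (i, x) = (fc j i * koszul (etas x) (eta n (i - step j))) * h (x @ [i - step j])
      + ?t j i * (koszul (etas x + rdeg n j) (eta n i) * tens (UF j) (\<lambda>y. h (y @ [i])) x)"
      by (simp add: P_def AF_def tens_F_parity[OF j] mult.assoc)
    then show ?thesis
      unfolding w by (simp add: tens_F_snoc koszul_add_left algebra_simps)
  qed
  have P: "?g (foldr (\<lambda>j. tens (UF j)) w f) = foldr P w (?g f)" if "set w \<subseteq> L" for w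
    using that
  proof (induction w)
    case (Cons j w)
    have "?g (foldr (\<lambda>j. tens (UF j)) (j # w) f) = P j (?g (foldr (\<lambda>j. tens (UF j)) w f))"
      using step[of j "foldr (\<lambda>j. tens (UF j)) w f"] Cons.prems by (auto simp: fun_eq_iff)
    then show ?case using Cons by simp
  qed simp
  have last: "foldr (\<lambda>j. tens (UF j)) w f (is @ [i]) = koszul (etas is) (eta n i) * foldr P w (?g f) (i, is)" if "set w \<subseteq> L" for w
    using fun_cong[OF P[OF that], of "(i, is)"] by (simp flip: P[OF that])
  have "skew (\<lambda>w. foldr P w (?g f) (i, is))"
  proof (rule two_slot_skew_functional[where S = I and A = AF and R = "\<lambda>j. tens (UF j)" and t = ?t, folded unit_def])
    show "AF j f i = (\<Sum>a\<in>I. AF j (unit a) i * f a)" if "j \<in> L" for j f i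
    proof -
      have "(\<Sum>a\<in>I. AF j (unit a) i * f a) = (\<Sum>a\<in>I. if a = i - step j then fc j i * f a else 0)"
        by (intro sum.cong) (auto simp: AF_def unit_def)
      also have "\<dots> = AF j f i" using fc_idx(2)[OF that, of i] by (auto simp: AF_def)
      finally show ?thesis ..
    qed
    show "?t j' i = ?t j' a * ch j' j" if "j \<in> L" "AF j (unit a) i \<noteq> 0" for j j' i a
    proof -
      have e: "fc j i \<noteq> 0" "a = i - step j" using that(2) by (auto simp: AF_def unit_def split: if_splits)
      then show ?thesis
        using kap_fc(2)[of j i j'] eta_fc[OF that(1) e(1)] that(1)
        by (simp add: ch_eq koszul_add_right qform_def mult_ac)
    qed
    show "i \<in> I" "skew (\<lambda>w. foldr (\<lambda>j. tens (UF j)) w f is)" for f using snoc by simp_all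
    show "skew (\<lambda>w. foldr AF w (unit a) i)" if "a \<in> I" for i a by (rule skew_F_vector[OF that])
  qed (simp_all add: tens_linear P_def)
  then have "skew (\<lambda>w. koszul (etas is) (eta n i) * foldr P w (?g f) (i, is))"
    by (rule skew_functional.scale)
  then show ?case by (rule skew_functional.cong) (rule last)
qed

lemma ev_uq_rels:
  assumes "r \<in> uq_rels n m q" "set is \<subseteq> I"
  shows "ev (\<lambda>w. foldr tens (letters w) f is) r = 0"
proof -
  have "ev (\<lambda>w. foldr tens (letters w) f is) (subst_gens g x) = 0"
    if x: "x \<in> serre_space n m q" and g: "skew (\<lambda>w. foldr (\<lambda>j. tens (g j)) w f is)" for g x
  proof -
    have "foldr tens (map g w) f = foldr (\<lambda>j. tens (g j)) w f" for w by (induction w) simp_all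
    then show ?thesis using ev_serre_space[OF q0 g x] by (simp add: ev_subst_gens)
  qed
  then show ?thesis
    using assms ev_utilde_rels skew_E_tens[OF assms(2)] skew_F_tens[OF assms(2)] unfolding uq_rels_def by blast
qed

section \<open>The R-matrix intertwines the action on the tensor square\<close>

text \<open>The Cartan part of R: this is \<open>q\<close> to the power (\<epsilon>_x,
  \<epsilon>_y).\<close>

definition R_diag :: "int \<Rightarrow> int \<Rightarrow> 'k" where
  "R_diag x y = (if x = y then q powi (sig n x x) else if x = - y then q powi (- sig n x x) else 1)"

definition q_diff :: 'k where "q_diff = q - inverse q"

text \<open>The contraction with C, cut off below \<open>t\<close>; the last family of terms of R
  produces such cut-off contractions.\<close>

definition partial_contr :: "int \<Rightarrow> (int \<Rightarrow> int \<Rightarrow> 'k) \<Rightarrow> 'k" where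
  "partial_contr t f = (\<Sum>y\<in>{y \<in> I. y < t}. cc y * f y (- y))"

text \<open>The operator \<open>R\<close> followed by the graded flip, in coordinates.\<close>

definition flip_R :: "(int \<Rightarrow> int \<Rightarrow> 'k) \<Rightarrow> int \<Rightarrow> int \<Rightarrow> 'k" where
  "flip_R f x y = koszul (eta n x) (eta n y) * R_diag x y * f y x + q_diff * (if x < y then f x y else 0)
     - q_diff * (if x = - y then inverse (cc y) * partial_contr y f else 0)"

definition pair_E :: "nat \<Rightarrow> (int \<Rightarrow> int \<Rightarrow> 'k) \<Rightarrow> int \<Rightarrow> int \<Rightarrow> 'k" where
  "pair_E k f x y = ec k x * f (x + step k) y + koszul (rdeg n k) (eta n x) * kap k x * (ec k y * f x (y + step k))"

definition pair_F :: "nat \<Rightarrow> (int \<Rightarrow> int \<Rightarrow> 'k) \<Rightarrow> int \<Rightarrow> int \<Rightarrow> 'k" where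
  "pair_F k f x y = fc k x * kapi k y * f (x - step k) y + koszul (rdeg n k) (eta n x) * (fc k y * f x (y - step k))"

section \<open>Invariance of the form C\<close>

lemma eta_step_facts:
  assumes "k \<in> L" "k \<noteq> 1"
  shows "eta n (int k) = rdeg n k + eta n (int k - 1)" "eta n (1 - int k) = eta n (int k - 1)"
    "\<not> (eta n (int k) = 0 \<and> eta n (int k - 1) = 1)"
  using assms by (auto simp: eta_def rdeg_def)

text \<open>Contraction with C annihilates the image of \<open>E_k\<close> on the tensor square.
  Each pair of inputs is met by exactly two terms, and these cancel.\<close>

lemma cc_invariant_E:
  assumes "k \<in> L"
  shows "cc (y + step k) * (koszul (rdeg n k) (eta n (y + step k)) * kap k (y + step k) * ec k (- y - step k)) = - (cc y * ec k y)"
proof (cases "k = 1")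
  case True
  then show ?thesis
    using n1 q0 assms unfolding kap_def form_sroot_eps[OF assms]
    by (cases "y = - 1") (auto simp: ec_def step_def rdeg_def cc_values_1 power_int_minus power2_eq_square)
next
  case False
  then have k: "k \<ge> 2" using assms by simp
  note cv = cc_values[OF k] and e = eta_step_facts[OF assms False]
  consider "y = - int k" | "y = int k - 1" | "y \<noteq> - int k" "y \<noteq> int k - 1" by blast
  then show ?thesis
  proof cases
    case 1
    show ?thesis
      using k q0 False e unfolding 1 kap_def form_sroot_eps[OF assms]
      by (cases "eta n (int k)"; cases "eta n (int k - 1)"; cases "rdeg n k")
        (simp_all add: ec_def step_def cv sig_def koszul_def power_int_minus field_simps)
  next
    case 2
    show ?thesis
      using k q0 False e unfolding 2 kap_def form_sroot_eps[OF assms]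
      by (cases "eta n (int k)"; cases "eta n (int k - 1)"; cases "rdeg n k")
        (simp_all add: ec_def step_def cv sig_def koszul_def power_int_minus field_simps)
  next
    case 3
    then have "- y - 1 \<noteq> - int k" "- y - 1 \<noteq> int k - 1" by auto
    then show ?thesis using 3 False by (simp add: ec_def step_def)
  qed
qed

lemma cc_invariant_F:
  assumes "k \<in> L"
  shows "cc (y + step k) * (fc k (y + step k) * kap k (y + step k)) = - (cc y * (koszul (rdeg n k) (eta n y) * fc k (- y)))"
proof (cases "k = 1")
  case True
  then show ?thesis
    using n1 q0 assms unfolding kap_def form_sroot_eps[OF assms]
    by (cases "y = - 1") (auto simp: fc_def step_def rdeg_def cc_values_1 power_int_minus power2_eq_square)
next
  case False
  then have k: "k \<ge> 2" using assms by simp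
  note cv = cc_values[OF k] and e = eta_step_facts[OF assms False]
  consider "y = - int k" | "y = int k - 1" | "y \<noteq> - int k" "y \<noteq> int k - 1" by blast
  then show ?thesis
  proof cases
    case 1
    show ?thesis
      using k q0 False e unfolding 1 kap_def form_sroot_eps[OF assms]
      by (cases "eta n (int k)"; cases "eta n (int k - 1)"; cases "rdeg n k")
        (simp_all add: fc_def step_def cv sig_def koszul_def power_int_minus field_simps)
  next
    case 2
    show ?thesis
      using k q0 False e unfolding 2 kap_def form_sroot_eps[OF assms]
      by (cases "eta n (int k)"; cases "eta n (int k - 1)"; cases "rdeg n k")
        (simp_all add: fc_def step_def cv sig_def koszul_def power_int_minus field_simps)
  next
    case 3
    then have "y + 1 \<noteq> - int k + 1" "y + 1 \<noteq> int k" "- y \<noteq> - int k + 1" "- y \<noteq> int k" by auto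
    then show ?thesis using False by (simp add: fc_def step_def)
  qed
qed

text \<open>The weight of \<open>y\<close> exceeds that of \<open>y + step k\<close> by \<alpha>_k,
  so the exponent (\<epsilon>_x, \<epsilon>_y) grows by (\<alpha>_k, \<epsilon>_x).\<close>

lemma R_diag_E:
  assumes "k \<in> L" "ec k y \<noteq> 0"
  shows "R_diag x y = kap k x * R_diag x (y + step k)"
proof (cases "k = 1")
  case True
  then have "y = - 1" using assms by (simp add: ec_def split: if_splits)
  then show ?thesis
    using True n1 q0 unfolding R_diag_def kap_def form_sroot_eps[OF assms(1)]
    by (auto simp: step_def sig_def eta_def power_int_minus power2_eq_square)
next
  case False
  then have k: "k \<ge> 2" using assms by simp
  note e = eta_step_facts[OF assms(1) False]
  consider "y = - int k" | "y = int k - 1" using assms False by (auto simp: ec_def split: if_splits)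
  then show ?thesis
    by cases (use k q0 in \<open>auto simp: R_diag_def kap_def form_sroot_eps[OF assms(1)] step_def sig_def e(2) power_int_minus\<close>)
qed

lemma R_diag_F:
  assumes "k \<in> L" "fc k x \<noteq> 0"
  shows "R_diag x y = kapi k y * R_diag (x - step k) y"
proof -
  have "R_diag a b = R_diag b a" for a b by (auto simp: R_diag_def sig_def)
  moreover have "ec k (x - step k) \<noteq> 0" using assms fc_ec by blast
  from R_diag_E[OF assms(1) this, of y] have "R_diag y (x - step k) = kap k y * R_diag y x" by simp
  then have "kapi k y * R_diag y (x - step k) = R_diag y x" by (simp add: mult.assoc[symmetric])
  ultimately show ?thesis by metis
qed

text \<open>The coefficient of \<open>f y (x + step k)\<close> in the commutator of
  \<open>flip_R\<close> with \<open>E_k\<close>. Here the diagonal part meets the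
  \<open>q_diff\<close> terms: two from the cutoff \<open>x < y\<close> and two from the
  contraction.\<close>

lemma hecke_E:
  assumes "k \<in> L" "ec k x \<noteq> 0" "x \<in> I" "y \<in> I"
  shows "koszul (eta n (x + step k)) (eta n y) * (R_diag x y * kap k y - R_diag (x + step k) y) +
    q_diff * ((if x = - y then koszul (rdeg n k) (eta n y) * kap k y else 0) + (if y = x + step k then 1 else 0)
      - (if x = y then koszul (rdeg n k) (eta n x) * kap k x else 0) - (if x + step k = - y then 1 else 0)) = 0"
proof (cases "k = 1")
  case True
  then have x: "x = - 1" using assms by (simp add: ec_def split: if_splits)
  consider "y = 1" | "y = - 1" | "y \<noteq> 1" "y \<noteq> - 1" by blast
  then show ?thesis
    unfolding x R_diag_def kap_def form_sroot_eps[OF assms(1)]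
    by cases (use True n1 q0 in \<open>auto simp: step_def sig_def eta_def rdeg_def
      q_diff_def power_int_minus field_simps power2_eq_square\<close>)
next
  case False
  then have k: "k \<ge> 2" using assms by simp
  note e = eta_step_facts[OF assms(1) False]
  have "y = int k \<or> y = - int k \<or> y = int k - 1 \<or> y = 1 - int k
    \<or> y \<noteq> int k \<and> y \<noteq> - int k \<and> y \<noteq> int k - 1 \<and> y \<noteq> 1 - int k" by blast
  moreover have "x = - int k \<or> x = int k - 1" using assms False by (auto simp: ec_def split: if_splits)
  ultimately show ?thesis
    unfolding R_diag_def kap_def form_sroot_eps[OF assms(1)]
    by (elim disjE; (elim conjE)?; hypsubst?; cases "eta n (int k)"; cases "eta n (int k - 1)"; cases "rdeg n k")
      (use k q0 False e in \<open>auto simp: step_def sig_def koszul_def q_diff_def power_int_minus field_simps power2_eq_square\<close>)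
qed

text \<open>Obtained from \<open>hecke_E\<close> at \<open>(y - step k, x)\<close> by multiplication
  with \<open>- kapi k x\<close>; the transposition reflects that \<open>F_k\<close> has its entries
  opposite to \<open>E_k\<close>.\<close>

lemma hecke_F:
  assumes k: "k \<in> L" "fc k y \<noteq> 0" "x \<in> I" "y \<in> I"
  shows "koszul (eta n x) (eta n y) * (R_diag x y * kapi k x - R_diag x (y - step k)) +
    q_diff * ((if x = - y then kap k y else 0) + (if x = y - step k then koszul (rdeg n k) (eta n x) else 0)
      - (if x = y then kapi k y else 0) - (if x = step k - y then koszul (rdeg n k) (eta n x) else 0)) = 0"
proof -
  have e: "ec k (y - step k) \<noteq> 0" "y - step k \<in> I" using assms fc_ec fc_idx by blast+
  have s: "R_diag a b = R_diag b a" for a b by (auto simp: R_diag_def sig_def)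
  have c: "kapi k x * (kap k x * c) = c" "kap k x * (kapi k x * c) = c" for c x by (simp_all add: mult.assoc[symmetric])
  have nz: "step k \<noteq> 0" "x \<noteq> 0" "y \<noteq> 0" using assms by (auto simp: step_def idx_def)
  let ?l = "koszul (eta n y) (eta n x) * (R_diag (y - step k) x * kap k x - R_diag y x) +
    q_diff * ((if y - step k = - x then koszul (rdeg n k) (eta n x) * kap k x else 0) + (if x = y then 1 else 0)
      - (if y - step k = x then koszul (rdeg n k) (eta n (y - step k)) * kap k (y - step k) else 0) - (if y = - x then 1 else 0))"
  have "- kapi k x * ?l = koszul (eta n x) (eta n y) * (R_diag x y * kapi k x - R_diag x (y - step k)) +
    q_diff * ((if x = - y then kap k y else 0) + (if x = y - step k then koszul (rdeg n k) (eta n x) else 0)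
      - (if x = y then kapi k y else 0) - (if x = step k - y then koszul (rdeg n k) (eta n x) else 0))"
  proof (cases "x = - y")
    case True
    then show ?thesis using nz by (auto simp: algebra_simps c s)
  next
    case False
    then show ?thesis
      unfolding s[of y] s[of "y - step k"] koszul_comm[of "eta n y"]
      using nz by (auto simp: algebra_simps c)
  qed
  moreover have "?l = 0"
    using hecke_E[OF k(1) e assms(3)] by simp
  ultimately show ?thesis by simp
qed

text \<open>No index lies strictly between \<open>y\<close> and \<open>y + step k\<close>; for
  \<open>k = 1\<close> the gap is the missing 0. A cutoff thus moves past one index at a
  time.\<close>

lemma step_consecutive:
  assumes "k \<in> L" "ec k y \<noteq> 0" "t \<in> I"
  shows "(t < y + step k) = (t < y \<or> t = y)" "(y < t) = (y + step k < t \<or> t = y + step k)"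
  using assms by (auto simp: ec_def step_def idx_def split: if_splits)

section \<open>Partial contractions and summation by parts\<close>

lemma partial_contr_restrict: "partial_contr t f = (\<Sum>y\<in>I. if y < t then cc y * f y (- y) else 0)"
  unfolding partial_contr_def by (simp add: sum.inter_filter)

lemma partial_contr_step:
  assumes "k \<in> L" "ec k y \<noteq> 0"
  shows "partial_contr (y + step k) f = partial_contr y f + cc y * f y (- y)"
proof -
  have y: "y \<in> I" using ec_idx[OF assms] by blast
  have "partial_contr (y + step k) f = (\<Sum>t\<in>I. (if t < y then cc t * f t (- t) else 0) + (if t = y then cc y * f y (- y) else 0))"
    unfolding partial_contr_restrict by (intro sum.cong refl) (auto simp: step_consecutive(1)[OF assms])
  then show ?thesis using y by (simp add: sum.distrib partial_contr_restrict)
qed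

lemma sum_shift:
  assumes "\<And>u. g (u + s) \<noteq> (0::'k) \<Longrightarrow> u \<in> I" "\<And>u. u \<in> I \<Longrightarrow> g (u + s) \<noteq> 0 \<Longrightarrow> u + s \<in> I"
    "\<And>u. u \<in> I \<Longrightarrow> g u \<noteq> 0 \<Longrightarrow> u - s \<in> I"
  shows "(\<Sum>u\<in>I. g u) = (\<Sum>u\<in>I. g (u + s))"
proof -
  have "(\<Sum>u\<in>I. g u) = (\<Sum>u\<in>{u \<in> I. g u \<noteq> 0}. g u)"
    by (rule sum.mono_neutral_right) auto
  also have "\<dots> = (\<Sum>u\<in>{u \<in> I. g (u + s) \<noteq> 0}. g (u + s))"
    by (rule sum.reindex_bij_witness[of _ "\<lambda>u. u + s" "\<lambda>u. u - s"]) (use assms in auto)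
  also have "\<dots> = (\<Sum>u\<in>I. g (u + s))"
    by (rule sum.mono_neutral_left) auto
  finally show ?thesis .
qed

text \<open>Summation by parts: by invariance the second half of the action at
  \<open>u + step k\<close> cancels the first half at \<open>u\<close>, leaving the jump of the
  cutoff \<open>P\<close>. Constant \<open>P\<close> gives invariance of the full contraction, and a
  threshold leaves a single boundary term.\<close>

lemma weighted_sum_E:
  assumes k: "k \<in> L"
  shows "(\<Sum>u\<in>I. if P u then cc u * pair_E k f u (- u) else 0) =
    (\<Sum>u\<in>I. ((if P u then 1 else 0) - (if P (u + step k) then 1 else 0)) * (cc u * ec k u * f (u + step k) (- u)))"
proof -
  let ?g = "\<lambda>u. if P u then cc u * (koszul (rdeg n k) (eta n u) * kap k u * (ec k (- u) * f u (- u + step k))) else 0"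
  have nz: "ec k (- u) = 0 \<longleftrightarrow> ec k (u - step k) = 0" for u
    using cc_invariant_E[OF k, of "u - step k", simplified] by (metis cc_nonzero koszul_nonzero kap_kapi(3) mult_eq_0_iff neg_equal_0_iff_equal)
  have shift: "(\<Sum>u\<in>I. ?g u) = (\<Sum>u\<in>I. ?g (u + step k))"
  proof (rule sum_shift)
    fix u
    show "u \<in> I" if "?g (u + step k) \<noteq> 0"
      using that nz[of "u + step k"] ec_idx[OF k, of u] by (auto split: if_splits)
    show "u + step k \<in> I" if "?g (u + step k) \<noteq> 0"
      using that nz[of "u + step k"] ec_idx[OF k, of u] by (auto split: if_splits)
    show "u - step k \<in> I" if "?g u \<noteq> 0"
      using that nz[of u] ec_idx[OF k, of "u - step k"] by (auto split: if_splits)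
  qed
  have "?g (u + step k) = - (if P (u + step k) then cc u * ec k u * f (u + step k) (- u) else 0)" for u
  proof -
    have "cc (u + step k) * (koszul (rdeg n k) (eta n (u + step k)) * kap k (u + step k) * (ec k (- u - step k) * c)) = - (cc u * ec k u * c)" for c
      using arg_cong[OF cc_invariant_E[OF k, of u], of "\<lambda>x. x * c"] by (simp add: mult.assoc)
    from this[of "f (u + step k) (- u)"] show ?thesis by simp
  qed
  then have g: "(\<Sum>u\<in>I. ?g u) = (\<Sum>u\<in>I. - (if P (u + step k) then cc u * ec k u * f (u + step k) (- u) else 0))"
    unfolding shift by simp
  have e: "(\<Sum>u\<in>I. if P u then cc u * pair_E k f u (- u) else 0) =
      (\<Sum>u\<in>I. if P u then cc u * ec k u * f (u + step k) (- u) else 0) + (\<Sum>u\<in>I. ?g u)"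
    unfolding sum.distrib[symmetric] pair_E_def by (intro sum.cong refl) (simp add: algebra_simps)
  show ?thesis
    unfolding e g sum.distrib[symmetric] by (intro sum.cong refl) simp
qed

lemma weighted_sum_F:
  assumes k: "k \<in> L"
  shows "(\<Sum>u\<in>I. if P u then cc u * pair_F k f u (- u) else 0) =
    (\<Sum>u\<in>I. ((if P u then 1 else 0) - (if P (u + step k) then 1 else 0)) * (cc u * (koszul (rdeg n k) (eta n u) * fc k (- u)) * f u (- u - step k)))"
proof -
  let ?g = "\<lambda>u. if P u then cc u * (fc k u * kap k u * f (u - step k) (- u)) else 0"
  have nz: "fc k (- u) = 0 \<longleftrightarrow> fc k (u + step k) = 0" for u
    using cc_invariant_F[OF k, of u] by (metis cc_nonzero koszul_nonzero kap_kapi(3) mult_eq_0_iff neg_equal_0_iff_equal)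
  have shift: "(\<Sum>u\<in>I. ?g u) = (\<Sum>u\<in>I. ?g (u + step k))"
  proof (rule sum_shift)
    fix u
    show "u \<in> I" if "?g (u + step k) \<noteq> 0"
      using that fc_idx[OF k, of "u + step k"] by (auto split: if_splits)
    show "u + step k \<in> I" if "?g (u + step k) \<noteq> 0"
      using that fc_idx[OF k, of "u + step k"] by (auto split: if_splits)
    show "u - step k \<in> I" if "?g u \<noteq> 0"
      using that fc_idx[OF k, of u] by (auto split: if_splits)
  qed
  have "?g (u + step k) = - (if P (u + step k) then cc u * (koszul (rdeg n k) (eta n u) * fc k (- u)) * f u (- u - step k) else 0)" for u
  proof -
    have "cc (u + step k) * (fc k (u + step k) * kap k (u + step k) * c) = - (cc u * (koszul (rdeg n k) (eta n u) * fc k (- u)) * c)" for c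
      using arg_cong[OF cc_invariant_F[OF k, of u], of "\<lambda>x. x * c"] by (simp add: mult.assoc)
    from this[of "f u (- u - step k)"] show ?thesis by simp
  qed
  then have g: "(\<Sum>u\<in>I. ?g u) = (\<Sum>u\<in>I. - (if P (u + step k) then cc u * (koszul (rdeg n k) (eta n u) * fc k (- u)) * f u (- u - step k) else 0))"
    unfolding shift by simp
  have e: "(\<Sum>u\<in>I. if P u then cc u * pair_F k f u (- u) else 0) =
      (\<Sum>u\<in>I. if P u then cc u * (koszul (rdeg n k) (eta n u) * fc k (- u)) * f u (- u - step k) else 0) + (\<Sum>u\<in>I. ?g u)"
    unfolding sum.distrib[symmetric] pair_F_def by (intro sum.cong refl) (simp add: algebra_simps)
  show ?thesis
    unfolding e g sum.distrib[symmetric] by (intro sum.cong refl) simp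
qed

definition contr :: "(int \<Rightarrow> int \<Rightarrow> 'k) \<Rightarrow> 'k" where "contr f = (\<Sum>u\<in>I. cc u * f u (- u))"

lemma contr_E: "k \<in> L \<Longrightarrow> contr (pair_E k f) = 0"
  using weighted_sum_E[of k "\<lambda>_. True" f] by (simp add: contr_def)

lemma contr_F: "k \<in> L \<Longrightarrow> contr (pair_F k f) = 0"
  using weighted_sum_F[of k "\<lambda>_. True" f] by (simp add: contr_def)

lemma partial_contr_E:
  assumes "k \<in> L" "t \<in> I"
  shows "partial_contr t (pair_E k f) = cc (t - step k) * ec k (t - step k) * f t (step k - t)"
proof -
  have "partial_contr t (pair_E k f) = (\<Sum>u\<in>I. if u = t - step k then cc (t - step k) * ec k (t - step k) * f t (step k - t) else 0)"
    unfolding partial_contr_restrict weighted_sum_E[OF assms(1)]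
  proof (intro sum.cong refl)
    fix u
    show "((if u < t then 1 else 0) - (if u + step k < t then 1 else 0)) * (cc u * ec k u * f (u + step k) (- u)) =
      (if u = t - step k then cc (t - step k) * ec k (t - step k) * f t (step k - t) else 0)"
      using step_consecutive(2)[OF assms(1) _ assms(2), of u] by (cases "ec k u = 0") auto
  qed
  then show ?thesis using ec_idx[OF assms(1), of "t - step k"] by auto
qed

lemma partial_contr_F:
  assumes "k \<in> L" "t \<in> I"
  shows "partial_contr t (pair_F k f) = cc (t - step k) * (koszul (rdeg n k) (eta n (t - step k)) * fc k (step k - t)) * f (t - step k) (- t)"
proof -
  have nz: "fc k (- u) = 0 \<longleftrightarrow> ec k u = 0" for u
    using cc_invariant_F[OF assms(1), of u] fc_ec[of k "u + step k", simplified] by (metis cc_nonzero koszul_nonzero kap_kapi(3) mult_eq_0_iff neg_equal_0_iff_equal)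
  have "partial_contr t (pair_F k f) = (\<Sum>u\<in>I. if u = t - step k then cc (t - step k) * (koszul (rdeg n k) (eta n (t - step k)) * fc k (step k - t)) * f (t - step k) (- t) else 0)"
    unfolding partial_contr_restrict weighted_sum_F[OF assms(1)]
  proof (intro sum.cong refl)
    fix u
    show "((if u < t then 1 else 0) - (if u + step k < t then 1 else 0)) * (cc u * (koszul (rdeg n k) (eta n u) * fc k (- u)) * f u (- u - step k)) =
      (if u = t - step k then cc (t - step k) * (koszul (rdeg n k) (eta n (t - step k)) * fc k (step k - t)) * f (t - step k) (- t) else 0)"
      using step_consecutive(2)[OF assms(1) _ assms(2), of u] nz[of u] by (cases "ec k u = 0") auto
  qed
  then show ?thesis using ec_idx[OF assms(1), of "t - step k"] nz[of "t - step k"] by auto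
qed

text \<open>Coefficients of the four shifted inputs are compared. Three match by weights, apart from
  coincidences at the cutoff; these and the contraction terms all involve
  \<open>f y (x + ?s)\<close>, where \<open>hecke_E\<close> applies.\<close>

lemma flip_R_E:
  assumes k: "k \<in> L" and x: "x \<in> I" and y: "y \<in> I"
  shows "flip_R (pair_E k f) x y = pair_E k (flip_R f) x y"
proof -
  let ?s = "step k" and ?K = "koszul (eta n x) (eta n y) :: 'k"
  let ?p = "ec k x" and ?r = "koszul (rdeg n k) (eta n x) * kap k x * ec k y"
  have kd1: "koszul (eta n (x + ?s)) (eta n y) * ?p = ?K * koszul (rdeg n k) (eta n y) * ?p"
    using eta_ec[OF k, of x] by (cases "?p = 0") (simp_all add: koszul_add_left mult_ac)
  have kd2: "koszul (eta n x) (eta n (y + ?s)) * ec k y = ?K * koszul (rdeg n k) (eta n x) * ec k y"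
    using eta_ec[OF k, of y] by (cases "ec k y = 0") (simp_all add: koszul_add_right koszul_comm mult_ac)
  have nz: "ec k (- u) = 0 \<longleftrightarrow> ec k (u - ?s) = 0" for u
    using cc_invariant_E[OF k, of "u - ?s", simplified] by (metis cc_nonzero koszul_nonzero kap_kapi(3) mult_eq_0_iff neg_equal_0_iff_equal)
  have left: "inverse (cc y) * partial_contr y (pair_E k f) = - (koszul (rdeg n k) (eta n y) * kap k y * ?p) * f y (x + ?s)" if "x = - y"
  proof -
    have "cc (y - ?s) * ec k (y - ?s) = - (cc y * (koszul (rdeg n k) (eta n y) * kap k y * ec k x))"
      using cc_invariant_E[OF k, of "y - ?s"] that by simp
    then show ?thesis unfolding partial_contr_E[OF k y] using that by (simp add: ac_simps field_simps)
  qed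
  \<comment> \<open>By invariance of C the two partial contractions cancel, up to the one term by
    which the cutoffs \<open>y\<close> and \<open>y + ?s\<close> differ.\<close>
  have right: "?p * (inverse (cc y) * partial_contr y f) + ?r * (inverse (cc (y + ?s)) * partial_contr (y + ?s) f) = - (?p * f y (x + ?s))" if "x + ?s = - y"
  proof (cases "ec k y = 0")
    case True
    have "- (y + ?s) = x" using that by simp
    then have "?p = 0" using nz[of "y + ?s"] True by simp
    then show ?thesis using True by simp
  next
    case False
    have x': "x = - y - ?s" using that by simp
    have e: "eta n x = eta n (y + ?s)" "kap k x = kapi k (y + ?s)" unfolding x'
      using eta_neg[of "y + ?s"] kap_neg(1)[of k "y + ?s"] by simp_all
    have "cc (y + ?s) * (koszul (rdeg n k) (eta n (y + ?s)) * kap k (y + ?s) * ?p) = - (cc y * ec k y)"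
      unfolding x' by (rule cc_invariant_E[OF k])
    then have "koszul (rdeg n k) (eta n (y + ?s)) * kapi k (y + ?s) * (cc (y + ?s) * (koszul (rdeg n k) (eta n (y + ?s)) * kap k (y + ?s) * ?p))
      = - (cc y * (koszul (rdeg n k) (eta n (y + ?s)) * kapi k (y + ?s) * ec k y))" by (simp add: mult_ac)
    moreover have "koszul (rdeg n k) (eta n (y + ?s)) * kapi k (y + ?s) * (cc (y + ?s) * (koszul (rdeg n k) (eta n (y + ?s)) * kap k (y + ?s) * ?p))
      = (koszul (rdeg n k) (eta n (y + ?s)) * koszul (rdeg n k) (eta n (y + ?s))) * (kapi k (y + ?s) * kap k (y + ?s)) * (cc (y + ?s) * ?p)"
      by (simp only: mult_ac)
    ultimately have r: "cc (y + ?s) * ?p = - (cc y * ?r)" unfolding e by simp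
    have "?r * inverse (cc (y + ?s)) = - (?p * inverse (cc y))"
    proof -
      have "?r = - (cc (y + ?s) * ?p) * inverse (cc y)" unfolding r by simp
      then show ?thesis by simp
    qed
    then have A: "?r * (inverse (cc (y + ?s)) * partial_contr (y + ?s) f) = - (?p * inverse (cc y)) * partial_contr (y + ?s) f" by (simp add: mult.assoc[symmetric])
    have B: "partial_contr (y + ?s) f = partial_contr y f + cc y * f y (x + ?s)"
      using that partial_contr_step[OF k False] by simp
    have ring: "a * (v * b) + - (a * v) * (b + c * w) = - (a * w) * (v * c)" for a v b c w :: 'k
      by (simp add: algebra_simps)
    have "?p * (inverse (cc y) * partial_contr y f) + ?r * (inverse (cc (y + ?s)) * partial_contr (y + ?s) f) =
      - (?p * f y (x + ?s)) * (inverse (cc y) * cc y)" unfolding A unfolding B by (rule ring)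
    then show ?thesis by simp
  qed
  have rc: "x = - (y + ?s) \<longleftrightarrow> x + ?s = - y" by auto
  have L: "flip_R (pair_E k f) x y = ?K * R_diag x y * (ec k y * f (y + ?s) x + koszul (rdeg n k) (eta n y) * kap k y * (?p * f y (x + ?s)))
     + q_diff * (if x < y then ?p * f (x + ?s) y + ?r * f x (y + ?s) else 0)
     + q_diff * (if x = - y then (koszul (rdeg n k) (eta n y) * kap k y * ?p) * f y (x + ?s) else 0)"
    unfolding flip_R_def using left by (simp add: pair_E_def mult.assoc)
  have R: "pair_E k (flip_R f) x y = koszul (eta n (x + ?s)) (eta n y) * ?p * R_diag (x + ?s) y * f y (x + ?s)
     + q_diff * (if x + ?s < y then ?p * f (x + ?s) y else 0)
     + koszul (rdeg n k) (eta n x) * kap k x * (koszul (eta n x) (eta n (y + ?s)) * ec k y) * R_diag x (y + ?s) * f (y + ?s) x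
     + q_diff * (if x < y + ?s then ?r * f x (y + ?s) else 0)
     + q_diff * (if x + ?s = - y then ?p * f y (x + ?s) else 0)"
  proof -
    have "pair_E k (flip_R f) x y = koszul (eta n (x + ?s)) (eta n y) * ?p * R_diag (x + ?s) y * f y (x + ?s)
     + q_diff * (if x + ?s < y then ?p * f (x + ?s) y else 0)
     + koszul (rdeg n k) (eta n x) * kap k x * (koszul (eta n x) (eta n (y + ?s)) * ec k y) * R_diag x (y + ?s) * f (y + ?s) x
     + q_diff * (if x < y + ?s then ?r * f x (y + ?s) else 0)
     - q_diff * (if x + ?s = - y then ?p * (inverse (cc y) * partial_contr y f) + ?r * (inverse (cc (y + ?s)) * partial_contr (y + ?s) f) else 0)"
      unfolding pair_E_def flip_R_def rc by (simp add: algebra_simps)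
    then show ?thesis using right by (simp split: if_splits)
  qed
  have c1: "?K * R_diag x y * (ec k y * f (y + ?s) x) = koszul (rdeg n k) (eta n x) * kap k x * (koszul (eta n x) (eta n (y + ?s)) * ec k y) * R_diag x (y + ?s) * f (y + ?s) x"
  proof (cases "ec k y = 0")
    case False
    show ?thesis unfolding kd2 R_diag_E[OF k False, of x] by (simp add: mult_ac)
  qed simp
  \<comment> \<open>The two cutoffs differ only when \<open>y\<close> equals \<open>x + ?s\<close>,
    and then the argument of \<open>f\<close> is the pair treated in \<open>c2\<close>. The same
    happens in \<open>c4\<close> for \<open>x = y\<close>.\<close>
  have c3: "(if x < y then ?p * f (x + ?s) y else 0) - (if x + ?s < y then ?p * f (x + ?s) y else 0) = (if y = x + ?s then ?p * f y (x + ?s) else 0)"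
    using step_consecutive(2)[OF k _ y, of x] by (cases "?p = 0") auto
  have c4: "(if x < y then ?r * f x (y + ?s) else 0) - (if x < y + ?s then ?r * f x (y + ?s) else 0) =
      - (if x = y then koszul (rdeg n k) (eta n x) * kap k x * ?p * f y (x + ?s) else 0)"
    using step_consecutive(1)[OF k _ x, of y] by (cases "ec k y = 0") auto
  have c2: "?p * f y (x + ?s) * (koszul (eta n (x + ?s)) (eta n y) * (R_diag x y * kap k y - R_diag (x + ?s) y) +
    q_diff * ((if x = - y then koszul (rdeg n k) (eta n y) * kap k y else 0) + (if y = x + ?s then 1 else 0)
      - (if x = y then koszul (rdeg n k) (eta n x) * kap k x else 0) - (if x + ?s = - y then 1 else 0))) = 0"
    using hecke_E[OF k _ x y] by (cases "?p = 0") simp_all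
  have kd1': "?K * koszul (rdeg n k) (eta n y) * ?p = koszul (eta n (x + ?s)) (eta n y) * ?p" by (simp add: kd1)
  have "flip_R (pair_E k f) x y - pair_E k (flip_R f) x y =
    (?K * koszul (rdeg n k) (eta n y) * ?p) * (R_diag x y * kap k y * f y (x + ?s)) - koszul (eta n (x + ?s)) (eta n y) * ?p * (R_diag (x + ?s) y * f y (x + ?s))
    + q_diff * ((if x < y then ?p * f (x + ?s) y else 0) - (if x + ?s < y then ?p * f (x + ?s) y else 0))
    + q_diff * ((if x < y then ?r * f x (y + ?s) else 0) - (if x < y + ?s then ?r * f x (y + ?s) else 0))
    + q_diff * (if x = - y then (koszul (rdeg n k) (eta n y) * kap k y * ?p) * f y (x + ?s) else 0)
    - q_diff * (if x + ?s = - y then ?p * f y (x + ?s) else 0)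
    + (?K * R_diag x y * (ec k y * f (y + ?s) x) - koszul (rdeg n k) (eta n x) * kap k x * (koszul (eta n x) (eta n (y + ?s)) * ec k y) * R_diag x (y + ?s) * f (y + ?s) x)"
    unfolding L R by (simp add: algebra_simps)
  also have "\<dots> = ?p * f y (x + ?s) * (koszul (eta n (x + ?s)) (eta n y) * (R_diag x y * kap k y - R_diag (x + ?s) y) +
    q_diff * ((if x = - y then koszul (rdeg n k) (eta n y) * kap k y else 0) + (if y = x + ?s then 1 else 0)
      - (if x = y then koszul (rdeg n k) (eta n x) * kap k x else 0) - (if x + ?s = - y then 1 else 0)))"
  proof -
    have ring: "kk * p * (d1 * kp * F) - kk * p * (d2 * F) + z * (if C2 then p * F else 0) + z * (- (if C3 then r1 * p * F else 0))
      + z * (if C1 then (r2 * p) * F else 0) - z * (if C4 then p * F else 0) + (u - u) =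
      p * F * (kk * (d1 * kp - d2) + z * ((if C1 then r2 else 0) + (if C2 then 1 else 0) - (if C3 then r1 else 0) - (if C4 then 1 else 0)))"
      for kk p d1 kp F d2 z r1 r2 u :: 'k and C1 C2 C3 C4 :: bool
      by (simp add: algebra_simps)
    show ?thesis unfolding kd1' c1 c3 c4 by (rule ring)
  qed
  also have "\<dots> = 0" by (rule c2)
  finally show ?thesis by simp
qed

text \<open>The same comparison with the shifts reversed; the input at which all contributions meet
  is now \<open>f (y - step k) x\<close>.\<close>

lemma flip_R_F:
  assumes k: "k \<in> L" and x: "x \<in> I" and y: "y \<in> I"
  shows "flip_R (pair_F k f) x y = pair_F k (flip_R f) x y"
proof -
  let ?s = "step k" and ?K = "koszul (eta n x) (eta n y) :: 'k" and ?g = "f (y - step k) x"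
  let ?r = "fc k x * kapi k y" and ?p = "koszul (rdeg n k) (eta n x) * fc k y"
  have kd1: "koszul (eta n (x - ?s)) (eta n y) * fc k x = ?K * koszul (rdeg n k) (eta n y) * fc k x"
    using eta_fc[OF k, of x] by (cases "fc k x = 0") (simp_all add: koszul_add_left mult_ac)
  have kd2: "koszul (rdeg n k) (eta n x) * koszul (eta n x) (eta n (y - ?s)) * fc k y = ?K * fc k y"
    using eta_fc[OF k, of y] by (cases "fc k y = 0") (simp_all add: koszul_add_right koszul_comm mult_ac)
  have inv: "cc y * (fc k y * kap k y) = - (cc (y - ?s) * (koszul (rdeg n k) (eta n (y - ?s)) * fc k (?s - y)))"
    using cc_invariant_F[OF k, of "y - ?s"] by simp
  have left: "inverse (cc y) * partial_contr y (pair_F k f) = - (fc k y * kap k y) * ?g" if "x = - y"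
  proof -
    have "inverse (cc y) * partial_contr y (pair_F k f) = - (inverse (cc y) * (cc y * (fc k y * kap k y))) * ?g"
      unfolding partial_contr_F[OF k y] inv using that by simp
    then show ?thesis by (simp add: mult.assoc[symmetric])
  qed
  have right: "?r * (inverse (cc y) * partial_contr y f) + ?p * (inverse (cc (y - ?s)) * partial_contr (y - ?s) f) = - (?p * ?g)" if xy: "x = ?s - y"
  proof (cases "fc k y = 0")
    case True
    then have "fc k x = 0" using inv xy by simp
    then show ?thesis using True by simp
  next
    case False
    then have ec: "ec k (y - ?s) \<noteq> 0" using fc_ec by blast
    have "eta n x = eta n (y - ?s)" using xy eta_neg[of "y - ?s"] by simp
    then have inv': "cc y * (fc k y * kap k y) = - (cc (y - ?s) * (koszul (rdeg n k) (eta n x) * fc k x))"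
      using inv xy by simp
    have "koszul (rdeg n k) (eta n x) * kapi k y * (cc y * (fc k y * kap k y)) =
      - (koszul (rdeg n k) (eta n x) * kapi k y * (cc (y - ?s) * (koszul (rdeg n k) (eta n x) * fc k x)))"
      unfolding inv' by simp
    moreover have "koszul (rdeg n k) (eta n x) * kapi k y * (cc y * (fc k y * kap k y)) = (kapi k y * kap k y) * (cc y * ?p)"
      "koszul (rdeg n k) (eta n x) * kapi k y * (cc (y - ?s) * (koszul (rdeg n k) (eta n x) * fc k x)) =
        (koszul (rdeg n k) (eta n x) * koszul (rdeg n k) (eta n x)) * (cc (y - ?s) * ?r)"
      by (simp_all only: mult_ac)
    ultimately have c: "cc y * ?p = - (cc (y - ?s) * ?r)" by simp
    have "?r * inverse (cc y) = - (?p * inverse (cc (y - ?s)))"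
    proof -
      have "?r = - (cc y * ?p) * inverse (cc (y - ?s))" unfolding c by simp
      then show ?thesis by simp
    qed
    then have A: "?r * (inverse (cc y) * partial_contr y f) = - (?p * inverse (cc (y - ?s))) * partial_contr y f" by (simp add: mult.assoc[symmetric])
    have B: "partial_contr y f = partial_contr (y - ?s) f + cc (y - ?s) * ?g"
      using xy partial_contr_step[OF k ec] by simp
    have ring: "- (a * v) * (b + c * w) + a * (v * b) = - (a * w) * (v * c)" for a v b c w :: 'k
      by (simp add: algebra_simps)
    have "?r * (inverse (cc y) * partial_contr y f) + ?p * (inverse (cc (y - ?s)) * partial_contr (y - ?s) f) =
      - (?p * ?g) * (inverse (cc (y - ?s)) * cc (y - ?s))" unfolding A unfolding B by (rule ring)
    then show ?thesis by simp
  qed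
  have rc: "x - ?s = - y \<longleftrightarrow> x = ?s - y" "x = - (y - ?s) \<longleftrightarrow> x = ?s - y" by auto
  have L: "flip_R (pair_F k f) x y = ?K * R_diag x y * (fc k y * kapi k x * ?g + koszul (rdeg n k) (eta n y) * (fc k x * f y (x - ?s)))
     + q_diff * (if x < y then ?r * f (x - ?s) y + ?p * f x (y - ?s) else 0)
     + q_diff * (if x = - y then (fc k y * kap k y) * ?g else 0)"
    unfolding flip_R_def using left by (simp add: pair_F_def mult.assoc)
  have R: "pair_F k (flip_R f) x y = koszul (eta n (x - ?s)) (eta n y) * fc k x * (kapi k y * R_diag (x - ?s) y) * f y (x - ?s)
     + q_diff * (if x - ?s < y then ?r * f (x - ?s) y else 0)
     + (koszul (rdeg n k) (eta n x) * koszul (eta n x) (eta n (y - ?s)) * fc k y) * R_diag x (y - ?s) * ?g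
     + q_diff * (if x < y - ?s then ?p * f x (y - ?s) else 0)
     + q_diff * (if x = ?s - y then ?p * ?g else 0)"
  proof -
    have "pair_F k (flip_R f) x y = koszul (eta n (x - ?s)) (eta n y) * fc k x * (kapi k y * R_diag (x - ?s) y) * f y (x - ?s)
     + q_diff * (if x - ?s < y then ?r * f (x - ?s) y else 0)
     + (koszul (rdeg n k) (eta n x) * koszul (eta n x) (eta n (y - ?s)) * fc k y) * R_diag x (y - ?s) * ?g
     + q_diff * (if x < y - ?s then ?p * f x (y - ?s) else 0)
     - q_diff * (if x = ?s - y then ?r * (inverse (cc y) * partial_contr y f) + ?p * (inverse (cc (y - ?s)) * partial_contr (y - ?s) f) else 0)"
      unfolding pair_F_def flip_R_def rc by (simp add: algebra_simps)
    then show ?thesis using right by (simp split: if_splits)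
  qed
  have c1: "koszul (eta n (x - ?s)) (eta n y) * fc k x * (kapi k y * R_diag (x - ?s) y) * f y (x - ?s) =
      ?K * R_diag x y * (koszul (rdeg n k) (eta n y) * (fc k x * f y (x - ?s)))"
  proof (cases "fc k x = 0")
    case False
    show ?thesis unfolding kd1 R_diag_F[OF k False, of y] by (simp only: mult_ac)
  qed simp
  have c3: "(if x < y then ?r * f (x - ?s) y else 0) - (if x - ?s < y then ?r * f (x - ?s) y else 0) = - (if x = y then fc k y * kapi k y * ?g else 0)"
  proof (cases "fc k x = 0")
    case False
    then have "ec k (x - ?s) \<noteq> 0" using fc_ec by blast
    from step_consecutive(2)[OF k this y] show ?thesis by auto
  qed auto
  have c4: "(if x < y then ?p * f x (y - ?s) else 0) - (if x < y - ?s then ?p * f x (y - ?s) else 0) =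
      (if x = y - ?s then ?p * ?g else 0)"
  proof (cases "fc k y = 0")
    case False
    then have "ec k (y - ?s) \<noteq> 0" using fc_ec by blast
    from step_consecutive(1)[OF k this x] show ?thesis by auto
  qed simp
  have c2: "fc k y * ?g * (?K * (R_diag x y * kapi k x - R_diag x (y - ?s)) +
    q_diff * ((if x = - y then kap k y else 0) + (if x = y - ?s then koszul (rdeg n k) (eta n x) else 0)
      - (if x = y then kapi k y else 0) - (if x = ?s - y then koszul (rdeg n k) (eta n x) else 0))) = 0"
    using hecke_F[OF k _ x y] by (cases "fc k y = 0") simp_all
  have "flip_R (pair_F k f) x y - pair_F k (flip_R f) x y =
    ?K * R_diag x y * (fc k y * kapi k x * ?g) - (koszul (rdeg n k) (eta n x) * koszul (eta n x) (eta n (y - ?s)) * fc k y) * R_diag x (y - ?s) * ?g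
    + q_diff * ((if x < y then ?r * f (x - ?s) y else 0) - (if x - ?s < y then ?r * f (x - ?s) y else 0))
    + q_diff * ((if x < y then ?p * f x (y - ?s) else 0) - (if x < y - ?s then ?p * f x (y - ?s) else 0))
    + q_diff * (if x = - y then (fc k y * kap k y) * ?g else 0)
    - q_diff * (if x = ?s - y then ?p * ?g else 0)
    + (?K * R_diag x y * (koszul (rdeg n k) (eta n y) * (fc k x * f y (x - ?s))) - koszul (eta n (x - ?s)) (eta n y) * fc k x * (kapi k y * R_diag (x - ?s) y) * f y (x - ?s))"
    unfolding L R by (simp add: algebra_simps)
  also have "\<dots> = fc k y * ?g * (?K * (R_diag x y * kapi k x - R_diag x (y - ?s)) +
    q_diff * ((if x = - y then kap k y else 0) + (if x = y - ?s then koszul (rdeg n k) (eta n x) else 0)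
      - (if x = y then kapi k y else 0) - (if x = ?s - y then koszul (rdeg n k) (eta n x) else 0)))"
  proof -
    have ring: "K * d1 * (p * k1 * F) - (K * p) * d2 * F + z * (- (if C3 then p * r3 * F else 0)) + z * (if C2 then (r2 * p) * F else 0)
      + z * (if C1 then (p * r1) * F else 0) - z * (if C4 then (r2 * p) * F else 0) + (u - u) =
      p * F * (K * (d1 * k1 - d2) + z * ((if C1 then r1 else 0) + (if C2 then r2 else 0) - (if C3 then r3 else 0) - (if C4 then r2 else 0)))"
      for K d1 p k1 F d2 z r1 r2 r3 u :: 'k and C1 C2 C3 C4 :: bool
      by (simp add: algebra_simps)
    show ?thesis unfolding kd2 c1 c3 c4 by (rule ring)
  qed
  also have "\<dots> = 0" by (rule c2)
  finally show ?thesis by simp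
qed

text \<open>The case of the group-like \<open>K_j\<close>: eigenvalues at opposite indices are
  inverse to each other, so the contraction has weight zero.\<close>

lemma flip_R_diagonal:
  assumes "\<And>a. w a * w (- a) = (1::'k)"
  shows "flip_R (\<lambda>a b. w a * w b * f a b) x y = w x * w y * flip_R f x y"
proof -
  have S: "partial_contr y (\<lambda>a b. w a * w b * f a b) = partial_contr y f"
    unfolding partial_contr_def by (intro sum.cong) (simp_all add: assms)
  have W: "(if x = - y then c else 0) = w x * w y * (if x = - y then c else 0)" for c
    using assms[of "- y"] by simp
  have "flip_R (\<lambda>a b. w a * w b * f a b) x y = koszul (eta n x) (eta n y) * R_diag x y * (w y * w x * f y x)
      + q_diff * (if x < y then w x * w y * f x y else 0) - q_diff * (w x * w y * (if x = - y then inverse (cc y) * partial_contr y f else 0))"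
    by (simp only: flip_R_def S W[symmetric])
  also have "\<dots> = w x * w y * flip_R f x y"
    unfolding flip_R_def by (cases "x < y") (simp_all add: algebra_simps)
  finally show ?thesis .
qed

section \<open>The relations of the quantum supergroup\<close>

lemma sum_delta_pair:
  assumes "finite S" "\<And>i. finite (J i)"
  shows "(\<Sum>i\<in>S. \<Sum>j\<in>J i. if i = a \<and> j = c then g i j else 0) = (if a \<in> S \<and> c \<in> J a then g a c else (0::'k))"
proof -
  have "(\<Sum>i\<in>S. \<Sum>j\<in>J i. if i = a \<and> j = c then g i j else 0) = (\<Sum>i\<in>S. if i = a then (if c \<in> J a then g a c else 0) else 0)"
  proof (intro sum.cong refl)
    fix i
    show "(\<Sum>j\<in>J i. if i = a \<and> j = c then g i j else 0) = (if i = a then (if c \<in> J a then g a c else 0) else 0)"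
      using assms(2)[of a] by (cases "i = a") simp_all
  qed
  then show ?thesis using assms(1) by simp
qed

lemma Rmat_eq:
  assumes "i \<in> I" "j \<in> I" "a \<in> I" "b \<in> I"
  shows "Rmat n m q (i, j, a, b) = (if a = i \<and> b = j then R_diag i j else 0)
    + q_diff * (if a = j \<and> b = i \<and> j < i then sig n j j else 0)
    - q_diff * (if j = - i \<and> b = - a \<and> a < i then sig n a a * sig n i i * sig n a i * inverse (cc i) * cc a else 0)"
proof -
  have 1: "(\<Sum>x\<in>I. q powi (sig n x x) * EE x x x x (i, j, a, b)) = (if a = i \<and> b = j \<and> i = j then q powi (sig n i i) else 0)"
  proof -
    have "(\<Sum>x\<in>I. q powi (sig n x x) * EE x x x x (i, j, a, b)) =
      (\<Sum>x\<in>I. if x = i then (if a = i \<and> b = j \<and> i = j then q powi (sig n i i) else 0) else 0)"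
      by (intro sum.cong) (auto simp: EE_def)
    then show ?thesis using assms by simp
  qed
  have 2: "(\<Sum>x\<in>I. q powi (- sig n x x) * EE x x (- x) (- x) (i, j, a, b)) = (if a = i \<and> b = j \<and> i = - j then q powi (- sig n i i) else 0)"
  proof -
    have "(\<Sum>x\<in>I. q powi (- sig n x x) * EE x x (- x) (- x) (i, j, a, b)) =
      (\<Sum>x\<in>I. if x = i then (if a = i \<and> b = j \<and> i = - j then q powi (- sig n i i) else 0) else 0)"
      by (intro sum.cong) (auto simp: EE_def)
    then show ?thesis using assms by simp
  qed
  have 3: "(\<Sum>x\<in>I. \<Sum>y\<in>I - {x, - x}. EE x x y y (i, j, a, b)) = (if a = i \<and> b = j \<and> i \<noteq> j \<and> i \<noteq> - j then 1 else (0::'k))"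
  proof -
    have "(\<Sum>x\<in>I. \<Sum>y\<in>I - {x, - x}. EE x x y y (i, j, a, b)) =
      (\<Sum>x\<in>I. \<Sum>y\<in>I - {x, - x}. if x = i \<and> y = j then (if a = i \<and> b = j then 1 else 0) else (0::'k))"
      by (intro sum.cong) (auto simp: EE_def)
    then show ?thesis using assms by (subst (asm) sum_delta_pair) auto
  qed
  have 4: "(\<Sum>x\<in>I. \<Sum>y\<in>{y \<in> I. x < y}. sig n x x * EE y x x y (i, j, a, b)) = (if a = j \<and> b = i \<and> j < i then sig n j j else (0::'k))"
  proof -
    have "(\<Sum>x\<in>I. \<Sum>y\<in>{y \<in> I. x < y}. sig n x x * EE y x x y (i, j, a, b)) =
      (\<Sum>x\<in>I. \<Sum>y\<in>{y \<in> I. x < y}. if x = j \<and> y = i then (if a = j \<and> b = i then sig n j j else 0) else (0::'k))"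
      by (intro sum.cong) (auto simp: EE_def)
    then show ?thesis using assms by (subst (asm) sum_delta_pair) auto
  qed
  have 5: "(\<Sum>x\<in>I. \<Sum>y\<in>{y \<in> I. x < y}. sig n x x * sig n y y * sig n x y * Cq_inv n q (- y) y * Cq n q x (- x) * EE y x (- y) (- x) (i, j, a, b))
    = (if j = - i \<and> b = - a \<and> a < i then sig n a a * sig n i i * sig n a i * inverse (cc i) * cc a else 0)"
  proof -
    have "(\<Sum>x\<in>I. \<Sum>y\<in>{y \<in> I. x < y}. sig n x x * sig n y y * sig n x y * Cq_inv n q (- y) y * Cq n q x (- x) * EE y x (- y) (- x) (i, j, a, b)) =
      (\<Sum>x\<in>I. \<Sum>y\<in>{y \<in> I. x < y}. if x = a \<and> y = i then (if j = - i \<and> b = - a then sig n a a * sig n i i * sig n a i * inverse (cc i) * cc a else 0) else 0)"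
      by (intro sum.cong) (auto simp: EE_def Cq_inv_def cc_def)
    then show ?thesis using assms by (subst (asm) sum_delta_pair) auto
  qed
  \<comment> \<open>As 0 is not an index, \<open>i = j\<close> and \<open>i = - j\<close> exclude
    each other, and the three diagonal sums combine to \<open>R_diag\<close>.\<close>
  have "i \<noteq> 0" using assms by (simp add: idx_def)
  then have 6: "(if a = i \<and> b = j \<and> i = j then q powi (sig n i i) else 0) + (if a = i \<and> b = j \<and> i = - j then q powi (- sig n i i) else 0)
    + (if a = i \<and> b = j \<and> i \<noteq> j \<and> i \<noteq> - j then 1 else 0) = (if a = i \<and> b = j then R_diag i j else 0)"
    by (simp add: R_diag_def)
  show ?thesis
    unfolding Rmat_def 1 2 3 4 5 6 q_diff_def ..
qed

text \<open>The sign is \<sigma>(i,j) from the graded flip times \<sigma>(\<eta>_j - \<eta>_b,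
  \<eta>_a) from applying the graded product of \<open>E_{i,a}\<close> and \<open>E_{j,b}\<close> to
  a pair of basis vectors.\<close>

lemma flip_R_Rmat:
  assumes "i \<in> I" "j \<in> I"
  shows "(\<Sum>a\<in>I. \<Sum>b\<in>I. koszul (eta n i) (eta n j) * koszul (eta n j) (eta n a) * koszul (eta n a) (eta n b) * Rmat n m q (i, j, a, b) * f a b) = flip_R f j i"
proof -
  let ?K = "\<lambda>a b. koszul (eta n i) (eta n j) * koszul (eta n j) (eta n a) * koszul (eta n a) (eta n b) :: 'k"
  have "(\<Sum>a\<in>I. \<Sum>b\<in>I. ?K a b * Rmat n m q (i, j, a, b) * f a b) =
    (\<Sum>a\<in>I. \<Sum>b\<in>I. (if a = i \<and> b = j then koszul (eta n j) (eta n i) * R_diag j i * f i j else 0)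
      + q_diff * (if a = j \<and> b = i then (if j < i then f j i else 0) else 0)
      - q_diff * (if b = - a then (if j = - i then inverse (cc i) * (if a < i then cc a * f a (- a) else 0) else 0) else 0))"
  proof (intro sum.cong refl)
    fix a b assume ab: "a \<in> I" "b \<in> I"
    have 1: "?K a b * (if a = i \<and> b = j then R_diag i j else 0) * f a b = (if a = i \<and> b = j then koszul (eta n j) (eta n i) * R_diag j i * f i j else 0)"
    proof (cases "a = i \<and> b = j")
      case True
      have "R_diag i j = R_diag j i" by (auto simp: R_diag_def sig_def)
      moreover have "?K i j = koszul (eta n j) (eta n i)" by (simp add: koszul_comm)
      ultimately show ?thesis using True by (simp add: mult_ac)
    qed auto
    have 2: "?K a b * (if a = j \<and> b = i \<and> j < i then sig n j j else 0) * f a b = (if a = j \<and> b = i then (if j < i then f j i else 0) else 0)"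
    proof (cases "a = j \<and> b = i \<and> j < i")
      case True
      have "?K j i * sig n j j = 1" by (cases "eta n i"; cases "eta n j") (simp_all add: sig_def koszul_def)
      then show ?thesis using True by simp
    qed auto
    have 3: "?K a b * (if j = - i \<and> b = - a \<and> a < i then sig n a a * sig n i i * sig n a i * inverse (cc i) * cc a else 0) * f a b =
       (if b = - a then (if j = - i then inverse (cc i) * (if a < i then cc a * f a (- a) else 0) else 0) else 0)"
    proof (cases "j = - i \<and> b = - a \<and> a < i")
      case True
      then have "?K a b * (sig n a a * sig n i i * sig n a i) = 1"
        by (cases "eta n i"; cases "eta n a") (simp_all add: sig_def koszul_def)
      from arg_cong[OF this, of "\<lambda>x. x * (inverse (cc i) * cc a * f a b)"] True show ?thesis by (simp add: mult_ac)
    qed auto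
    have "?K a b * Rmat n m q (i, j, a, b) * f a b = ?K a b * (if a = i \<and> b = j then R_diag i j else 0) * f a b
      + q_diff * (?K a b * (if a = j \<and> b = i \<and> j < i then sig n j j else 0) * f a b)
      - q_diff * (?K a b * (if j = - i \<and> b = - a \<and> a < i then sig n a a * sig n i i * sig n a i * inverse (cc i) * cc a else 0) * f a b)"
      unfolding Rmat_eq[OF assms ab] by (simp only: algebra_simps)
    then show "?K a b * Rmat n m q (i, j, a, b) * f a b = (if a = i \<and> b = j then koszul (eta n j) (eta n i) * R_diag j i * f i j else 0)
      + q_diff * (if a = j \<and> b = i then (if j < i then f j i else 0) else 0)
      - q_diff * (if b = - a then (if j = - i then inverse (cc i) * (if a < i then cc a * f a (- a) else 0) else 0) else 0)"
      unfolding 1 2 3 .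
  qed
  also have "\<dots> = koszul (eta n j) (eta n i) * R_diag j i * f i j + q_diff * (if j < i then f j i else 0)
     - q_diff * (\<Sum>a\<in>I. (if j = - i then inverse (cc i) * (if a < i then cc a * f a (- a) else 0) else 0))"
    unfolding sum.distrib sum_subtractf sum_distrib_left[symmetric] using assms
    by (simp add: sum_delta_pair)
  also have "\<dots> = flip_R f j i"
    unfolding flip_R_def partial_contr_restrict by (simp add: sum_distrib_left)
  finally show ?thesis .
qed

section \<open>From generators to words: the RTT relations and the element Q\<close>

lemma tens_pair:
  "tens (UE k) F [x, y] = pair_E k (\<lambda>a b. F [a, b]) x y"
  "tens (UF k) F [x, y] = pair_F k (\<lambda>a b. F [a, b]) x y"
  by (simp_all add: pair_E_def pair_F_def algebra_simps)

definition flip_R_list :: "(int list \<Rightarrow> 'k) \<Rightarrow> int list \<Rightarrow> 'k" where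
  "flip_R_list F = (\<lambda>ls. flip_R (\<lambda>a b. F [a, b]) (ls ! 0) (ls ! 1))"

lemma flip_R_list_tens:
  assumes "g \<in> G" "x \<in> I" "y \<in> I"
  shows "flip_R_list (tens g F) [x, y] = tens g (flip_R_list F) [x, y]"
proof (cases g)
  case (UK k)
  then show ?thesis using flip_R_diagonal[of "kap k" "\<lambda>a b. F [a, b]" x y]
    by (simp add: flip_R_list_def mult.assoc)
next
  case (UKinv k)
  then show ?thesis using flip_R_diagonal[of "kapi k" "\<lambda>a b. F [a, b]" x y]
    by (simp add: flip_R_list_def mult.assoc)
next
  case (UE k)
  then have "k \<in> L" using assms by (auto simp: uq_gens_def)
  from flip_R_E[OF this assms(2,3), of "\<lambda>a b. F [a, b]"] show ?thesis
    unfolding UE flip_R_list_def tens_pair by simp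
next
  case (UF k)
  then have "k \<in> L" using assms by (auto simp: uq_gens_def)
  from flip_R_F[OF this assms(2,3), of "\<lambda>a b. F [a, b]"] show ?thesis
    unfolding UF flip_R_list_def tens_pair by simp
qed

lemma idx_lists_2: "ks \<in> idx_lists 2 \<longleftrightarrow> (\<exists>a b. ks = [a, b] \<and> a \<in> I \<and> b \<in> I)"
  by (auto simp: idx_lists_def numeral_2_eq_2 length_Suc_conv)

lemma flip_R_list_foldr:
  assumes "set w \<subseteq> G" "x \<in> I" "y \<in> I"
  shows "flip_R_list (foldr tens w F) [x, y] = foldr tens w (flip_R_list F) [x, y]"
  using assms
proof (induction w arbitrary: x y)
  case (Cons g w)
  have "flip_R_list (foldr tens (g # w) F) [x, y] = tens g (flip_R_list (foldr tens w F)) [x, y]"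
    using Cons.prems by (simp add: flip_R_list_tens)
  also have "\<dots> = tens g (foldr tens w (flip_R_list F)) [x, y]"
    by (rule tens_local[of _ _ 2]) (use Cons in \<open>auto simp: idx_lists_2\<close>)
  finally show ?case by simp
qed simp

lemma sum_idx_lists_2: "(\<Sum>ks\<in>idx_lists 2. h ks) = (\<Sum>a\<in>I. \<Sum>b\<in>I. h [a, b])"
  by (simp add: numeral_2_eq_2 sum_idx_lists_Suc)

lemma word_form_pair: "word_form (FM [(a, k)] + FM [(b, l)]) (FM w) = koszul (eta n b + eta n l) (eta n a) * mat w [a, b] [k, l]"
  by (simp add: word_form_def plus_free_monoid_def tdeg_def add.commute)

text \<open>Up to a common sign the two sums are the entries of \<open>flip_R\<close> composed with
  the action of \<open>w\<close> in either order, so the relation states that \<open>flip_R\<close>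
  is an intertwiner.\<close>

lemma ev_rtt:
  assumes I: "i \<in> I" "j \<in> I" "k \<in> I" "l \<in> I" and w: "set w \<subseteq> G"
  shows "ev (\<lambda>u. word_form u (FM w)) (rtt n m q i j k l) = 0"
proof -
  \<comment> \<open>The part of the signs free of the summation indices; it is the same for both
    sums.\<close>
  let ?s = "koszul (eta n l) (eta n k) * koszul (eta n i) (eta n j) * koszul (eta n j) (eta n k) :: 'k"
  let ?Y = "\<lambda>i j a b. koszul (eta n i) (eta n j) * koszul (eta n j) (eta n a) * koszul (eta n a) (eta n b) * Rmat n m q (i, j, a, b)"
  have "(\<Sum>a\<in>I. \<Sum>b\<in>I. koszul (eta n j - eta n l) (eta n a - eta n k) * Rmat n m q (i, j, a, b) * word_form (FM [(a, k)] + FM [(b, l)]) (FM w))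
    = ?s * (\<Sum>a\<in>I. \<Sum>b\<in>I. ?Y i j a b * mat w [a, b] [k, l])"
    unfolding sum_distrib_left word_form_pair
  proof (intro sum.cong refl)
    fix a b
    show "koszul (eta n j - eta n l) (eta n a - eta n k) * Rmat n m q (i, j, a, b) * (koszul (eta n b + eta n l) (eta n a) * mat w [a, b] [k, l]) =
      ?s * (?Y i j a b * mat w [a, b] [k, l])"
      by (cases "eta n i"; cases "eta n j"; cases "eta n k"; cases "eta n l"; cases "eta n a"; cases "eta n b") (simp_all add: koszul_def)
  qed
  also have "(\<Sum>a\<in>I. \<Sum>b\<in>I. ?Y i j a b * mat w [a, b] [k, l]) = flip_R_list (foldr tens w (delta [k, l])) [j, i]"
    using flip_R_Rmat[OF I(1,2), of "\<lambda>a b. mat w [a, b] [k, l]"] by (simp add: flip_R_list_def mat_def)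
  also have "\<dots> = foldr tens w (flip_R_list (delta [k, l])) [j, i]"
    by (rule flip_R_list_foldr[OF w I(2,1)])
  also have "\<dots> = (\<Sum>b\<in>I. \<Sum>a\<in>I. mat w [j, i] [b, a] * flip_R (\<lambda>a b. delta [k, l] [a, b]) b a)"
    using foldr_tens_expand[OF w, of "[j, i]" 2 "flip_R_list (delta [k, l])"] I by (simp add: idx_lists_2 sum_idx_lists_2 flip_R_list_def)
  also have "\<dots> = (\<Sum>b\<in>I. \<Sum>a\<in>I. mat w [j, i] [b, a] * ?Y a b k l)"
  proof (intro sum.cong refl)
    fix a b assume ab: "b \<in> I" "a \<in> I"
    have "flip_R (\<lambda>a b. delta [k, l] [a, b]) b a = (\<Sum>c\<in>I. \<Sum>d\<in>I. ?Y a b c d * delta [k, l] [c, d])"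
      using flip_R_Rmat[OF ab(2,1), of "\<lambda>a b. delta [k, l] [a, b]"] by simp
    also have "\<dots> = (\<Sum>c\<in>I. \<Sum>d\<in>I. if c = k \<and> d = l then ?Y a b c d else 0)"
      by (intro sum.cong) (auto simp: delta_def)
    also have "\<dots> = ?Y a b k l" using I by (simp add: sum_delta_pair)
    finally show "mat w [j, i] [b, a] * flip_R (\<lambda>a b. delta [k, l] [a, b]) b a = mat w [j, i] [b, a] * ?Y a b k l" by simp
  qed
  also have "\<dots> = (\<Sum>a\<in>I. \<Sum>b\<in>I. mat w [j, i] [b, a] * ?Y a b k l)" by (rule sum.swap)
  also have "?s * \<dots> = (\<Sum>a\<in>I. \<Sum>b\<in>I. koszul (eta n j - eta n b) (eta n a - eta n k) * Rmat n m q (a, b, k, l) * word_form (FM [(j, b)] + FM [(i, a)]) (FM w))"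
    unfolding sum_distrib_left word_form_pair
  proof (intro sum.cong refl)
    fix a b
    show "?s * (mat w [j, i] [b, a] * ?Y a b k l) =
      koszul (eta n j - eta n b) (eta n a - eta n k) * Rmat n m q (a, b, k, l) * (koszul (eta n i + eta n a) (eta n j) * mat w [j, i] [b, a])"
      by (cases "eta n i"; cases "eta n j"; cases "eta n k"; cases "eta n l"; cases "eta n a"; cases "eta n b") (simp_all add: koszul_def)
  qed
  finally show ?thesis
    unfolding rtt_def by simp
qed

lemma contr_foldr:
  assumes "set w \<subseteq> G"
  shows "contr (\<lambda>a b. foldr tens w F [a, b]) = prod_list (map uq_counit w) * contr (\<lambda>a b. F [a, b])"
  using assms
proof (induction w)
  case (Cons g w)
  let ?F = "foldr tens w F"
  have "contr (\<lambda>a b. tens g ?F [a, b]) = uq_counit g * contr (\<lambda>a b. ?F [a, b])"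
  proof (cases g)
    case (UE k)
    then have "k \<in> L" using Cons.prems by (auto simp: uq_gens_def)
    then show ?thesis unfolding UE tens_pair by (simp add: contr_E)
  next
    case (UF k)
    then have "k \<in> L" using Cons.prems by (auto simp: uq_gens_def)
    then show ?thesis unfolding UF tens_pair by (simp add: contr_F)
  qed (simp_all add: contr_def)
  then show ?case using Cons by simp
qed simp

text \<open>Q contracts the row indices with C. By invariance, pairing with \<open>w\<close> gives
  its counit times \<open>cc k\<close>; the normalisation of Q removes \<open>cc k\<close>, and the
  counit is also the value of the unit on \<open>w\<close>.\<close>

lemma ev_Qelt:
  assumes "k \<in> I" "set w \<subseteq> G"
  shows "ev (\<lambda>u. word_form u (FM w)) (Qelt n m q k - 1) = 0"
proof -
  have "(\<Sum>a\<in>I. \<Sum>b\<in>I. sig n a k * sig n b a * Cq n q a b * word_form (FM [(a, k)] + FM [(b, - k)]) (FM w)) =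
    (\<Sum>a\<in>I. cc a * mat w [a, - a] [k, - k])"
  proof (intro sum.cong refl)
    fix a assume a: "a \<in> I"
    have "(\<Sum>b\<in>I. sig n a k * sig n b a * Cq n q a b * word_form (FM [(a, k)] + FM [(b, - k)]) (FM w)) =
      (\<Sum>b\<in>I. if b = - a then cc a * mat w [a, - a] [k, - k] else 0)"
    proof (intro sum.cong refl)
      fix b
      show "sig n a k * sig n b a * Cq n q a b * word_form (FM [(a, k)] + FM [(b, - k)]) (FM w) =
        (if b = - a then cc a * mat w [a, - a] [k, - k] else 0)"
        unfolding word_form_pair
        by (cases "eta n a"; cases "eta n k") (auto simp: sig_def koszul_def cc_def Cq_def)
    qed
    then show "(\<Sum>b\<in>I. sig n a k * sig n b a * Cq n q a b * word_form (FM [(a, k)] + FM [(b, - k)]) (FM w)) =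
      cc a * mat w [a, - a] [k, - k]" using a by simp
  qed
  also have "\<dots> = contr (\<lambda>a b. foldr tens w (delta [k, - k]) [a, b])"
    by (simp add: contr_def mat_def)
  also have "\<dots> = prod_list (map uq_counit w) * contr (\<lambda>a b. delta [k, - k] [a, b])"
    by (rule contr_foldr[OF assms(2)])
  also have "contr (\<lambda>a b. delta [k, - k] [a, b]) = (\<Sum>a\<in>I. if a = k then cc k else 0)"
    unfolding contr_def by (intro sum.cong) (auto simp: delta_def)
  finally have "(\<Sum>a\<in>I. \<Sum>b\<in>I. sig n a k * sig n b a * Cq n q a b * word_form (FM [(a, k)] + FM [(b, - k)]) (FM w)) =
    prod_list (map uq_counit w) * cc k" using assms by simp
  then show ?thesis
    using word_form_unit_left[of "FM w"] assms cc_nonzero[of k]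
    by (simp add: Qelt_def flip: cc_def)
qed

section \<open>The pairing\<close>

lemma rtt_carrier:
  assumes "i \<in> I" "j \<in> I" "k \<in> I" "l \<in> I"
  shows "Poly_Mapping.keys (rtt n m q i j k l) \<subseteq> words T"
proof -
  have s: "Poly_Mapping.keys (scal c (gen x * gen y :: (int \<times> int, 'k) free_algebra)) \<subseteq> words T" if "x \<in> T" "y \<in> T" for c x y
    using that keys_scal[of c "gen x * gen y :: (int \<times> int, 'k) free_algebra"]
    by (auto simp: gen_def mult_single plus_free_monoid_def)
  have sum: "Poly_Mapping.keys (sum f S) \<subseteq> words T" if "\<And>x. x \<in> S \<Longrightarrow> Poly_Mapping.keys (f x) \<subseteq> words T"
    for f :: "int \<Rightarrow> (int \<times> int, 'k) free_algebra" and S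
    using Poly_Mapping.keys_sum[of f S] that by blast
  show ?thesis unfolding rtt_def
    by (rule order_trans[OF keys_diff]) (intro Un_least sum s; use assms in simp)
qed

lemma Qelt_carrier:
  assumes "k \<in> I"
  shows "Poly_Mapping.keys (Qelt n m q k - 1) \<subseteq> words T"
proof -
  have s: "Poly_Mapping.keys (scal c (gen x * gen y :: (int \<times> int, 'k) free_algebra)) \<subseteq> words T" if "x \<in> T" "y \<in> T" for c x y
    using that keys_scal[of c "gen x * gen y :: (int \<times> int, 'k) free_algebra"]
    by (auto simp: gen_def mult_single plus_free_monoid_def)
  have sum: "Poly_Mapping.keys (sum f S) \<subseteq> words T" if "\<And>x. x \<in> S \<Longrightarrow> Poly_Mapping.keys (f x) \<subseteq> words T"
    for f :: "int \<Rightarrow> (int \<times> int, 'k) free_algebra" and S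
    using Poly_Mapping.keys_sum[of f S] that by blast
  have "Poly_Mapping.keys (Qelt n m q k) \<subseteq> words T"
    unfolding Qelt_def by (rule order_trans[OF keys_scal]) (intro sum s; use assms in simp)
  then show ?thesis using keys_diff[of "Qelt n m q k" 1] by auto
qed

lemma presentation_spo: "presentation T (spo_rels n m q) (spo_comult n m) (spo_antipode n q)"
proof
  show "spo_rels n m q \<subseteq> carrier (free_alg T)"
    using rtt_carrier Qelt_carrier by (auto simp: spo_rels_def carrier_free_alg subset_iff)
  show "Poly_Mapping.keys (spo_comult n m x :: _ \<Rightarrow>\<^sub>0 'k) \<subseteq> words T \<times> words T" if "x \<in> T" for x
  proof -
    obtain i j where [simp]: "x = (i, j)" by fastforce
    have "Poly_Mapping.keys (spo_comult n m x :: _ \<Rightarrow>\<^sub>0 'k) \<subseteq>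
      (\<Union>k\<in>I. Poly_Mapping.keys (Poly_Mapping.single (FM [(i, k)], FM [(k, j)]) (koszul (eta n k - eta n i) (eta n k - eta n j) :: 'k)))"
      unfolding spo_comult_def using Poly_Mapping.keys_sum by fastforce
    then show ?thesis using that by (auto split: if_splits)
  qed
  show "spo_antipode n q x \<in> carrier (free_alg T)" if "x \<in> T" for x
  proof -
    obtain i j where [simp]: "x = (i, j)" by fastforce
    show ?thesis using that
      by (auto simp: spo_antipode_eq carrier_free_alg gen_def)
  qed
qed

lemma keys_subst_gens: "Poly_Mapping.keys (subst_gens g x) \<subseteq> (\<lambda>w. FM (map g (letters w))) ` Poly_Mapping.keys x"
  unfolding subst_gens_def using keys_lin_ext[of "\<lambda>w. Poly_Mapping.single (FM (map g (letters w))) 1" x] by fastforce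

lemma presentation_uq: "presentation G (uq_rels n m q) uq_comult (uq_antipode :: _ \<Rightarrow> (uq_gen, 'k) free_algebra)"
proof
  show "Poly_Mapping.keys (uq_comult x :: _ \<Rightarrow>\<^sub>0 'k) \<subseteq> words G \<times> words G" if "x \<in> G" for x
    using uq_comult_words[OF that] .
  show "(uq_antipode x :: (uq_gen, 'k) free_algebra) \<in> carrier (free_alg G)" if "x \<in> G" for x
    using uq_antipode_words[OF that] by (simp add: carrier_free_alg)
  have "serre_space n m q \<subseteq> {x. Poly_Mapping.keys x \<subseteq> words L}"
    unfolding serre_space_def
  proof (rule scal.span_minimal)
    have "Poly_Mapping.keys (x + y) \<subseteq> words L" if "Poly_Mapping.keys x \<subseteq> words L" "Poly_Mapping.keys y \<subseteq> words L"
      for x y :: "(nat, 'k) free_algebra"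
      using that Poly_Mapping.keys_add[of x y] by blast
    moreover have "Poly_Mapping.keys (scal c x) \<subseteq> words L" if "Poly_Mapping.keys x \<subseteq> words L"
      for c and x :: "(nat, 'k) free_algebra"
      using that keys_scal[of c x] by blast
    ultimately show "scal.subspace {x :: (nat, 'k) free_algebra. Poly_Mapping.keys x \<subseteq> words L}"
      by (simp add: scal.subspace_def)
  qed (auto simp: carrier_free_alg)
  then have serre: "Poly_Mapping.keys (subst_gens g x) \<subseteq> words G" if "x \<in> serre_space n m q" "g ` L \<subseteq> G" for x g
    using that keys_subst_gens[of g x] by (fastforce simp: words_def)
  have EF: "UE ` L \<subseteq> G" "UF ` L \<subseteq> G" by (auto simp: uq_gens_def)
  let ?g = "gen :: _ \<Rightarrow> (uq_gen, 'k) free_algebra"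
  have d: "p - p' \<in> carrier (free_alg G)" if "p \<in> carrier (free_alg G)" "p' \<in> carrier (free_alg G)"
    for p p' :: "(uq_gen, 'k) free_algebra"
    using that keys_diff[of p p'] by (auto simp: carrier_free_alg)
  have s: "scal c p \<in> carrier (free_alg G)" if "p \<in> carrier (free_alg G)" for c and p :: "(uq_gen, 'k) free_algebra"
    using that keys_scal[of c p] by (auto simp: carrier_free_alg)
  have g: "?g x \<in> carrier (free_alg G)" "?g x * ?g y \<in> carrier (free_alg G)" "?g x * ?g y * ?g z \<in> carrier (free_alg G)"
    if "x \<in> G" "y \<in> G" "z \<in> G" for x y z
    using that by (simp_all add: carrier_free_alg gen_def mult_single plus_free_monoid_def)
  have "utilde_rels n m q \<subseteq> carrier (free_alg G)"
  proof
    fix r assume "r \<in> utilde_rels n m q"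
    then obtain j k where jk: "j \<in> L" "k \<in> L" and r: "r \<in>
     {?g (UK j) * gen (UK k) - gen (UK k) * gen (UK j),
      gen (UK j) * gen (UKinv k) - gen (UKinv k) * gen (UK j),
      gen (UKinv j) * gen (UKinv k) - gen (UKinv k) * gen (UKinv j),
      gen (UK j) * gen (UKinv j) - 1,
      gen (UK j) * gen (UE k) * gen (UKinv j) - scal (q powi (form n m (sroot j) (sroot k))) (gen (UE k)),
      gen (UK j) * gen (UF k) * gen (UKinv j) - scal (q powi (- form n m (sroot j) (sroot k))) (gen (UF k)),
      gen (UE j) * gen (UF k) - scal (koszul (rdeg n j) (rdeg n k)) (gen (UF k) * gen (UE j))
        - (if j = k then scal (inverse (qj q j - inverse (qj q j))) (gen (UK j) - gen (UKinv j)) else 0)}"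
      unfolding utilde_rels_def by blast
    have G: "UK j \<in> G" "UK k \<in> G" "UKinv j \<in> G" "UKinv k \<in> G" "UE j \<in> G" "UE k \<in> G" "UF j \<in> G" "UF k \<in> G"
      using jk by (auto simp: uq_gens_def)
    have 1: "(1 :: (uq_gen, 'k) free_algebra) \<in> carrier (free_alg G)" "(0 :: (uq_gen, 'k) free_algebra) \<in> carrier (free_alg G)"
      by (simp_all add: carrier_free_alg)
    show "r \<in> carrier (free_alg G)"
      using r G by (auto intro!: d s g 1)
  qed
  then show "uq_rels n m q \<subseteq> carrier (free_alg G)"
    using serre[OF _ EF(1)] serre[OF _ EF(2)] unfolding uq_rels_def by (auto simp: carrier_free_alg)
qed

sublocale P: hopf_word_pairing T "tdeg n" "spo_rels n m q" "spo_comult n m" "\<lambda>(i, j). if i = j then 1 else 0" "spo_antipode n q"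
  G "uq_deg n" "uq_rels n m q" uq_comult uq_counit uq_antipode word_form
proof -
  interpret A: presentation T "tdeg n" "spo_rels n m q" "spo_comult n m" "\<lambda>(i, j). if i = j then 1 else 0" "spo_antipode n q"
    by (rule presentation_spo)
  interpret H: presentation G "uq_deg n" "uq_rels n m q" uq_comult uq_counit uq_antipode
    by (rule presentation_uq)
  show "hopf_word_pairing T (tdeg n) (spo_rels n m q) (spo_comult n m) (\<lambda>(i, j). if i = j then 1 else 0) (spo_antipode n q)
    G (uq_deg n) (uq_rels n m q) uq_comult uq_counit uq_antipode word_form"
  proof unfold_locales
    show "ev (\<lambda>w. word_form w y) r = 0" if "r \<in> spo_rels n m q" "y \<in> words G" for r y
      using that ev_rtt[of _ _ _ _ "letters y"] ev_Qelt[of _ "letters y"] unfolding spo_rels_def by (auto simp: words_def)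
    show "ev (\<lambda>w. word_form u w) r = 0" if "r \<in> uq_rels n m q" "u \<in> words T" for r u
    proof -
      have "set (rows (letters u)) \<subseteq> I" using rows_cols_idx_lists[of "letters u"] that(2) by (auto simp: words_def idx_lists_def)
      from ev_uq_rels[OF that(1) this] show ?thesis
        unfolding word_form_def ev_fun_mult mat_def by simp
    qed
    show "word_form u y = 0" if "u \<in> words T" "y \<in> words G" "wdeg (tdeg n) u \<noteq> wdeg (uq_deg n) y" for u y
      by (rule word_form_even[OF that])
    show "word_form u y = 0" if "y \<in> words G" "u \<in> words T" "wdeg (uq_deg n) y \<noteq> wdeg (tdeg n) u" for u y
      by (rule word_form_even) (use that in auto)
    show "word_form 0 y = prod_list (map uq_counit (letters y))" if "y \<in> words G" for y by (rule word_form_unit_left[OF that])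
    show "word_form u 0 = prod_list (map (\<lambda>(i, j). if i = j then 1 else 0) (letters u))" for u by (rule word_form_unit_right)
    show "word_form (u + v) y = koszul (wdeg (tdeg n) u) (wdeg (tdeg n) v) * ev (\<lambda>(y1, y2). word_form u y1 * word_form v y2) (uqc (letters y))"
      if "u \<in> words T" "v \<in> words T" "y \<in> words G" for u v y by (rule word_form_mult_left[OF that])
    show "word_form u (y + y') = koszul (wdeg (uq_deg n) y) (wdeg (uq_deg n) y') * ev (\<lambda>(u1, u2). word_form u1 y * word_form u2 y') (spc (letters u))"
      if "y \<in> words G" "y' \<in> words G" "u \<in> words T" for u y y' by (rule word_form_mult_right[OF that(3,1,2)])
    show "ev (\<lambda>w. word_form w (FM y)) (list_antipode (tdeg n) (spo_antipode n q) u) = ev (word_form (FM u)) (list_antipode (uq_deg n) uq_antipode y)"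
      if "set u \<subseteq> T" "set y \<subseteq> G" for u y by (rule word_form_antipode[OF that])
  qed
qed

text \<open>A one-letter word has trivial \<open>word_sign\<close>, and on a single tensor factor
  \<open>tens\<close> is the vector representation.\<close>

lemma class_form_t:
  assumes "i \<in> I" "j \<in> I" "h \<in> carrier (Uq_spo n m q)"
  shows "P.pairing (spo_t n m q i j, h) = vec_rep_elem n m q i j h"
proof -
  have h: "h \<in> carrier P.L.H.H" using assms(3) by (simp add: Uq_spo_def)
  have g: "gen (i, j) \<in> carrier P.L.A.F" using assms by (simp add: carrier_free_alg gen_def)
  have r: "rep h \<in> carrier P.L.H.F" "P.L.H.cl (rep h) = h"
    using h P.L.H.rep_carrier P.L.H.cl_rep by simp_all
  have "P.pairing (spo_t n m q i j, h) = P.L.class_form (P.L.A.cl (gen (i, j))) (P.L.H.cl (rep h))"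
    unfolding spo_t_def r by (rule P.pairing_eq[OF _ h]) (use g in simp)
  also have "\<dots> = ev (word_form (FM [(i, j)])) (rep h)"
    unfolding P.L.class_form_cl[OF g r(1)] P.L.free_form_def by simp
  also have "\<dots> = ev (\<lambda>w. foldr (vec_gen n m q) (letters w) (ebasis j) i) (rep h)"
    by (rule P.L.H.ev_carrier_cong[OF r(1)]) (simp add: word_form_def words_def mat_single tdeg_def)
  also have "\<dots> = vec_rep_elem n m q i j h"
    by (simp add: vec_rep_elem_def vec_rep_def free_vec_rep_def ev_def)
  finally show ?thesis .
qed

end

theorem theorem3:
  fixes q :: "'k::field_char_0" and n m :: nat
  assumes "q \<noteq> 0" and "\<forall>k>0. q ^ k \<noteq> 1" and "n \<ge> 1" and "m \<ge> 1"
  shows "\<exists>!\<phi>. \<phi> \<in> carrier (SPO n m q) \<times> carrier (Uq_spo n m q) \<rightarrow>\<^sub>E UNIV \<and>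
    hopf_pairing (SPO n m q) (Uq_spo n m q) \<phi> \<and>
    (\<forall>i\<in>idx n m. \<forall>j\<in>idx n m. \<forall>h\<in>carrier (Uq_spo n m q).
       \<phi> (spo_t n m q i j, h) = vec_rep_elem n m q i j h)"
proof -
  interpret spo n m q by unfold_locales (use assms in auto)
  show ?thesis
  proof (rule ex_ex1I, rule exI[of _ P.pairing], intro conjI ballI)
    show "P.pairing \<in> carrier (SPO n m q) \<times> carrier (Uq_spo n m q) \<rightarrow>\<^sub>E UNIV"
      unfolding P.pairing_def SPO_def Uq_spo_def by (rule restrict_PiE_iff[THEN iffD2]) simp
    show "hopf_pairing (SPO n m q) (Uq_spo n m q) P.pairing"
      unfolding SPO_def Uq_spo_def by (rule P.hopf_pairing)
    show "P.pairing (spo_t n m q i j, h) = vec_rep_elem n m q i j h"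
      if "i \<in> idx n m" "j \<in> idx n m" "h \<in> carrier (Uq_spo n m q)" for i j h
      by (rule class_form_t[OF that])
  next
    fix \<phi> \<psi>
    assume \<phi>: "\<phi> \<in> carrier (SPO n m q) \<times> carrier (Uq_spo n m q) \<rightarrow>\<^sub>E UNIV \<and>
      hopf_pairing (SPO n m q) (Uq_spo n m q) \<phi> \<and>
      (\<forall>i\<in>idx n m. \<forall>j\<in>idx n m. \<forall>h\<in>carrier (Uq_spo n m q). \<phi> (spo_t n m q i j, h) = vec_rep_elem n m q i j h)"
    assume \<psi>: "\<psi> \<in> carrier (SPO n m q) \<times> carrier (Uq_spo n m q) \<rightarrow>\<^sub>E UNIV \<and>
      hopf_pairing (SPO n m q) (Uq_spo n m q) \<psi> \<and>
      (\<forall>i\<in>idx n m. \<forall>j\<in>idx n m. \<forall>h\<in>carrier (Uq_spo n m q). \<psi> (spo_t n m q i j, h) = vec_rep_elem n m q i j h)"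
    show "\<phi> = \<psi>"
    \<comment> \<open>Extensionality reduces the equality to the carriers, where the values on the
      generators decide.\<close>
    proof (rule PiE_ext[OF conjunct1[OF \<phi>] conjunct1[OF \<psi>]], clarify)
      fix a h assume "a \<in> carrier (SPO n m q)" "h \<in> carrier (Uq_spo n m q)"
      then show "\<phi> (a, h) = \<psi> (a, h)"
        unfolding SPO_def Uq_spo_def
        by (rule hopf_pairing_unique[OF presentation_spo presentation_uq, rotated 3])
          (use \<phi> \<psi> in \<open>auto simp: SPO_def Uq_spo_def spo_t_def simp del: presented_sel\<close>)
    qed
  qed
qed

end
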